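(* The $\mathsf{KS}_2\big(1/(4\sqrt{2})\big)$ problem is $\mathsf{FNP}$-hard for general values of $d$. Moreover, it is $\mathsf{NP}$-hard to distinguish between instances $\mathcal{I}$ of the $\mathsf{KS}_2(c)$ problem with $\mathcal{W}(\mathcal{I})=0$ and instances with $\mathcal{W}(\mathcal{I})\ge\frac{1}{4\sqrt{2}}\sqrt{\alpha}$.
   Context: For a constant $c>0$, an instance of the $\mathsf{KS}_2(c)$ problem is a set $\mathcal{I}=\{v_1,\dots,v_m\}$ of vectors in $\mathbb{R}^d$ with $\|v_i\|^2\le\alpha$ for all $i$ and $\sum_{i=1}^m\langle v_i,x\rangle^2=1$ for every unit $x\in\mathbb{R}^d$; the problem asks to find $S\subset[m]$ with $\big|\sum_{i\in S}\langle v_i,x\rangle^2-\frac12\big|\le c\sqrt{\alpha}$ for all unit $x\in\mathbb{R}^d$, or report that no such $S$ exists. For an instance $\mathcal{I}$, define \[\mathcal{W}(\mathcal{I})=\min_{S\subset\mathcal{I}}\ \max_{x\in\mathbb{R}^d,\ \|x\|=1}\Big|\sum_{v\in S}\langle v,x\rangle^2-\frac12\Big|.\] The class $\mathsf{FNP}$ consists of function problems given by a binary relation $R$ (on input $X$, find $Y$ with $R(X,Y)$ or report that none exists) such that $R(X,Y)$ can be checked in deterministic polynomial time; a function problem is $\mathsf{FNP}$-hard if every problem in $\mathsf{FNP}$ reduces to it in polynomial time. $\mathsf{KS}_2(c)$ is viewed as the function problem with relation $R(\mathcal{I},Y)$ holding iff $Y\subseteq\mathcal{I}$ satisfies the displayed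 discrepancy condition. *)

theory Defs
  imports Complex_Main "Jordan_Normal_Form.Matrix"
begin

section \<open>Deterministic multi-tape Turing machines\<close>

text \<open>
  A machine with \<^term>\<open>n\<close> working states uses the states \<^term>\<open>{..<n}\<close>, starts in state 0, and
  halts upon entering the additional state \<^term>\<open>n\<close>. Tapes are infinite in both directions.
  Symbol 0 is the blank, symbols 1 and 2 are the two bits; further symbols are at the machine's
  disposal.
\<close>

datatype move = Move_Left | Stay | Move_Right

record tm =
  tm_tapes :: nat
  tm_states :: nat
  tm_symbols :: nat
  tm_delta :: "nat \<Rightarrow> nat list \<Rightarrow> nat \<times> (nat \<times> move) list"

type_synonym tape = "(int \<Rightarrow> nat) \<times> int"
type_synonym config = "nat \<times> tape list"

text \<open>Outside the finite domain described here the transition function is irrelevant.\<close>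

definition tm_wf :: "tm \<Rightarrow> bool" where
  "tm_wf M \<longleftrightarrow> 1 \<le> tm_tapes M \<and> 3 \<le> tm_symbols M \<and>
     (\<forall>q < tm_states M. \<forall>ss. length ss = tm_tapes M \<and> set ss \<subseteq> {..<tm_symbols M} \<longrightarrow>
        (case tm_delta M q ss of (q', acts) \<Rightarrow>
           q' \<le> tm_states M \<and> length acts = tm_tapes M \<and> (\<forall>(s, mv) \<in> set acts. s < tm_symbols M)))"

fun shift :: "move \<Rightarrow> int" where
  "shift Move_Left = - 1"
| "shift Stay = 0"
| "shift Move_Right = 1"

fun read_tape :: "tape \<Rightarrow> nat" where
  "read_tape (w, h) = w h"

fun act_tape :: "nat \<times> move \<Rightarrow> tape \<Rightarrow> tape" where
  "act_tape (s, mv) (w, h) = (w(h := s), h + shift mv)"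

fun tm_step :: "tm \<Rightarrow> config \<Rightarrow> config" where
  "tm_step M (q, ts) =
     (if q = tm_states M then (q, ts)
      else (case tm_delta M q (map read_tape ts) of (q', acts) \<Rightarrow> (q', map2 act_tape acts ts)))"

definition string_tape :: "bool list \<Rightarrow> int \<Rightarrow> nat" where
  "string_tape x i = (if 0 \<le> i \<and> i < int (length x) then (if x ! nat i then 2 else 1) else 0)"

text \<open>The arguments are written on the first tapes, one per tape; all other tapes are blank.\<close>

definition tm_init :: "tm \<Rightarrow> bool list list \<Rightarrow> config" where
  "tm_init M xs =
     (0, map (\<lambda>i. (string_tape (if i < length xs then xs ! i else []), 0)) [0..<tm_tapes M])"

text \<open>The output is the content of the first tape at halting time.\<close>

definition tm_computes_within :: "tm \<Rightarrow> bool list list \<Rightarrow> bool list \<Rightarrow> nat \<Rightarrow> bool" where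
  "tm_computes_within M xs y T \<longleftrightarrow>
     (\<exists>t \<le> T. case (tm_step M ^^ t) (tm_init M xs) of (q, ts) \<Rightarrow>
        q = tm_states M \<and> fst (hd ts) = string_tape y)"

definition polytime :: "nat \<Rightarrow> (bool list list \<Rightarrow> bool list) \<Rightarrow> bool" where
  "polytime n f \<longleftrightarrow>
     (\<exists>M c e. tm_wf M \<and> n \<le> tm_tapes M \<and>
        (\<forall>xs. length xs = n \<longrightarrow>
           tm_computes_within M xs (f xs) (c * (\<Sum>x\<leftarrow>xs. length x) ^ e + c)))"

definition polytime_fun :: "(bool list \<Rightarrow> bool list) \<Rightarrow> bool" where
  "polytime_fun f \<longleftrightarrow> polytime 1 (\<lambda>xs. f (xs ! 0))"

definition polytime_fun2 :: "(bool list \<Rightarrow> bool list \<Rightarrow> bool list) \<Rightarrow> bool" where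
  "polytime_fun2 g \<longleftrightarrow> polytime 2 (\<lambda>xs. g (xs ! 0) (xs ! 1))"

definition polytime_rel :: "(bool list \<Rightarrow> bool list \<Rightarrow> bool) \<Rightarrow> bool" where
  "polytime_rel R \<longleftrightarrow> polytime 2 (\<lambda>xs. [R (xs ! 0) (xs ! 1)])"


section \<open>FNP, NP and hardness\<close>

definition poly_balanced :: "(bool list \<Rightarrow> bool list \<Rightarrow> bool) \<Rightarrow> bool" where
  "poly_balanced R \<longleftrightarrow> (\<exists>c e. \<forall>x y. R x y \<longrightarrow> length y \<le> c * length x ^ e + c)"

definition FNP :: "(bool list \<Rightarrow> bool list \<Rightarrow> bool) set" where
  "FNP = {R. polytime_rel R \<and> poly_balanced R}"

definition NP :: "bool list set set" where
  "NP = {{x. \<exists>y. R x y} | R. polytime_rel R \<and> poly_balanced R}"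

text \<open>
  A function problem is given by the set \<open>D\<close> of strings that encode instances and a relation \<open>R\<close>.
  A reduction to it from \<open>Q\<close> maps every string to an encoded instance and turns every correct
  answer for that instance (a solution, or the report that there is none) into a correct answer
  for the original input.
\<close>

definition fnp_reduces ::
  "(bool list \<Rightarrow> bool list \<Rightarrow> bool) \<Rightarrow> bool list set \<Rightarrow> (bool list \<Rightarrow> bool list \<Rightarrow> bool) \<Rightarrow> bool" where
  "fnp_reduces Q D R \<longleftrightarrow>
     (\<exists>f g. polytime_fun f \<and> polytime_fun2 g \<and>
        (\<forall>x. f x \<in> D \<and>
             (\<forall>z. R (f x) z \<longrightarrow> Q x (g x z)) \<and>
             ((\<nexists>z. R (f x) z) \<longrightarrow> (\<nexists>y. Q x y))))"

definition FNP_hard :: "bool list set \<Rightarrow> (bool list \<Rightarrow> bool list \<Rightarrow> bool) \<Rightarrow> bool" where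
  "FNP_hard D R \<longleftrightarrow> (\<forall>Q \<in> FNP. fnp_reduces Q D R)"

text \<open>NP-hardness of the promise problem of telling the members of \<open>A\<close> from those of \<open>B\<close>.\<close>

definition NP_hard_to_distinguish :: "bool list set \<Rightarrow> bool list set \<Rightarrow> bool" where
  "NP_hard_to_distinguish A B \<longleftrightarrow>
     (\<forall>L \<in> NP. \<exists>f. polytime_fun f \<and> (\<forall>x. (x \<in> L \<longrightarrow> f x \<in> A) \<and> (x \<notin> L \<longrightarrow> f x \<in> B)))"


section \<open>The problem \<open>KS\<^sub>2(c)\<close>\<close>

definition unit_vecs :: "nat \<Rightarrow> real vec set" where
  "unit_vecs d = {x \<in> carrier_vec d. x \<bullet> x = 1}"

definition KS2_instance :: "nat \<Rightarrow> real \<Rightarrow> real vec set \<Rightarrow> bool" where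
  "KS2_instance d \<alpha> I \<longleftrightarrow>
     0 < d \<and> finite I \<and> I \<subseteq> carrier_vec d \<and> (\<forall>v \<in> I. v \<bullet> v \<le> \<alpha>) \<and>
     (\<forall>x \<in> unit_vecs d. (\<Sum>v\<in>I. (v \<bullet> x)\<^sup>2) = 1)"

definition KS2_solution :: "real \<Rightarrow> nat \<Rightarrow> real \<Rightarrow> real vec set \<Rightarrow> real vec set \<Rightarrow> bool" where
  "KS2_solution c d \<alpha> I S \<longleftrightarrow>
     S \<subseteq> I \<and> (\<forall>x \<in> unit_vecs d. \<bar>(\<Sum>v\<in>S. (v \<bullet> x)\<^sup>2) - 1 / 2\<bar> \<le> c * sqrt \<alpha>)"

definition KS2_W :: "nat \<Rightarrow> real vec set \<Rightarrow> real" where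
  "KS2_W d I = (MIN S \<in> Pow I. SUP x \<in> unit_vecs d. \<bar>(\<Sum>v\<in>S. (v \<bullet> x)\<^sup>2) - 1 / 2\<bar>)"


section \<open>Instances as strings\<close>

text \<open>
  Instances presented to a machine have rational data. Rationals are written in lowest terms with
  numerator and denominator in binary, least significant bit first.
\<close>

fun nat_bits :: "nat \<Rightarrow> bool list" where
  "nat_bits n = (if n = 0 then [] else odd n # nat_bits (n div 2))"

declare nat_bits.simps [simp del]

definition enc_list :: "('a \<Rightarrow> bool list) \<Rightarrow> 'a list \<Rightarrow> bool list" where
  "enc_list f xs = concat (map (\<lambda>x. True # f x) xs) @ [False]"

definition enc_nat :: "nat \<Rightarrow> bool list" where
  "enc_nat n = enc_list (\<lambda>b. [b]) (nat_bits n)"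

definition enc_int :: "int \<Rightarrow> bool list" where
  "enc_int i = (i < 0) # enc_nat (nat \<bar>i\<bar>)"

definition enc_rat :: "rat \<Rightarrow> bool list" where
  "enc_rat r = (case quotient_of r of (p, q) \<Rightarrow> enc_int p @ enc_int q)"

definition enc_vec :: "rat vec \<Rightarrow> bool list" where
  "enc_vec v = enc_list enc_rat (list_of_vec v)"

text \<open>
  The dimension is not written separately: instances are nonempty, and it is the length of each of
  their vectors.
\<close>

definition enc_KS2 :: "rat \<Rightarrow> rat vec list \<Rightarrow> bool list" where
  "enc_KS2 \<alpha> vs = enc_rat \<alpha> @ enc_list enc_vec vs"

abbreviation real_vec :: "rat vec \<Rightarrow> real vec" where
  "real_vec \<equiv> map_vec real_of_rat"

text \<open>The list enumerates the set of vectors without repetition.\<close>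

definition KS2_code :: "nat \<Rightarrow> rat \<Rightarrow> rat vec list \<Rightarrow> bool" where
  "KS2_code d \<alpha> vs \<longleftrightarrow> distinct vs \<and> KS2_instance d (of_rat \<alpha>) (real_vec ` set vs)"

definition KS2_codes :: "bool list set" where
  "KS2_codes = {enc_KS2 \<alpha> vs | d \<alpha> vs. KS2_code d \<alpha> vs}"

text \<open>A solution \<open>S \<subseteq> [m]\<close> is written as its characteristic bit string of length \<open>m\<close>.\<close>

definition KS2_rel :: "real \<Rightarrow> bool list \<Rightarrow> bool list \<Rightarrow> bool" where
  "KS2_rel c w z \<longleftrightarrow>
     (\<exists>d \<alpha> vs. w = enc_KS2 \<alpha> vs \<and> KS2_code d \<alpha> vs \<and> length z = length vs \<and>
        KS2_solution c d (of_rat \<alpha>) (real_vec ` set vs)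
          {real_vec (vs ! i) | i. i < length vs \<and> z ! i})"

definition KS2_codes_W_zero :: "bool list set" where
  "KS2_codes_W_zero =
     {enc_KS2 \<alpha> vs | d \<alpha> vs. KS2_code d \<alpha> vs \<and> KS2_W d (real_vec ` set vs) = 0}"

definition KS2_codes_W_ge :: "real \<Rightarrow> bool list set" where
  "KS2_codes_W_ge \<kappa> =
     {enc_KS2 \<alpha> vs | d \<alpha> vs.
        KS2_code d \<alpha> vs \<and> KS2_W d (real_vec ` set vs) \<ge> \<kappa> * sqrt (of_rat \<alpha>)}"


subsection \<open>Unique readability\<close>

lemma enc_list_prefix:
  assumes f: "\<And>x y u v. f x @ u = f y @ v \<Longrightarrow> x = y \<and> u = v"
  shows "enc_list f xs @ u = enc_list f ys @ v \<Longrightarrow> xs = ys \<and> u = v"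
proof (induction xs arbitrary: ys)
  case Nil
  then show ?case by (cases ys) (auto simp: enc_list_def)
next
  case (Cons x xs)
  then obtain y ys' where ys: "ys = y # ys'"
    by (cases ys) (auto simp: enc_list_def)
  with Cons.prems have "f x @ (enc_list f xs @ u) = f y @ (enc_list f ys' @ v)"
    by (simp add: enc_list_def)
  from f[OF this] Cons.IH[of ys'] ys show ?case by blast
qed

lemma nat_bits_inj: "nat_bits m = nat_bits n \<Longrightarrow> m = n"
proof (induction m arbitrary: n rule: less_induct)
  case (less m)
  show ?case
  proof (cases "m = 0 \<or> n = 0")
    case True
    with less.prems show ?thesis
      by (subst (asm) (1 2) nat_bits.simps) (auto split: if_splits)
  next
    case False
    with less.prems have "odd m = odd n" and "nat_bits (m div 2) = nat_bits (n div 2)"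
      by (subst (asm) (1 2) nat_bits.simps, simp)+
    moreover have "m div 2 = n div 2"
      using less.IH[of "m div 2" "n div 2"] False calculation(2) by simp
    ultimately show ?thesis by presburger
  qed
qed

lemma enc_nat_prefix: "enc_nat m @ u = enc_nat n @ v \<Longrightarrow> m = n \<and> u = v"
  using enc_list_prefix[of "\<lambda>b. [b]" "nat_bits m" u "nat_bits n" v] nat_bits_inj
  unfolding enc_nat_def by auto

lemma enc_int_prefix: "enc_int i @ u = enc_int j @ v \<Longrightarrow> i = j \<and> u = v"
  using enc_nat_prefix[of "nat \<bar>i\<bar>" u "nat \<bar>j\<bar>" v]
  unfolding enc_int_def by (auto simp: abs_if split: if_splits)

lemma enc_rat_prefix:
  assumes "enc_rat r @ u = enc_rat s @ v"
  shows "r = s \<and> u = v"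
proof -
  obtain p q p' q' where r: "quotient_of r = (p, q)" and s: "quotient_of s = (p', q')"
    by (meson surj_pair)
  have "enc_int p @ (enc_int q @ u) = enc_int p' @ (enc_int q' @ v)"
    using assms r s by (simp add: enc_rat_def)
  then have "p = p'" "q = q'" "u = v"
    using enc_int_prefix by blast+
  with r s show ?thesis
    by (metis quotient_of_div)
qed

lemma enc_vec_prefix: "enc_vec x @ u = enc_vec y @ v \<Longrightarrow> x = y \<and> u = v"
  using enc_list_prefix[OF enc_rat_prefix] unfolding enc_vec_def
  by (metis vec_list)

lemma enc_KS2_inject: "enc_KS2 \<alpha> vs = enc_KS2 \<beta> ws \<longleftrightarrow> \<alpha> = \<beta> \<and> vs = ws"
  using enc_rat_prefix[of \<alpha> "enc_list enc_vec vs" \<beta> "enc_list enc_vec ws"]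
    enc_list_prefix[of enc_vec vs "[]" ws "[]", OF enc_vec_prefix]
  unfolding enc_KS2_def by auto

end

theory Submission
  imports Defs
begin

text \<open>
  A sign vector \<open>\<epsilon>\<close> splits the instance exactly iff the matrix \<open>\<Sum> \<epsilon>\<^sub>i v\<^sub>i v\<^sub>i\<^sup>T\<close> vanishes. The gadget has
  elements \<open>e\<close>, each with its own coordinate and five vectors, and clauses with one coordinate each.
  Two of the vectors of \<open>e\<close>, \<open>(\<plusminus>1/3, 1/2)\<close> on the coordinates of \<open>e\<close> and of a successor \<open>\<pi> e\<close>, are
  forced to share a sign by the off-diagonal entry; two others, \<open>(3, 4)/10\<close> and \<open>(4, -3)/10\<close>, tie this
  sign to a clause coordinate. The diagonal entry \<open>1/2 + 1/4 + 1/4\<close> of an element then forces opposite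
  signs on \<open>e\<close> and \<open>\<pi> e\<close>, and the one of a clause, \<open>4 * 1/4\<close> with one free vector, says that its
  three elements are not all equal. A cycle of \<open>\<pi>\<close> thus carries one Boolean variable and both its
  literals. Any violation costs a matrix entry of absolute value at least \<open>6/25\<close>, while a discrepancy
  of \<open>sqrt \<alpha> / (4 sqrt 2)\<close> with \<open>\<alpha> = 13/36\<close> only allows entries below \<open>0.223\<close>.

  For the source of the reduction, the computation of the verifier is laid out with the tapes shifted
  so that all heads stay in the central column; its correctness is then a binary constraint between
  neighbouring cells, which is written in clausal form and split into not-all-equal triples.
\<close>

section \<open>Structured programs for multi-tape machines\<close>

text \<open>Two demands shape the construction. Hardness speaks of concrete machines, so the map to
  instances has to be realised as one: every entry is a fixed expression in quotients and remainders
  of its indices, and clauses and cycles get one uniform length, so that no occurrence of a variable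
  ever has to be searched for. Entries must also be rational: \<open>(3, 4)/10\<close> and
  \<open>(4, -3)/10\<close> are orthogonal with squared norm 1/4, and 1/9 + 1/9 + 1/36 = 1/4. The
  largest squared norm, that of a linking vector, is 1/9 + 1/4 = 13/36.

  The proof works with subsets instead of signs, which halves deviations from the balanced value:
  the gap is between 3/25 and a bound below 0.112. The latter includes a factor 25/24, paid for
  testing off-diagonal entries with the rational coordinates 3/5 and 4/5.

  A solution must also yield a certificate. It is the content of the second tape in the first row of
  the tableau. A selection and its complement are equally good, so truth values are read relative to
  the element that stands for falsity.\<close>

datatype prog =
    Wr nat nat
  | Mv nat move
  | Sq prog prog
  | Ite nat "nat set" prog prog
  | Wh nat "nat set" prog

type_synonym mem = "nat \<Rightarrow> tape"

inductive exec :: "prog \<Rightarrow> mem \<Rightarrow> nat \<Rightarrow> mem \<Rightarrow> bool" where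
  Wr: "exec (Wr j s) m 1 (m(j := ((fst (m j))(snd (m j) := s), snd (m j))))"
| Mv: "exec (Mv j d) m 1 (m(j := (fst (m j), snd (m j) + shift d)))"
| Sq: "exec p m t m' \<Longrightarrow> exec q m' t' m'' \<Longrightarrow> exec (Sq p q) m (t + t') m''"
| IteT: "read_tape (m j) \<in> A \<Longrightarrow> exec p m t m' \<Longrightarrow> exec (Ite j A p q) m (Suc t) m'"
| IteF: "read_tape (m j) \<notin> A \<Longrightarrow> exec q m t m' \<Longrightarrow> exec (Ite j A p q) m (Suc t) m'"
| WhF: "read_tape (m j) \<notin> A \<Longrightarrow> exec (Wh j A p) m 1 m"
| WhT: "read_tape (m j) \<in> A \<Longrightarrow> exec p m t m' \<Longrightarrow> exec (Wh j A p) m' t' m'' \<Longrightarrow>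
    exec (Wh j A p) m (Suc (t + t')) m''"

fun prog_states :: "prog \<Rightarrow> nat" where
  "prog_states (Wr j s) = 1"
| "prog_states (Mv j d) = 1"
| "prog_states (Sq p q) = prog_states p + prog_states q"
| "prog_states (Ite j A p q) = Suc (prog_states p + prog_states q)"
| "prog_states (Wh j A p) = Suc (prog_states p)"

definition idle :: "nat list \<Rightarrow> (nat \<times> move) list" where
  "idle ss = map (\<lambda>s. (s, Stay)) ss"

text \<open>The state \<open>prog_states p\<close> is the exit of \<open>p\<close>. Each combinator
  redirects the exits of its parts: to the entry of the next part, to the common exit, or, for a
  loop, back to its test in state 0.\<close>

fun prog_delta :: "prog \<Rightarrow> nat \<Rightarrow> nat list \<Rightarrow> nat \<times> (nat \<times> move) list" where
  "prog_delta (Wr j s) i ss = (1, (idle ss)[j := (s, Stay)])"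
| "prog_delta (Mv j d) i ss = (1, (idle ss)[j := (ss ! j, d)])"
| "prog_delta (Sq p q) i ss = (if i < prog_states p then prog_delta p i ss
     else apfst (\<lambda>i. i + prog_states p) (prog_delta q (i - prog_states p) ss))"
| "prog_delta (Ite j A p q) i ss =
    (if i = 0 then (if ss ! j \<in> A then 1 else Suc (prog_states p), idle ss)
     else if i \<le> prog_states p then apfst (\<lambda>i. if i = prog_states p then Suc (prog_states p + prog_states q) else Suc i) (prog_delta p (i - 1) ss)
     else apfst (\<lambda>i. Suc (prog_states p + i)) (prog_delta q (i - Suc (prog_states p)) ss))"
| "prog_delta (Wh j A p) i ss =
    (if i = 0 then (if ss ! j \<in> A then 1 else Suc (prog_states p), idle ss)
     else apfst (\<lambda>i. if i = prog_states p then 0 else Suc i) (prog_delta p (i - 1) ss))"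

fun wf_prog :: "nat \<Rightarrow> prog \<Rightarrow> bool" where
  "wf_prog k (Wr j s) \<longleftrightarrow> j < k \<and> s < 3"
| "wf_prog k (Mv j d) \<longleftrightarrow> j < k"
| "wf_prog k (Sq p q) \<longleftrightarrow> wf_prog k p \<and> wf_prog k q"
| "wf_prog k (Ite j A p q) \<longleftrightarrow> j < k \<and> wf_prog k p \<and> wf_prog k q"
| "wf_prog k (Wh j A p) \<longleftrightarrow> j < k \<and> wf_prog k p"

lemma wf_prog_mono: "wf_prog k p \<Longrightarrow> k \<le> k' \<Longrightarrow> wf_prog k' p"
  by (induction p) auto

lemma prog_states_pos: "0 < prog_states p"
  by (induction p) auto

lemma prog_delta_wf:
  assumes "wf_prog k p" "length ss = k" "set ss \<subseteq> {..<3}" "i < prog_states p"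
  shows "fst (prog_delta p i ss) \<le> prog_states p \<and> length (snd (prog_delta p i ss)) = k \<and>
    (\<forall>x\<in>set (snd (prog_delta p i ss)). fst x < 3)"
  using assms
proof (induction p arbitrary: i)
  case (Wr j s)
  then show ?case
    by (auto simp: idle_def dest!: set_update_subset_insert[THEN subsetD])
next
  case (Mv j d)
  then have "ss ! j < 3" by (meson lessThan_iff nth_mem subsetD wf_prog.simps(2))
  with Mv show ?case
    by (auto simp: idle_def dest!: set_update_subset_insert[THEN subsetD])
next
  case (Sq p q)
  show ?case using Sq.IH(1)[of i] Sq.IH(2)[of "i - prog_states p"] Sq.prems by (auto simp: apfst_def)
next
  case (Ite j A p q)
  consider "i = 0" | "0 < i" "i \<le> prog_states p" | "prog_states p < i" by linarith
  then show ?case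
  proof cases
    case 1
    then show ?thesis using Ite.prems by (auto simp: idle_def)
  next
    case 2
    then have "i - 1 < prog_states p" by linarith
    from Ite.IH(1)[OF _ _ _ this] Ite.prems 2 show ?thesis by auto
  next
    case 3
    then have "i - Suc (prog_states p) < prog_states q" using Ite.prems(4) by auto
    from Ite.IH(2)[OF _ _ _ this] Ite.prems 3 show ?thesis by auto
  qed
next
  case (Wh j A p)
  show ?case using Wh.IH(1)[of "i - 1"] Wh.prems by (cases "i = 0") (auto simp: idle_def)
qed

section \<open>Compilation of programs to machines\<close>

inductive path :: "(nat \<Rightarrow> nat list \<Rightarrow> nat \<times> (nat \<times> move) list) \<Rightarrow> nat \<Rightarrow> nat \<Rightarrow> config \<Rightarrow> config \<Rightarrow> bool"
  for D N where
  path_0: "path D N 0 c c"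
| path_Suc: "i < N \<Longrightarrow> path D N t (fst (D i (map read_tape ts)), map2 act_tape (snd (D i (map read_tape ts))) ts) c
    \<Longrightarrow> path D N (Suc t) (i, ts) c"

lemma path_trans: "path D N t c c' \<Longrightarrow> path D N t' c' c'' \<Longrightarrow> path D N (t + t') c c''"
  by (induction rule: path.induct) (auto intro: path.intros)

text \<open>Steps start only in states below \<open>N\<close>, so the renaming \<open>h\<close> is
  unconstrained on the exit \<open>N\<close> itself. This freedom is what lets a combinator send the
  exit of a part wherever it likes.\<close>

lemma path_embed:
  assumes "path D N t c c'"
    and "\<And>i ss. i < N \<Longrightarrow> D' (h i) ss = apfst h (D i ss)" "\<And>i. i < N \<Longrightarrow> h i < N'"
  shows "path D' N' t (apfst h c) (apfst h c')"
  using assms(1)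
proof (induction rule: path.induct)
  case (path_Suc i t ts c)
  show ?case using path_Suc path.path_Suc[of "h i" N' D' t ts "apfst h c"] assms(2,3)
    by (simp add: apfst_def map_prod_def case_prod_beta)
qed (rule path.intros)

lemma path_tm_step:
  assumes "path D N t c c'" "tm_delta M = D" "tm_states M = N"
  shows "(tm_step M ^^ t) c = c'"
  using assms(1)
proof (induction rule: path.induct)
  case (path_Suc i t ts c)
  then show ?case using assms(2,3) by (simp add: funpow_swap1 case_prod_beta)
qed simp

lemma act_idle: "map2 act_tape (idle (map read_tape ts)) ts = ts"
  by (rule nth_equalityI) (auto simp: idle_def, metis act_tape.simps add.right_neutral fun_upd_triv
      read_tape.simps shift.simps(2) surj_pair)

lemma act_upd:
  assumes "j < length ts"
  shows "map2 act_tape ((idle (map read_tape ts))[j := a]) ts = ts[j := act_tape a (ts ! j)]"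
proof (rule nth_equalityI)
  fix i assume "i < length (map2 act_tape ((idle (map read_tape ts))[j := a]) ts)"
  then have i: "i < length ts" by (simp add: idle_def)
  have "act_tape (read_tape (ts ! i), Stay) (ts ! i) = ts ! i"
    by (cases "ts ! i") simp
  then show "map2 act_tape ((idle (map read_tape ts))[j := a]) ts ! i = ts[j := act_tape a (ts ! j)] ! i"
    using i assms by (cases "i = j") (auto simp: idle_def)
qed (simp add: idle_def)

lemma map_upd: "j < k \<Longrightarrow> (map m [0..<k])[j := a] = map (m(j := a)) [0..<k]"
  by (rule nth_equalityI) (auto simp: nth_list_update)

lemma path_step:
  assumes "i < N" "D i (map read_tape ts) = (i', a)" "map2 act_tape a ts = ts'"
  shows "path D N 1 (i, ts) (i', ts')"
  using path_Suc[OF assms(1), of D 0 ts] assms(2,3) path_0 by simp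

lemma exec_path:
  assumes "exec p m t m'" "wf_prog k p"
  shows "path (prog_delta p) (prog_states p) t (0, map m [0..<k]) (prog_states p, map m' [0..<k])"
  using assms
proof (induction rule: exec.induct)
  case (Wr j s m)
  let ?ts = "map m [0..<k]"
  have "act_tape (s, Stay) (m j) = ((fst (m j))(snd (m j) := s), snd (m j))"
    by (cases "m j") simp
  then have "map2 act_tape ((idle (map read_tape ?ts))[j := (s, Stay)]) ?ts =
      map (m(j := ((fst (m j))(snd (m j) := s), snd (m j)))) [0..<k]"
    using Wr by (subst act_upd) (simp_all add: map_upd)
  then show ?case by (intro path_step) auto
next
  case (Mv j d m)
  let ?ts = "map m [0..<k]"
  have "act_tape (read_tape (m j), d) (m j) = (fst (m j), snd (m j) + shift d)"
    by (cases "m j") simp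
  then have "map2 act_tape ((idle (map read_tape ?ts))[j := (map read_tape ?ts ! j, d)]) ?ts =
      map (m(j := (fst (m j), snd (m j) + shift d))) [0..<k]"
    using Mv by (subst act_upd) (simp_all add: map_upd)
  then show ?case by (intro path_step) auto
next
  case (Sq p m t m' q t' m'')
  have "path (prog_delta (Sq p q)) (prog_states (Sq p q)) t (apfst id (0, map m [0..<k])) (apfst id (prog_states p, map m' [0..<k]))"
    by (rule path_embed[of "prog_delta p" "prog_states p"]) (use Sq in auto)
  moreover have "path (prog_delta (Sq p q)) (prog_states (Sq p q)) t' (apfst (\<lambda>i. i + prog_states p) (0, map m' [0..<k]))
     (apfst (\<lambda>i. i + prog_states p) (prog_states q, map m'' [0..<k]))"
    by (rule path_embed[of "prog_delta q" "prog_states q"]) (use Sq in auto)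
  ultimately have "path (prog_delta (Sq p q)) (prog_states (Sq p q)) (t + t') (apfst id (0, map m [0..<k]))
     (apfst (\<lambda>i. i + prog_states p) (prog_states q, map m'' [0..<k]))"
    by (intro path_trans[of _ _ t]) (assumption, simp)
  then show ?case by (simp add: add.commute[of "prog_states q"] del: prog_delta.simps)
next
  case (IteT m j A p t m' q)
  let ?P = "Ite j A p q"
  have "path (prog_delta ?P) (prog_states ?P) 1 (0, map m [0..<k]) (1, map m [0..<k])"
    by (rule path_step[of _ _ _ _ _ "idle (map read_tape (map m [0..<k]))"], simp, use IteT in simp)
       (rule act_idle)
  moreover have "path (prog_delta ?P) (prog_states ?P) t
     (apfst (\<lambda>i. if i = prog_states p then Suc (prog_states p + prog_states q) else Suc i) (0, map m [0..<k]))
     (apfst (\<lambda>i. if i = prog_states p then Suc (prog_states p + prog_states q) else Suc i) (prog_states p, map m' [0..<k]))"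
    by (rule path_embed[of "prog_delta p" "prog_states p"]) (use IteT in auto)
  ultimately have "path (prog_delta ?P) (prog_states ?P) (1 + t) (0, map m [0..<k])
     (apfst (\<lambda>i. if i = prog_states p then Suc (prog_states p + prog_states q) else Suc i) (prog_states p, map m' [0..<k]))"
    using prog_states_pos[of p] by (intro path_trans[of _ _ 1]) (assumption, simp del: prog_delta.simps)
  then show ?case by (simp del: prog_delta.simps)
next
  case (IteF m j A q t m' p)
  let ?P = "Ite j A p q"
  have "path (prog_delta ?P) (prog_states ?P) 1 (0, map m [0..<k]) (Suc (prog_states p), map m [0..<k])"
    by (rule path_step[of _ _ _ _ _ "idle (map read_tape (map m [0..<k]))"], simp, use IteF in simp)
       (rule act_idle)
  moreover have "path (prog_delta ?P) (prog_states ?P) t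
     (apfst (\<lambda>i. Suc (prog_states p + i)) (0, map m [0..<k]))
     (apfst (\<lambda>i. Suc (prog_states p + i)) (prog_states q, map m' [0..<k]))"
    by (rule path_embed[of "prog_delta q" "prog_states q"]) (use IteF in auto)
  ultimately have "path (prog_delta ?P) (prog_states ?P) (1 + t) (0, map m [0..<k])
     (apfst (\<lambda>i. Suc (prog_states p + i)) (prog_states q, map m' [0..<k]))"
    by (intro path_trans[of _ _ 1]) (assumption, simp del: prog_delta.simps)
  then show ?case by (simp del: prog_delta.simps)
next
  case (WhF m j A p)
  let ?P = "Wh j A p"
  show ?case
    by (rule path_step[of _ _ _ _ _ "idle (map read_tape (map m [0..<k]))"], simp, use WhF in simp)
       (rule act_idle)
next
  case (WhT m j A p t m' t' m'')
  let ?P = "Wh j A p"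
  have "path (prog_delta ?P) (prog_states ?P) 1 (0, map m [0..<k]) (1, map m [0..<k])"
    by (rule path_step[of _ _ _ _ _ "idle (map read_tape (map m [0..<k]))"], simp, use WhT in simp)
       (rule act_idle)
  moreover have "path (prog_delta ?P) (prog_states ?P) t
     (apfst (\<lambda>i. if i = prog_states p then 0 else Suc i) (0, map m [0..<k]))
     (apfst (\<lambda>i. if i = prog_states p then 0 else Suc i) (prog_states p, map m' [0..<k]))"
    by (rule path_embed[of "prog_delta p" "prog_states p"]) (use WhT in auto)
  ultimately have "path (prog_delta ?P) (prog_states ?P) (1 + t) (0, map m [0..<k]) (0, map m' [0..<k])"
    using prog_states_pos[of p] by (intro path_trans[of _ _ 1]) (assumption, simp del: prog_delta.simps)
  from path_trans[OF this WhT.IH(2)] WhT.prems show ?case by (simp del: prog_delta.simps)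
qed

text \<open>A head moves by at most one cell per step. Since an output head ends behind its word,
  running time bounds the length of outputs.\<close>

lemma exec_head: "exec p m t m' \<Longrightarrow> \<bar>snd (m' j) - snd (m j)\<bar> \<le> int t"
proof (induction rule: exec.induct)
  case (Mv j' d m)
  then show ?case by (cases d) auto
qed auto


section \<open>Runs with time bounds and basic tape routines\<close>

definition runs :: "prog \<Rightarrow> mem \<Rightarrow> nat \<Rightarrow> mem \<Rightarrow> bool" where
  "runs p m b m' \<longleftrightarrow> (\<exists>t\<le>b. exec p m t m')"

lemma runs_mono: "runs p m b m' \<Longrightarrow> b \<le> b' \<Longrightarrow> runs p m b' m'"
  unfolding runs_def using le_trans by blast

lemma runs_eq: "runs p m b m' \<Longrightarrow> m' = m'' \<Longrightarrow> b \<le> b' \<Longrightarrow> runs p m b' m''"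
  using runs_mono by blast

lemma runs_Wr: "m' = m(j := ((fst (m j))(snd (m j) := s), snd (m j))) \<Longrightarrow> runs (Wr j s) m 1 m'"
  unfolding runs_def using exec.Wr by blast

lemma runs_Mv: "m' = m(j := (fst (m j), snd (m j) + shift d)) \<Longrightarrow> runs (Mv j d) m 1 m'"
  unfolding runs_def using exec.Mv by blast

lemma runs_Sq: "runs p m b m' \<Longrightarrow> runs q m' b' m'' \<Longrightarrow> runs (Sq p q) m (b + b') m''"
  unfolding runs_def using exec.Sq add_mono by metis

lemma runs_Ite:
  "(read_tape (m j) \<in> A \<Longrightarrow> runs p m b m') \<Longrightarrow> (read_tape (m j) \<notin> A \<Longrightarrow> runs q m b m') \<Longrightarrow>
    runs (Ite j A p q) m (Suc b) m'"
  unfolding runs_def using exec.IteT exec.IteF Suc_le_mono by metis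

text \<open>A loop is specified by the sequence \<open>S\<close> of memories after each round, with
  one time bound for all rounds.\<close>

lemma runs_Wh:
  assumes "\<And>i. i < n \<Longrightarrow> read_tape (S i j) \<in> A" "read_tape (S n j) \<notin> A"
    and "\<And>i. i < n \<Longrightarrow> runs p (S i) b (S (Suc i))"
  shows "runs (Wh j A p) (S 0) (n * Suc b + 1) (S n)"
  using assms
proof (induction n arbitrary: S)
  case 0
  then show ?case unfolding runs_def using exec.WhF by force
next
  case (Suc n)
  have "runs (Wh j A p) (S (Suc 0)) (n * Suc b + 1) (S (Suc n))"
    using Suc.IH[of "\<lambda>i. S (Suc i)"] Suc.prems by auto
  moreover have "runs p (S 0) b (S (Suc 0))" "read_tape (S 0 j) \<in> A" using Suc.prems by auto
  ultimately obtain t t' where "t \<le> b" "t' \<le> n * Suc b + 1" "exec p (S 0) t (S (Suc 0))"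
     "exec (Wh j A p) (S (Suc 0)) t' (S (Suc n))" "read_tape (S 0 j) \<in> A"
    unfolding runs_def by blast
  then show ?case unfolding runs_def
    by (intro exI[of _ "Suc (t + t')"]) (auto intro: exec.WhT)
qed

text \<open>Arguments rest with the head on their first cell, results with the head on the first
  blank behind them, where the next piece is appended.\<close>

definition reg :: "bool list \<Rightarrow> tape" where "reg w = (string_tape w, 0)"
definition out :: "bool list \<Rightarrow> tape" where "out w = (string_tape w, int (length w))"

lemma reg_Nil: "out [] = reg []" by (simp add: reg_def out_def)

lemma string_tape_in: "0 \<le> i \<Longrightarrow> i < int (length w) \<Longrightarrow> string_tape w i \<in> {1, 2}"
  by (simp add: string_tape_def)

lemma string_tape_out: "i < 0 \<or> int (length w) \<le> i \<Longrightarrow> string_tape w i = 0"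
  by (auto simp: string_tape_def)

lemma string_tape_snoc:
  "(string_tape w)(int (length w) := (if b then 2 else 1)) = string_tape (w @ [b])"
  by (auto simp: string_tape_def fun_eq_iff nth_append)

definition emit :: "nat \<Rightarrow> bool \<Rightarrow> prog" where
  "emit d b = Sq (Wr d (if b then 2 else 1)) (Mv d Move_Right)"

lemma runs_emit:
  assumes "m d = out w" shows "runs (emit d b) m 2 (m(d := out (w @ [b])))"
proof -
  have "runs (emit d b) m (1 + 1) (m(d := out (w @ [b])))"
    unfolding emit_def using assms
    by (intro runs_Sq[OF runs_Wr[OF refl] runs_Mv])
       (simp add: out_def string_tape_snoc add.commute)
  then show ?thesis by (simp add: numeral_2_eq_2)
qed

text \<open>The initial step to the left leaves the blank behind the word, on which the scan would
  stop at once.\<close>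

definition rewind :: "nat \<Rightarrow> prog" where
  "rewind j = Sq (Mv j Move_Left) (Sq (Wh j {1, 2} (Mv j Move_Left)) (Mv j Move_Right))"

lemma runs_rewind:
  assumes "m j = (string_tape w, int h)" "h \<le> length w"
  shows "runs (rewind j) m (2 * h + 3) (m(j := reg w))"
proof -
  let ?S = "\<lambda>i. m(j := (string_tape w, int h - 1 - int i))"
  have "runs (Wh j {1, 2} (Mv j Move_Left)) (?S 0) (h * Suc 1 + 1) (?S h)"
  proof (rule runs_Wh)
    fix i assume "i < h"
    then show "read_tape (?S i j) \<in> {1, 2}" using assms string_tape_in[of "int h - 1 - int i" w] by auto
    show "runs (Mv j Move_Left) (?S i) 1 (?S (Suc i))" by (rule runs_Mv) (simp add: fun_eq_iff)
  qed (simp add: string_tape_out)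
  then have "runs (rewind j) m (1 + ((h * Suc 1 + 1) + 1)) (m(j := reg w))"
    unfolding rewind_def
    by (intro runs_Sq runs_Mv) (use assms in \<open>auto simp: reg_def\<close>)
  then show ?thesis by (rule runs_mono) simp
qed

definition goto_end :: "nat \<Rightarrow> prog" where
  "goto_end j = Wh j {1, 2} (Mv j Move_Right)"

lemma runs_goto_end:
  assumes "m j = reg w"
  shows "runs (goto_end j) m (2 * length w + 1) (m(j := out w))"
proof -
  let ?S = "\<lambda>i. m(j := (string_tape w, int i))"
  have "runs (Wh j {1, 2} (Mv j Move_Right)) (?S 0) (length w * Suc 1 + 1) (?S (length w))"
  proof (rule runs_Wh)
    fix i assume "i < length w"
    then show "read_tape (?S i j) \<in> {1, 2}" using string_tape_in[of "int i" w] by auto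
    show "runs (Mv j Move_Right) (?S i) 1 (?S (Suc i))" by (rule runs_Mv) (simp add: fun_eq_iff)
  qed (simp add: string_tape_out)
  moreover have "?S 0 = m" using assms by (auto simp: reg_def)
  ultimately show ?thesis by (simp add: goto_end_def out_def mult_2)
qed

definition erase :: "nat \<Rightarrow> prog" where
  "erase j = Sq (Mv j Move_Left) (Sq (Wh j {1, 2} (Sq (Wr j 0) (Mv j Move_Left))) (Mv j Move_Right))"

lemma runs_erase:
  assumes "m j = out w"
  shows "runs (erase j) m (3 * length w + 3) (m(j := reg []))"
proof -
  let ?n = "length w"
  let ?S = "\<lambda>i. m(j := (string_tape (take (?n - i) w), int ?n - 1 - int i))"
  have "runs (Wh j {1, 2} (Sq (Wr j 0) (Mv j Move_Left))) (?S 0) (?n * Suc (1 + 1) + 1) (?S ?n)"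
  proof (rule runs_Wh)
    fix i assume i: "i < ?n"
    then show "read_tape (?S i j) \<in> {1, 2}"
      using string_tape_in[of "int ?n - 1 - int i" "take (?n - i) w"] by auto
    have "(string_tape (take (?n - i) w))(int ?n - 1 - int i := 0) = string_tape (take (?n - Suc i) w)"
    proof
      fix x
      show "((string_tape (take (?n - i) w))(int ?n - 1 - int i := 0)) x = string_tape (take (?n - Suc i) w) x"
        using i by (cases "0 \<le> x \<and> x < int ?n - 1 - int i")
          (auto simp: string_tape_def nat_less_iff of_nat_diff)
    qed
    then show "runs (Sq (Wr j 0) (Mv j Move_Left)) (?S i) (1 + 1) (?S (Suc i))"
      by (intro runs_Sq[OF runs_Wr[OF refl] runs_Mv]) (simp add: fun_eq_iff)
  qed (simp add: string_tape_out)
  then have "runs (erase j) m (1 + ((?n * Suc (1 + 1) + 1) + 1)) (m(j := reg []))"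
    unfolding erase_def
    by (intro runs_Sq runs_Mv) (use assms in \<open>auto simp: reg_def out_def\<close>)
  then show ?thesis by (rule runs_mono) simp
qed

text \<open>With base \<open>n + 2\<close>, which is at least 2, a larger exponent absorbs
  constants, sums, products and compositions alike. Monotonicity lets a bound on the input size be
  inserted.\<close>

definition pbound :: "(nat \<Rightarrow> nat) \<Rightarrow> bool" where
  "pbound g \<longleftrightarrow> mono g \<and> (\<exists>e. \<forall>n. g n \<le> (n + 2) ^ e)"

lemma pbound_mono: "pbound g \<Longrightarrow> a \<le> b \<Longrightarrow> g a \<le> g b"
  unfolding pbound_def mono_def by blast

lemma pbound_const: "pbound (\<lambda>n. c)"
proof -
  have "c \<le> (n + 2) ^ c" for n
  proof -
    have "c < 2 ^ c" by simp
    also have "2 ^ c \<le> (n + 2) ^ c" by (rule power_mono) auto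
    finally show ?thesis by simp
  qed
  then show ?thesis unfolding pbound_def mono_def by blast
qed

lemma pbound_id: "pbound (\<lambda>n. n)"
  unfolding pbound_def by (auto simp: mono_def intro!: exI[of _ 1])

lemma pbound_add:
  assumes "pbound f" "pbound g" shows "pbound (\<lambda>n. f n + g n)"
proof -
  obtain a b where ab: "\<And>n. f n \<le> (n + 2) ^ a" "\<And>n. g n \<le> (n + 2) ^ b"
    using assms unfolding pbound_def by blast
  have "f n + g n \<le> (n + 2) ^ (Suc (a + b))" for n
  proof -
    have "(n + 2) ^ a \<le> (n + 2) ^ (a + b)" "(n + 2) ^ b \<le> (n + 2) ^ (a + b)"
      by (rule power_increasing; simp)+
    then have "f n + g n \<le> 2 * (n + 2) ^ (a + b)" using ab[of n] by linarith
    also have "\<dots> \<le> (n + 2) * (n + 2) ^ (a + b)" by (rule mult_right_mono) auto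
    finally show ?thesis by simp
  qed
  then show ?thesis using assms unfolding pbound_def mono_def by (blast intro: add_mono)
qed

lemma pbound_mult:
  assumes "pbound f" "pbound g" shows "pbound (\<lambda>n. f n * g n)"
proof -
  obtain a b where ab: "\<And>n. f n \<le> (n + 2) ^ a" "\<And>n. g n \<le> (n + 2) ^ b"
    using assms unfolding pbound_def by blast
  have "f n * g n \<le> (n + 2) ^ (a + b)" for n
    using mult_mono[OF ab(1)[of n] ab(2)[of n]] by (simp add: power_add)
  then show ?thesis using assms unfolding pbound_def mono_def by (blast intro: mult_mono)
qed

lemma pbound_comp:
  assumes "pbound f" "pbound g" shows "pbound (\<lambda>n. f (g n))"
proof -
  obtain a b where ab: "\<And>n. f n \<le> (n + 2) ^ a" "\<And>n. g n \<le> (n + 2) ^ b"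
    using assms unfolding pbound_def by blast
  have "f (g n) \<le> (n + 2) ^ ((b + 2) * a)" for n
  proof -
    have "(n + 2) ^ b \<le> (n + 2) ^ Suc b" "(n + 2) ^ 1 \<le> (n + 2) ^ Suc b"
      by (rule power_increasing; simp)+
    then have "g n \<le> (n + 2) ^ Suc b" "2 \<le> (n + 2) ^ Suc b"
      using ab(2)[of n] le_trans by (blast, simp)
    from add_mono[OF this] have "g n + 2 \<le> 2 * (n + 2) ^ Suc b" by (simp only: mult_2)
    also have "\<dots> \<le> (n + 2) * (n + 2) ^ Suc b" by (rule mult_right_mono) auto
    finally have "g n + 2 \<le> (n + 2) ^ (b + 2)" by simp
    then have "(g n + 2) ^ a \<le> ((n + 2) ^ (b + 2)) ^ a" by (rule power_mono) simp
    with ab(1)[of "g n"] show ?thesis by (simp only: power_mult)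
  qed
  then show ?thesis using assms unfolding pbound_def mono_def by blast
qed

lemmas pbound_intros = pbound_const pbound_id pbound_add pbound_mult

lemma pbound_le:
  assumes "pbound g" shows "\<exists>c e. \<forall>n. g n \<le> c * n ^ e + c"
proof -
  obtain e where e: "\<And>n. g n \<le> (n + 2) ^ e" using assms unfolding pbound_def by blast
  have "g n \<le> 3 ^ e * n ^ e + 3 ^ e" for n
  proof (cases "n = 0")
    case True
    have "(2::nat) ^ e \<le> 3 ^ e" by (rule power_mono) auto
    then show ?thesis using e[of 0] True by (simp add: numeral_2_eq_2)
  next
    case False
    then have "(n + 2) ^ e \<le> (3 * n) ^ e" by (intro power_mono) auto
    then show ?thesis using e[of n] by (simp add: power_mult_distrib)
  qed
  then show ?thesis by blast
qed

section \<open>Functions computed in polynomial time\<close>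

definition tot :: "bool list list \<Rightarrow> nat" where "tot xs = (\<Sum>x\<leftarrow>xs. length x)"

text \<open>
  The program finds its arguments on the tapes \<open>rs\<close>, appends its result to the output tape \<open>d\<close>, and
  restores everything else. The tapes from \<open>s\<close> on are blank and serve as scratch space; the content
  of all other tapes is arbitrary.
\<close>

definition computes where
  "computes n f rs d s P g \<longleftrightarrow> (\<forall>xs w m. length xs = n \<and> (\<forall>i<n. m (rs ! i) = reg (xs ! i)) \<and>
     m d = out w \<and> (\<forall>j\<ge>s. m j = reg []) \<longrightarrow> runs P m (g (tot xs)) (m(d := out (w @ f xs))))"

text \<open>A program is demanded for every choice of tapes, so subprograms are obtained directly on
  the tapes at hand and never have to be relocated. Because output is appended, concatenation is
  sequencing and a loop emits its result piece by piece.\<close>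

definition ptime :: "nat \<Rightarrow> (bool list list \<Rightarrow> bool list) \<Rightarrow> bool" where
  "ptime n f \<longleftrightarrow> (\<forall>rs d s. length rs = n \<longrightarrow> distinct rs \<longrightarrow> d \<notin> set rs \<longrightarrow> (\<forall>r\<in>set rs. r < s) \<longrightarrow>
     d < s \<longrightarrow> (\<exists>P k g. wf_prog k P \<and> pbound g \<and> computes n f rs d s P g))"

lemma ptimeD:
  assumes "ptime n f" "length rs = n" "distinct rs" "d \<notin> set rs" "\<And>r. r \<in> set rs \<Longrightarrow> r < s" "d < s"
  obtains P k g where "wf_prog k P" "pbound g" "computes n f rs d s P g"
  using assms unfolding ptime_def by blast

lemma ptimeI:
  assumes "\<And>rs d s. length rs = n \<Longrightarrow> distinct rs \<Longrightarrow> d \<notin> set rs \<Longrightarrow> \<forall>r\<in>set rs. r < s \<Longrightarrow> d < s \<Longrightarrow>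
    (\<exists>P k g. wf_prog k P \<and> pbound g \<and> computes n f rs d s P g)"
  shows "ptime n f"
  using assms unfolding ptime_def by blast

lemma computesD:
  assumes "computes n f rs d s P g" "length xs = n" "\<And>i. i < n \<Longrightarrow> m (rs ! i) = reg (xs ! i)"
     "m d = out w" "\<And>j. s \<le> j \<Longrightarrow> m j = reg []"
  shows "runs P m (g (tot xs)) (m(d := out (w @ f xs)))"
  using assms unfolding computes_def by blast

text \<open>Started on an empty output tape, the output head has travelled exactly the length of the
  result.\<close>

lemma ptime_length:
  assumes "ptime n f"
  obtains g where "pbound g" "\<And>xs. length xs = n \<Longrightarrow> length (f xs) \<le> g (tot xs)"
proof -
  obtain P k g where P: "pbound g" "computes n f [0..<n] n (Suc n) P g"
    by (rule ptimeD[OF assms, of "[0..<n]" n "Suc n"]) auto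
  have "length (f xs) \<le> g (tot xs)" if "length xs = n" for xs
  proof -
    let ?m = "\<lambda>i. if i < n then reg (xs ! i) else reg []"
    have "runs P ?m (g (tot xs)) (?m(n := out ([] @ f xs)))"
      by (rule computesD[OF P(2)]) (use that in \<open>auto simp: reg_Nil\<close>)
    then obtain t where "t \<le> g (tot xs)" "exec P ?m t (?m(n := out ([] @ f xs)))"
      unfolding runs_def by blast
    from exec_head[OF this(2), of n] this(1) show ?thesis by (simp add: out_def reg_def)
  qed
  with P(1) show ?thesis using that by blast
qed

lemma ptime_cong: "ptime n f \<Longrightarrow> (\<And>xs. length xs = n \<Longrightarrow> f xs = g xs) \<Longrightarrow> ptime n g"
proof (rule ptimeI)
  fix rs :: "nat list" and d s
  assume f: "ptime n f" and eq: "\<And>xs. length xs = n \<Longrightarrow> f xs = g xs"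
    and rs: "length rs = n" "distinct rs" "d \<notin> set rs" "\<forall>r\<in>set rs. r < s" "d < s"
  obtain P k h where P: "wf_prog k P" "pbound h" "computes n f rs d s P h"
    by (rule ptimeD[OF f rs(1-3) _ rs(5)]) (use rs in auto)
  then have "computes n g rs d s P h" unfolding computes_def using eq by simp
  with P show "\<exists>P k h. wf_prog k P \<and> pbound h \<and> computes n g rs d s P h" by blast
qed

lemma ptime_select:
  assumes f: "ptime k f" and ix: "length ix = k" "distinct ix" "\<And>i. i \<in> set ix \<Longrightarrow> i < n"
  shows "ptime n (\<lambda>xs. f (map ((!) xs) ix))"
proof (rule ptimeI)
  fix rs :: "nat list" and d s
  assume rs: "length rs = n" "distinct rs" "d \<notin> set rs" "\<forall>r\<in>set rs. r < s" "d < s"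
  have sub: "set (map ((!) rs) ix) \<subseteq> set rs" using ix rs by auto
  have "distinct (map ((!) rs) ix)" using ix rs by (auto simp: distinct_map inj_on_def nth_eq_iff_index_eq)
  then obtain P k' g where P: "wf_prog k' P" "pbound g" "computes k f (map ((!) rs) ix) d s P g"
    by (rule ptimeD[OF f, of "map ((!) rs) ix" d s, rotated]) (use ix rs sub in \<open>auto\<close>)
  have "computes n (\<lambda>xs. f (map ((!) xs) ix)) rs d s P g"
    unfolding computes_def
  proof (intro allI impI, elim conjE)
    fix xs :: "bool list list" and w and m :: mem
    assume xs: "length xs = n" "\<forall>i<n. m (rs ! i) = reg (xs ! i)" "m d = out w" "\<forall>j\<ge>s. m j = reg []"
    have "runs P m (g (tot (map ((!) xs) ix))) (m(d := out (w @ f (map ((!) xs) ix))))"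
      by (rule computesD[OF P(3)]) (use xs ix in auto)
    \<comment> \<open>Distinct indices count each argument at most once, so the total length does
      not grow under selection.\<close>
    moreover have "tot (map ((!) xs) ix) \<le> tot xs"
    proof -
      have "tot (map ((!) xs) ix) = (\<Sum>i\<in>set ix. length (xs ! i))"
        by (simp add: tot_def comp_def sum_list_distinct_conv_sum_set ix)
      also have "\<dots> \<le> (\<Sum>i\<in>{0..<n}. length (xs ! i))" by (rule sum_mono2) (use ix in auto)
      also have "\<dots> = tot xs" using xs(1) by (simp add: tot_def sum_list_sum_nth)
      finally show ?thesis .
    qed
    ultimately show "runs P m (g (tot xs)) (m(d := out (w @ f (map ((!) xs) ix))))"
      using runs_mono pbound_mono[OF P(2)] by blast
  qed
  with P show "\<exists>P k g. wf_prog k P \<and> pbound g \<and> computes n (\<lambda>xs. f (map ((!) xs) ix)) rs d s P g" by blast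
qed

lemma ptime_take:
  assumes "ptime n f" shows "ptime (Suc n) (\<lambda>ys. f (take n ys))"
  by (rule ptime_cong[OF ptime_select[OF assms, of "[0..<n]"]])
     (auto simp: take_map[symmetric] map_nth intro!: arg_cong[of _ _ f] nth_equalityI)

lemma ptime_Nil: "ptime n (\<lambda>xs. [])"
proof (rule ptimeI)
  fix rs :: "nat list" and d s :: nat
  assume rs: "length rs = n" "distinct rs" "d \<notin> set rs" "\<forall>r\<in>set rs. r < s" "d < s"
  have "computes n (\<lambda>xs. []) rs d s (Mv d Stay) (\<lambda>_. 1)"
    unfolding computes_def
  proof (intro allI impI, elim conjE)
    fix xs :: "bool list list" and w and m :: mem
    assume "m d = out w"
    then show "runs (Mv d Stay) m 1 (m(d := out (w @ [])))"
      by (intro runs_Mv) (simp add: out_def)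
  qed
  moreover have "wf_prog (Suc d) (Mv d Stay)" by simp
  ultimately show "\<exists>P k g. wf_prog k P \<and> pbound g \<and> computes n (\<lambda>xs. []) rs d s P g"
    using pbound_const by blast
qed

lemma ptime_bit: "ptime n (\<lambda>xs. [b])"
proof (rule ptimeI)
  fix rs :: "nat list" and d s :: nat
  assume rs: "length rs = n" "distinct rs" "d \<notin> set rs" "\<forall>r\<in>set rs. r < s" "d < s"
  have "computes n (\<lambda>xs. [b]) rs d s (emit d b) (\<lambda>_. 2)"
    unfolding computes_def using runs_emit by auto
  moreover have "wf_prog (Suc d) (emit d b)" by (simp add: emit_def)
  ultimately show "\<exists>P k g. wf_prog k P \<and> pbound g \<and> computes n (\<lambda>xs. [b]) rs d s P g"
    using pbound_const by blast
qed

lemma ptime_append: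
  assumes "ptime n f" "ptime n g" shows "ptime n (\<lambda>xs. f xs @ g xs)"
proof (rule ptimeI)
  fix rs :: "nat list" and d s :: nat
  assume rs: "length rs = n" "distinct rs" "d \<notin> set rs" "\<forall>r\<in>set rs. r < s" "d < s"
  obtain P k a where P: "wf_prog k P" "pbound a" "computes n f rs d s P a"
    by (rule ptimeD[OF assms(1) rs(1-3) _ rs(5)]) (use rs in auto)
  obtain Q l b where Q: "wf_prog l Q" "pbound b" "computes n g rs d s Q b"
    by (rule ptimeD[OF assms(2) rs(1-3) _ rs(5)]) (use rs in auto)
  have "computes n (\<lambda>xs. f xs @ g xs) rs d s (Sq P Q) (\<lambda>n. a n + b n)"
    unfolding computes_def
  proof (intro allI impI, elim conjE)
    fix xs :: "bool list list" and w and m :: mem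
    assume xs: "length xs = n" "\<forall>i<n. m (rs ! i) = reg (xs ! i)" "m d = out w" "\<forall>j\<ge>s. m j = reg []"
    have "runs P m (a (tot xs)) (m(d := out (w @ f xs)))"
      by (rule computesD[OF P(3)]) (use xs in auto)
    moreover have "runs Q (m(d := out (w @ f xs))) (b (tot xs)) (m(d := out (w @ f xs), d := out ((w @ f xs) @ g xs)))"
      by (rule computesD[OF Q(3)]) (use xs rs in auto)
    ultimately show "runs (Sq P Q) m (a (tot xs) + b (tot xs)) (m(d := out (w @ f xs @ g xs)))"
      using runs_Sq by (metis append.assoc fun_upd_upd)
  qed
  moreover have "wf_prog (max k l) (Sq P Q)" using P Q wf_prog_mono by auto
  moreover have "pbound (\<lambda>n. a n + b n)" using P Q pbound_add by blast
  ultimately show "\<exists>P k g'. wf_prog k P \<and> pbound g' \<and> computes n (\<lambda>xs. f xs @ g xs) rs d s P g'" by blast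
qed

lemma ptime_const: "ptime n (\<lambda>xs. bs)"
proof (induction bs)
  case (Cons b bs)
  from ptime_append[OF ptime_bit[of n b] Cons] show ?case by simp
qed (rule ptime_Nil)

text \<open>The intermediate value goes to the first scratch tape \<open>s\<close>, which then
  serves as last argument of \<open>g\<close> while the tapes from \<open>Suc s\<close> on remain
  scratch. Erasing works leftwards, hence the walk to the end of the word before \<open>s\<close> is
  blanked again.\<close>

lemma ptime_let:
  assumes "ptime n f" "ptime (Suc n) g" shows "ptime n (\<lambda>xs. g (xs @ [f xs]))"
proof (rule ptimeI)
  fix rs :: "nat list" and d s :: nat
  assume rs: "length rs = n" "distinct rs" "d \<notin> set rs" "\<forall>r\<in>set rs. r < s" "d < s"
  obtain P k a where P: "wf_prog k P" "pbound a" "computes n f rs s (Suc s) P a"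
    by (rule ptimeD[OF assms(1) rs(1,2), of s "Suc s"]) (use rs in \<open>auto simp: less_SucI\<close>)
  have ob: "length (rs @ [s]) = Suc n" "distinct (rs @ [s])" "d \<notin> set (rs @ [s])"
    "\<And>r. r \<in> set (rs @ [s]) \<Longrightarrow> r < Suc s" "d < Suc s"
    using rs by (auto intro: less_SucI)
  obtain Q l b where Q: "wf_prog l Q" "pbound b" "computes (Suc n) g (rs @ [s]) d (Suc s) Q b"
    by (rule ptimeD[OF assms(2) ob])
  obtain h where h: "pbound h" "\<And>xs. length xs = n \<Longrightarrow> length (f xs) \<le> h (tot xs)"
    using ptime_length[OF assms(1)] by blast
  let ?T = "\<lambda>n. a n + ((2 * h n + 3) + (b (n + h n) + ((2 * h n + 1) + (3 * h n + 3))))"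
  let ?P = "Sq P (Sq (rewind s) (Sq Q (Sq (goto_end s) (erase s))))"
  have "computes n (\<lambda>xs. g (xs @ [f xs])) rs d s ?P ?T"
    unfolding computes_def
  proof (intro allI impI, elim conjE)
    fix xs :: "bool list list" and w and m :: mem
    assume xs: "length xs = n" "\<forall>i<n. m (rs ! i) = reg (xs ! i)" "m d = out w" "\<forall>j\<ge>s. m j = reg []"
    have ne: "rs ! i \<noteq> s" if "i < n" for i using rs that by (metis nth_mem less_irrefl)
    let ?m1 = "m(s := out (f xs))" and ?m2 = "m(s := reg (f xs))"
    let ?m3 = "m(s := reg (f xs), d := out (w @ g (xs @ [f xs])))"
    let ?m4 = "m(s := out (f xs), d := out (w @ g (xs @ [f xs])))"
    have len: "length (f xs) \<le> h (tot xs)" using h xs by blast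
    have 1: "runs P m (a (tot xs)) ?m1"
      using computesD[OF P(3), of xs m "[]"] xs by (simp add: reg_Nil)
    have 2: "runs (rewind s) ?m1 (2 * h (tot xs) + 3) ?m2"
      by (rule runs_eq[OF runs_rewind[of ?m1 s "f xs" "length (f xs)"]]) (use len in \<open>simp_all add: out_def\<close>)
    have "tot (xs @ [f xs]) \<le> tot xs + h (tot xs)" using len by (simp add: tot_def)
    then have le: "b (tot (xs @ [f xs])) \<le> b (tot xs + h (tot xs))" using pbound_mono[OF Q(2)] by blast
    have "runs Q ?m2 (b (tot (xs @ [f xs]))) (?m2(d := out (w @ g (xs @ [f xs]))))"
    proof (rule computesD[OF Q(3)])
      fix i assume "i < Suc n"
      then show "?m2 ((rs @ [s]) ! i) = reg ((xs @ [f xs]) ! i)"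
        using xs rs(1) ne[of i] by (cases "i = n") (simp_all add: nth_append)
    qed (use xs rs in simp_all)
    then have 3: "runs Q ?m2 (b (tot xs + h (tot xs))) ?m3"
      using le by (rule runs_mono)
    have 4: "runs (goto_end s) ?m3 (2 * h (tot xs) + 1) ?m4"
      by (rule runs_eq[OF runs_goto_end[of ?m3 s "f xs"]]) (use len rs in \<open>simp_all add: fun_upd_twist\<close>)
    have 5: "runs (erase s) ?m4 (3 * h (tot xs) + 3) (m(d := out (w @ g (xs @ [f xs]))))"
      by (rule runs_eq[OF runs_erase[of ?m4 s "f xs"]]) (use len rs xs in \<open>simp_all add: fun_eq_iff\<close>)
    show "runs ?P m (?T (tot xs)) (m(d := out (w @ g (xs @ [f xs]))))"
      by (rule runs_Sq[OF 1 runs_Sq[OF 2 runs_Sq[OF 3 runs_Sq[OF 4 5]]]])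
  qed
  moreover have "wf_prog (max (max k l) (Suc s)) ?P"
    using P Q wf_prog_mono by (auto simp: rewind_def goto_end_def erase_def)
  moreover have "pbound ?T"
    by (insert P(2) Q(2) h(1)) (assumption | rule pbound_intros pbound_comp[of b])+
  ultimately show "\<exists>P k g'. wf_prog k P \<and> pbound g' \<and> computes n (\<lambda>xs. g (xs @ [f xs])) rs d s P g'" by blast
qed

lemma ptime_arg:
  assumes i: "i < n" shows "ptime n (\<lambda>xs. xs ! i)"
proof (rule ptimeI)
  fix rs :: "nat list" and d s :: nat
  assume rs: "length rs = n" "distinct rs" "d \<notin> set rs" "\<forall>r\<in>set rs. r < s" "d < s"
  let ?r = "rs ! i"
  have ne: "?r \<noteq> d" using rs i by (metis nth_mem)
  let ?B = "Sq (Ite ?r {2} (emit d True) (emit d False)) (Mv ?r Move_Right)"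
  let ?P = "Sq (Wh ?r {1, 2} ?B) (rewind ?r)"
  let ?T = "\<lambda>n. (n * Suc (Suc 2 + 1) + 1) + (2 * n + 3)"
  have "computes n (\<lambda>xs. xs ! i) rs d s ?P ?T"
    unfolding computes_def
  proof (intro allI impI, elim conjE)
    fix xs :: "bool list list" and w and m :: mem
    assume xs: "length xs = n" "\<forall>i<n. m (rs ! i) = reg (xs ! i)" "m d = out w" "\<forall>j\<ge>s. m j = reg []"
    let ?x = "xs ! i"
    let ?S = "\<lambda>l. m(?r := (string_tape ?x, int l), d := out (w @ take l ?x))"
    have "runs (Wh ?r {1, 2} ?B) (?S 0) (length ?x * Suc (Suc 2 + 1) + 1) (?S (length ?x))"
    proof (rule runs_Wh)
      fix l assume l: "l < length ?x"
      then show "read_tape (?S l ?r) \<in> {1, 2}" using string_tape_in[of "int l" ?x] ne by auto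
      have "runs (emit d (?x ! l)) (?S l) 2 ((?S l)(d := out ((w @ take l ?x) @ [?x ! l])))"
        by (rule runs_emit) simp
      then have "runs (Ite ?r {2} (emit d True) (emit d False)) (?S l) (Suc 2)
          (m(?r := (string_tape ?x, int l), d := out (w @ take (Suc l) ?x)))"
        using l ne by (intro runs_Ite) (auto simp: take_Suc_conv_app_nth string_tape_def split: if_splits)
      moreover have "runs (Mv ?r Move_Right) (m(?r := (string_tape ?x, int l), d := out (w @ take (Suc l) ?x))) 1
          (?S (Suc l))"
        by (rule runs_Mv) (use ne in \<open>auto simp: fun_eq_iff\<close>)
      ultimately show "runs ?B (?S l) (Suc 2 + 1) (?S (Suc l))"
        by (rule runs_Sq)
    qed (use ne in \<open>simp add: string_tape_out\<close>)
    moreover have "?S 0 = m" using xs i ne by (auto simp: fun_eq_iff reg_def)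
    moreover have "runs (rewind ?r) (?S (length ?x)) (2 * length ?x + 3) ((?S (length ?x))(?r := reg ?x))"
      by (rule runs_rewind) (use ne in auto)
    moreover have "(?S (length ?x))(?r := reg ?x) = m(d := out (w @ ?x))"
      using xs i ne by (auto simp: fun_eq_iff)
    ultimately have "runs ?P m (?T (length ?x)) (m(d := out (w @ ?x)))"
      by (metis runs_Sq)
    moreover have "length ?x \<le> tot xs" unfolding tot_def
      using i xs(1) by (intro member_le_sum_list) auto
    ultimately show "runs ?P m (?T (tot xs)) (m(d := out (w @ ?x)))"
      by (elim runs_mono) auto
  qed
  moreover have "wf_prog (Suc (max ?r d)) ?P" by (auto simp: emit_def rewind_def less_Suc_eq_le)
  moreover have "pbound ?T" by (intro pbound_intros)
  ultimately show "\<exists>P k g'. wf_prog k P \<and> pbound g' \<and> computes n (\<lambda>xs. xs ! i) rs d s P g'" by blast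
qed

text \<open>The head on the first argument stops at the end of its word, so that it can be rewound.\<close>

lemma ptime_nth_args:
  "ptime 2 (\<lambda>xs. if length (xs ! 1) < length (xs ! 0) then [xs ! 0 ! length (xs ! 1)] else [])"
    (is "ptime 2 ?f")
proof (rule ptimeI)
  fix rs :: "nat list" and d s :: nat
  assume rs: "length rs = 2" "distinct rs" "d \<notin> set rs" "\<forall>r\<in>set rs. r < s" "d < s"
  define a b where "a = rs ! 0" and "b = rs ! 1"
  have "a \<in> set rs" "b \<in> set rs" using rs(1) by (simp_all add: a_def b_def)
  moreover have "a \<noteq> b" using rs(1,2) by (simp add: a_def b_def nth_eq_iff_index_eq)
  ultimately have ne: "a \<noteq> b" "a \<noteq> d" "b \<noteq> d" using rs by auto
  let ?B = "Sq (Ite a {1, 2} (Mv a Move_Right) (Mv a Stay)) (Mv b Move_Right)"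
  let ?E = "Ite a {2} (emit d True) (Ite a {1} (emit d False) (Mv d Stay))"
  let ?P = "Sq (Wh b {1, 2} ?B) (Sq ?E (Sq (rewind a) (rewind b)))"
  let ?T = "\<lambda>n. (n * Suc (Suc 1 + 1) + 1) + (4 + ((2 * n + 3) + (2 * n + 3)))"
  have "computes 2 ?f rs d s ?P ?T"
    unfolding computes_def
  proof (intro allI impI, elim conjE)
    fix xs :: "bool list list" and w and m :: mem
    assume xs: "length xs = 2" "\<forall>i<2. m (rs ! i) = reg (xs ! i)" "m d = out w" "\<forall>j\<ge>s. m j = reg []"
    define x y where "x = xs ! 0" and "y = xs ! 1"
    have m: "m a = reg x" "m b = reg y" using xs(2) by (simp_all add: a_def b_def x_def y_def)
    have len: "length x \<le> tot xs" "length y \<le> tot xs"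
      unfolding tot_def x_def y_def using xs(1) by (intro member_le_sum_list; simp)+
    let ?S = "\<lambda>l. m(a := (string_tape x, int (min l (length x))), b := (string_tape y, int l))"
    let ?o = "if length y < length x then [x ! length y] else []"
    let ?n = "length y"
    have "runs (Wh b {1, 2} ?B) (?S 0) (?n * Suc (Suc 1 + 1) + 1) (?S ?n)"
    proof (rule runs_Wh)
      fix l assume l: "l < ?n"
      then show "read_tape (?S l b) \<in> {1, 2}" using string_tape_in[of "int l" y] ne by auto
      let ?M = "m(a := (string_tape x, int (min (Suc l) (length x))), b := (string_tape y, int l))"
      have "runs (Ite a {1, 2} (Mv a Move_Right) (Mv a Stay)) (?S l) (Suc 1) ?M"
      proof (rule runs_Ite)
        assume "read_tape (?S l a) \<in> {1, 2}"
        then have "l < length x" using ne string_tape_out[of "int (min l (length x))" x]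
          by (cases "l < length x") (auto simp: min_def split: if_splits)
        then show "runs (Mv a Move_Right) (?S l) 1 ?M"
          by (intro runs_Mv) (use ne in \<open>auto simp: fun_eq_iff\<close>)
      next
        assume "read_tape (?S l a) \<notin> {1, 2}"
        then have "length x \<le> l" using ne string_tape_in[of "int l" x]
          by (cases "l < length x") (auto simp: min_def)
        then show "runs (Mv a Stay) (?S l) 1 ?M"
          by (intro runs_Mv) (use ne in \<open>auto simp: fun_eq_iff\<close>)
      qed
      moreover have "runs (Mv b Move_Right) ?M 1 (?S (Suc l))"
        by (rule runs_Mv) (use ne in \<open>auto simp: fun_eq_iff\<close>)
      ultimately show "runs ?B (?S l) (Suc 1 + 1) (?S (Suc l))"
        by (rule runs_Sq)
    qed (use ne in \<open>simp add: string_tape_out\<close>)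
    moreover have "?S 0 = m" using m ne by (auto simp: fun_eq_iff reg_def)
    ultimately have 1: "runs (Wh b {1, 2} ?B) m (tot xs * Suc (Suc 1 + 1) + 1) (?S ?n)"
      using len by (auto elim!: runs_mono)
    let ?M = "(?S ?n)(d := out (w @ ?o))"
    have 2: "runs ?E (?S ?n) 4 ?M"
    proof (cases "length y < length x")
      case True
      have r: "read_tape (?S ?n a) = (if x ! length y then 2 else 1)"
        using True ne by (simp add: string_tape_def)
      have e: "runs (emit d (x ! length y)) (?S ?n) 2 ?M"
        using runs_emit[of "?S ?n" d w "x ! length y"] True ne xs(3) by simp
      show ?thesis
      proof (cases "x ! length y")
        case True
        then have "runs ?E (?S ?n) (Suc 2) ?M" using r e by (intro runs_Ite) auto
        then show ?thesis by (rule runs_mono) simp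
      next
        case False
        then have "runs ?E (?S ?n) (Suc (Suc 2)) ?M" using r e by (intro runs_Ite) auto
        then show ?thesis by (rule runs_mono) simp
      qed
    next
      case False
      have r: "read_tape (?S ?n a) = 0"
        using False ne by (simp add: string_tape_out)
      have "runs (Mv d Stay) (?S ?n) 1 ?M"
        by (rule runs_Mv) (use xs(3) ne False in \<open>auto simp: fun_eq_iff out_def\<close>)
      then have "runs ?E (?S ?n) (Suc (Suc 1)) ?M" using r by (intro runs_Ite) auto
      then show ?thesis by (rule runs_mono) simp
    qed
    have "runs (rewind a) ?M (2 * min ?n (length x) + 3) (?M(a := reg x))"
      by (rule runs_rewind) (use ne in auto)
    then have 3: "runs (rewind a) ?M (2 * tot xs + 3) (?M(a := reg x))"
      using len by (auto elim!: runs_mono)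
    have "runs (rewind b) (?M(a := reg x)) (2 * ?n + 3) (?M(a := reg x, b := reg y))"
      by (rule runs_rewind) (use ne in auto)
    moreover have "?M(a := reg x, b := reg y) = m(d := out (w @ ?o))"
      using m ne by (auto simp: fun_eq_iff)
    ultimately have 4: "runs (rewind b) (?M(a := reg x)) (2 * tot xs + 3) (m(d := out (w @ ?o)))"
      using len by (auto elim!: runs_mono)
    show "runs ?P m (?T (tot xs)) (m(d := out (w @ ?f xs)))"
      using runs_Sq[OF 1 runs_Sq[OF 2 runs_Sq[OF 3 4]]] unfolding x_def y_def .
  qed
  moreover have "wf_prog (Suc (max (max a b) d)) ?P" by (auto simp: emit_def rewind_def less_Suc_eq_le)
  moreover have "pbound ?T" by (intro pbound_intros)
  ultimately show "\<exists>P k g'. wf_prog k P \<and> pbound g' \<and> computes 2 ?f rs d s P g'" by blast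
qed

lemma ptime_test_last:
  assumes "ptime n f" "ptime n g"
  shows "ptime (Suc n) (\<lambda>ys. if string_tape (ys ! n) 0 \<in> A then f (take n ys) else g (take n ys))"
    (is "ptime _ ?f")
proof (rule ptimeI)
  fix rs :: "nat list" and d s :: nat
  assume rs: "length rs = Suc n" "distinct rs" "d \<notin> set rs" "\<forall>r\<in>set rs. r < s" "d < s"
  obtain P k a where P: "wf_prog k P" "pbound a" "computes (Suc n) (\<lambda>ys. f (take n ys)) rs d s P a"
    by (rule ptimeD[OF ptime_take[OF assms(1)] rs(1-3) _ rs(5)]) (use rs in auto)
  obtain Q l b where Q: "wf_prog l Q" "pbound b" "computes (Suc n) (\<lambda>ys. g (take n ys)) rs d s Q b"
    by (rule ptimeD[OF ptime_take[OF assms(2)] rs(1-3) _ rs(5)]) (use rs in auto)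
  have "computes (Suc n) ?f rs d s (Ite (rs ! n) A P Q) (\<lambda>n. Suc (a n + b n))"
    unfolding computes_def
  proof (intro allI impI, elim conjE)
    fix xs :: "bool list list" and w and m :: mem
    assume xs: "length xs = Suc n" "\<forall>i<Suc n. m (rs ! i) = reg (xs ! i)" "m d = out w" "\<forall>j\<ge>s. m j = reg []"
    have r: "read_tape (m (rs ! n)) = string_tape (xs ! n) 0" using xs(2) by (simp add: reg_def)
    have "runs P m (a (tot xs)) (m(d := out (w @ f (take n xs))))"
      by (rule computesD[OF P(3)]) (use xs in auto)
    then have 1: "runs P m (a (tot xs) + b (tot xs)) (m(d := out (w @ f (take n xs))))"
      by (rule runs_mono) simp
    have "runs Q m (b (tot xs)) (m(d := out (w @ g (take n xs))))"
      by (rule computesD[OF Q(3)]) (use xs in auto)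
    then have 2: "runs Q m (a (tot xs) + b (tot xs)) (m(d := out (w @ g (take n xs))))"
      by (rule runs_mono) simp
    show "runs (Ite (rs ! n) A P Q) m (Suc (a (tot xs) + b (tot xs))) (m(d := out (w @ ?f xs)))"
      by (rule runs_Ite) (use 1 2 r in auto)
  qed
  moreover have "wf_prog (max (max k l) (Suc (rs ! n))) (Ite (rs ! n) A P Q)" using P Q wf_prog_mono by auto
  moreover have "pbound (\<lambda>n. Suc (a n + b n))" using P Q pbound_add[OF pbound_const[of 1], of "\<lambda>n. a n + b n"] pbound_add by simp
  ultimately show "\<exists>P k g'. wf_prog k P \<and> pbound g' \<and> computes (Suc n) ?f rs d s P g'" by blast
qed

lemma ptime_test:
  assumes "ptime n c" "ptime n f" "ptime n g"
  shows "ptime n (\<lambda>xs. if string_tape (c xs) 0 \<in> A then f xs else g xs)"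
  by (rule ptime_cong[OF ptime_let[OF assms(1) ptime_test_last[OF assms(2,3), of A]]]) (auto simp: nth_append)

text \<open>The word of the last argument acts as a unary loop bound. In the body its place is taken
  by the counter, a unary word on tape \<open>s\<close> that grows by one symbol per round.\<close>

lemma ptime_for_args:
  assumes f: "ptime (Suc n) f"
  shows "ptime (Suc n) (\<lambda>ys. concat (map (\<lambda>i. f (take n ys @ [replicate i True])) [0..<length (ys ! n)]))"
    (is "ptime _ ?F")
proof (rule ptimeI)
  fix rs :: "nat list" and d s :: nat
  assume rs: "length rs = Suc n" "distinct rs" "d \<notin> set rs" "\<forall>r\<in>set rs. r < s" "d < s"
  let ?c = "rs ! n" and ?rs = "take n rs @ [s]"
  have lt: "rs ! i < s" "rs ! i \<noteq> d" if "i < Suc n" for i using rs that by (metis nth_mem)+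
  have cn: "rs ! i \<noteq> ?c" if "i < n" for i using rs that by (simp add: nth_eq_iff_index_eq)
  have "r < s" "r \<noteq> d" if "r \<in> set (take n rs)" for r using rs that in_set_takeD by metis+
  then have ob: "length ?rs = Suc n" "distinct ?rs" "d \<notin> set ?rs" "\<And>r. r \<in> set ?rs \<Longrightarrow> r < Suc s" "d < Suc s"
    using rs by (auto simp: less_SucI)
  obtain P k a where P: "wf_prog k P" "pbound a" "computes (Suc n) f ?rs d (Suc s) P a"
    by (rule ptimeD[OF f ob])
  let ?B = "Sq P (Sq (goto_end s) (Sq (emit s True) (Sq (rewind s) (Mv ?c Move_Right))))"
  let ?P = "Sq (Wh ?c {1, 2} ?B) (Sq (rewind ?c) (Sq (goto_end s) (erase s)))"
  let ?b = "\<lambda>n. a (2 * n) + ((2 * n + 1) + (2 + ((2 * n + 3) + 1)))"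
  let ?T = "\<lambda>n. (n * (1 + ?b n) + 1) + ((2 * n + 3) + ((2 * n + 1) + (3 * n + 3)))"
  have "computes (Suc n) ?F rs d s ?P ?T"
    unfolding computes_def
  proof (intro allI impI, elim conjE)
    fix xs :: "bool list list" and w and m :: mem
    assume xs: "length xs = Suc n" "\<forall>i<Suc n. m (rs ! i) = reg (xs ! i)" "m d = out w" "\<forall>j\<ge>s. m j = reg []"
    let ?u = "xs ! n" and ?N = "tot xs" and ?ys = "take n xs"
    let ?n = "length ?u"
    let ?G = "\<lambda>i. concat (map (\<lambda>i. f (?ys @ [replicate i True])) [0..<i])"
    have len: "?n \<le> ?N" unfolding tot_def using xs(1) by (intro member_le_sum_list) auto
    let ?M = "\<lambda>i x o'. m(?c := (string_tape ?u, int i), s := x, d := out (w @ o'))"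
    let ?S = "\<lambda>i. ?M i (reg (replicate i True)) (?G i)"
    have ne: "?c \<noteq> s" "?c \<noteq> d" "s \<noteq> d" using lt[of n] rs by auto
    have W: "runs (Wh ?c {1, 2} ?B) (?S 0) (?n * Suc (?b ?N) + 1) (?S ?n)"
    proof (rule runs_Wh)
      fix i assume i: "i < ?n"
      then show "read_tape (?S i ?c) \<in> {1, 2}" using string_tape_in[of "int i" ?u] ne by auto
      let ?r = "replicate i True"
      have "runs P (?S i) (a (tot (?ys @ [?r]))) ((?S i)(d := out ((w @ ?G i) @ f (?ys @ [?r]))))"
      proof (rule computesD[OF P(3)])
        fix j assume "j < Suc n"
        then show "?S i (?rs ! j) = reg ((?ys @ [?r]) ! j)"
          using xs rs(1) ne lt[of j] cn[of j] by (cases "j = n") (auto simp: nth_append)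
      next
        fix j assume "Suc s \<le> j"
        then have "j \<noteq> ?c" "j \<noteq> s" "j \<noteq> d" "s \<le> j" using lt[of n] rs(5) by auto
        then show "?S i j = reg []" using xs(4) by simp
      qed (use xs in auto)
      note r = this
      have "tot (?ys @ [?r]) \<le> 2 * ?N"
      proof -
        have "?ys @ [?u] = xs" using xs(1) take_Suc_conv_app_nth[of n xs] by simp
        moreover have "tot (?ys @ [?u]) = tot ?ys + ?n" by (simp add: tot_def)
        moreover have "tot (?ys @ [?r]) = tot ?ys + i" by (simp add: tot_def)
        ultimately show ?thesis using i by simp
      qed
      then have "a (tot (?ys @ [?r])) \<le> a (2 * ?N)" by (rule pbound_mono[OF P(2)])
      moreover have "(?S i)(d := out ((w @ ?G i) @ f (?ys @ [?r]))) = ?M i (reg ?r) (?G (Suc i))"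
        by simp
      ultimately have 1: "runs P (?S i) (a (2 * ?N)) (?M i (reg ?r) (?G (Suc i)))"
        using runs_eq[OF r] by blast
      have 2: "runs (goto_end s) (?M i (reg ?r) (?G (Suc i))) (2 * ?N + 1) (?M i (out ?r) (?G (Suc i)))"
        by (rule runs_eq[OF runs_goto_end[of _ s ?r]])
           (use i len ne in \<open>simp_all add: fun_upd_twist del: upt_Suc\<close>)
      let ?r' = "replicate (Suc i) True"
      have 3: "runs (emit s True) (?M i (out ?r) (?G (Suc i))) 2 (?M i (out ?r') (?G (Suc i)))"
        by (rule runs_eq[OF runs_emit[of _ s ?r]])
           (use ne in \<open>simp_all add: fun_upd_twist replicate_append_same del: upt_Suc\<close>)
      have 4: "runs (rewind s) (?M i (out ?r') (?G (Suc i))) (2 * ?N + 3) (?M i (reg ?r') (?G (Suc i)))"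
        by (rule runs_eq[OF runs_rewind[of _ s ?r' "Suc i"]])
           (use i len ne in \<open>simp_all add: fun_upd_twist out_def del: upt_Suc\<close>)
      have 5: "runs (Mv ?c Move_Right) (?M i (reg ?r') (?G (Suc i))) 1 (?S (Suc i))"
        by (rule runs_Mv) (use ne in \<open>auto simp: fun_eq_iff simp del: upt_Suc\<close>)
      show "runs ?B (?S i) (?b ?N) (?S (Suc i))"
        by (rule runs_Sq[OF 1 runs_Sq[OF 2 runs_Sq[OF 3 runs_Sq[OF 4 5]]]])
    qed (use ne in \<open>simp add: string_tape_out\<close>)
    have S0: "?S 0 = m" using xs ne by (auto simp: fun_eq_iff reg_def)
    have "?n * Suc (?b ?N) + 1 \<le> ?N * (1 + ?b ?N) + 1"
      using mult_le_mono1[OF len, of "Suc (?b ?N)"] by simp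
    with W[unfolded S0] have 1: "runs (Wh ?c {1, 2} ?B) m (?N * (1 + ?b ?N) + 1) (?S ?n)"
      by (rule runs_mono)
    let ?r = "replicate ?n True"
    let ?m1 = "m(s := reg ?r, d := out (w @ ?G ?n))" and ?m2 = "m(s := out ?r, d := out (w @ ?G ?n))"
    have 2: "runs (rewind ?c) (?S ?n) (2 * ?N + 3) ?m1"
      by (rule runs_eq[OF runs_rewind[of _ ?c ?u ?n]]) (use len ne xs in \<open>simp_all add: fun_eq_iff\<close>)
    have 3: "runs (goto_end s) ?m1 (2 * ?N + 1) ?m2"
      by (rule runs_eq[OF runs_goto_end[of _ s ?r]]) (use len ne in \<open>simp_all add: fun_upd_twist\<close>)
    have 4: "runs (erase s) ?m2 (3 * ?N + 3) (m(d := out (w @ ?G ?n)))"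
      by (rule runs_eq[OF runs_erase[of _ s ?r]]) (use len ne xs in \<open>simp_all add: fun_eq_iff\<close>)
    show "runs ?P m (?T ?N) (m(d := out (w @ ?F xs)))"
      by (rule runs_Sq[OF 1 runs_Sq[OF 2 runs_Sq[OF 3 4]]])
  qed
  moreover have "wf_prog (max k (Suc s)) ?P"
    using P wf_prog_mono lt[of n] by (auto simp: rewind_def goto_end_def erase_def emit_def less_Suc_eq less_max_iff_disj)
  moreover have "pbound ?T"
    by (insert P(2)) (assumption | rule pbound_intros pbound_comp[of a])+
  ultimately show "\<exists>P k g'. wf_prog k P \<and> pbound g' \<and> computes (Suc n) ?F rs d s P g'" by blast
qed

section \<open>Polynomial-time arithmetic in unary\<close>

text \<open>In unary, every computable value is automatically polynomially bounded and can be used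
  as a loop bound or a position. A predicate is true when its word is nonempty.\<close>

definition pnum :: "nat \<Rightarrow> (bool list list \<Rightarrow> nat) \<Rightarrow> bool" where
  "pnum n h \<longleftrightarrow> ptime n (\<lambda>xs. replicate (h xs) True)"

definition ppred :: "nat \<Rightarrow> (bool list list \<Rightarrow> bool) \<Rightarrow> bool" where
  "ppred n P \<longleftrightarrow> ptime n (\<lambda>xs. if P xs then [True] else [])"

lemma ppred_cong: "ppred n P \<Longrightarrow> (\<And>xs. length xs = n \<Longrightarrow> P xs \<longleftrightarrow> Q xs) \<Longrightarrow> ppred n Q"
  unfolding ppred_def by (erule ptime_cong) simp

lemma ptime_for:
  assumes "pnum n u" "ptime (Suc n) (\<lambda>ys. F (take n ys) (length (ys ! n)))"
  shows "ptime n (\<lambda>xs. concat (map (F xs) [0..<u xs]))"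
  by (rule ptime_cong[OF ptime_let[OF assms(1)[unfolded pnum_def] ptime_for_args[OF assms(2)]]])
     (simp add: nth_append)

lemma ptime_if:
  assumes "ppred n P" "ptime n f" "ptime n g"
  shows "ptime n (\<lambda>xs. if P xs then f xs else g xs)"
  by (rule ptime_cong[OF ptime_test[OF assms(1)[unfolded ppred_def] assms(2,3), of "{2}"]])
     (simp add: string_tape_def)

lemma ppred_hd: "ptime n c \<Longrightarrow> ppred n (\<lambda>xs. c xs \<noteq> [] \<and> hd (c xs))"
  unfolding ppred_def
  by (rule ptime_cong[OF ptime_test[OF _ ptime_bit ptime_Nil, of n c "{2}"]])
     (auto simp: string_tape_def hd_conv_nth)

lemma ppred_nonempty: "ptime n c \<Longrightarrow> ppred n (\<lambda>xs. c xs \<noteq> [])"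
  unfolding ppred_def
  by (rule ptime_cong[OF ptime_test[OF _ ptime_bit ptime_Nil, of n c "{1, 2}"]])
     (auto simp: string_tape_def)

lemma ptime_nth:
  assumes "ptime n a" "ptime n b"
  shows "ptime n (\<lambda>xs. if length (b xs) < length (a xs) then [a xs ! length (b xs)] else [])"
proof -
  have "ptime (Suc (Suc n)) (\<lambda>xs. if length (xs ! Suc n) < length (xs ! n) then [xs ! n ! length (xs ! Suc n)] else [])"
    by (rule ptime_cong[OF ptime_select[OF ptime_nth_args, of "[n, Suc n]" "Suc (Suc n)"]]) auto
  from ptime_let[OF ptime_take[OF assms(2)] this]
  have "ptime (Suc n) (\<lambda>xs. if length (b (take n xs)) < length (xs ! n) then [xs ! n ! length (b (take n xs))] else [])"
    by (rule ptime_cong) (simp add: nth_append)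
  from ptime_let[OF assms(1) this] show ?thesis
    by (rule ptime_cong) (simp add: nth_append)
qed

text \<open>The unary word of length \<open>b xs\<close> has a symbol at position
  \<open>a xs\<close> exactly if \<open>a xs < b xs\<close>.\<close>

lemma ppred_less: "pnum n a \<Longrightarrow> pnum n b \<Longrightarrow> ppred n (\<lambda>xs. a xs < b xs)"
  unfolding pnum_def
  by (rule ppred_cong[OF ppred_nonempty[OF ptime_nth[of n "\<lambda>xs. replicate (b xs) True" "\<lambda>xs. replicate (a xs) True"]]])
     auto

lemma ppred_nth: "ptime n a \<Longrightarrow> pnum n i \<Longrightarrow> ppred n (\<lambda>xs. i xs < length (a xs) \<and> a xs ! i xs)"
  unfolding pnum_def
  by (rule ppred_cong[OF ppred_hd[OF ptime_nth[of n a "\<lambda>xs. replicate (i xs) True"]]]) auto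

lemma ppred_const: "ppred n (\<lambda>xs. b)"
  unfolding ppred_def by (rule ptime_const)

lemma ppred_not: "ppred n P \<Longrightarrow> ppred n (\<lambda>xs. \<not> P xs)"
  unfolding ppred_def[of n "\<lambda>xs. \<not> P xs"]
  by (rule ptime_cong[OF ptime_if[of n P "\<lambda>_. []" "\<lambda>_. [True]"]]) (auto intro: ptime_const)

lemma ppred_conj: "ppred n P \<Longrightarrow> ppred n Q \<Longrightarrow> ppred n (\<lambda>xs. P xs \<and> Q xs)"
  unfolding ppred_def[of n "\<lambda>xs. P xs \<and> Q xs"]
  by (rule ptime_cong[OF ptime_if[of n P "\<lambda>xs. if Q xs then [True] else []" "\<lambda>_. []"]])
     (auto intro: ptime_const ptime_if)

lemma ppred_disj: "ppred n P \<Longrightarrow> ppred n Q \<Longrightarrow> ppred n (\<lambda>xs. P xs \<or> Q xs)"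
  using ppred_not[OF ppred_conj[OF ppred_not[of n P] ppred_not[of n Q]]] by simp

lemma ppred_iff: "ppred n P \<Longrightarrow> ppred n Q \<Longrightarrow> ppred n (\<lambda>xs. P xs \<longleftrightarrow> Q xs)"
  unfolding ppred_def[of n "\<lambda>xs. P xs \<longleftrightarrow> Q xs"]
  by (rule ptime_cong[OF ptime_if[of n P "\<lambda>xs. if Q xs then [True] else []" "\<lambda>xs. if Q xs then [] else [True]"]])
     (auto intro: ptime_const ptime_if)

lemma ppred_le: "pnum n a \<Longrightarrow> pnum n b \<Longrightarrow> ppred n (\<lambda>xs. a xs \<le> b xs)"
  using ppred_not[OF ppred_less[of n b a]] by (simp add: not_less)

lemma ppred_eq: "pnum n a \<Longrightarrow> pnum n b \<Longrightarrow> ppred n (\<lambda>xs. a xs = b xs)"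
  using ppred_conj[OF ppred_le[of n a b] ppred_le[of n b a]] by (simp add: eq_iff)

lemma pnum_const: "pnum n (\<lambda>xs. c)"
  unfolding pnum_def by (rule ptime_const)

lemma pnum_length:
  assumes "i < n" shows "pnum n (\<lambda>xs. length (xs ! i))"
  unfolding pnum_def
proof (rule ptime_cong[OF ptime_let[OF ptime_arg[OF assms] ptime_for_args[OF ptime_bit[of _ True]]]])
  have "concat (map (\<lambda>i. [True]) [0..<k]) = replicate k True" for k
    by (induction k) (auto simp: replicate_append_same)
  then show "concat (map (\<lambda>i. [True]) [0..<length ((xs @ [xs ! i]) ! n)]) = replicate (length (xs ! i)) True"
    if "length xs = n" for xs using that by (simp add: nth_append)
qed

lemma pnum_if: "ppred n P \<Longrightarrow> pnum n a \<Longrightarrow> pnum n b \<Longrightarrow> pnum n (\<lambda>xs. if P xs then a xs else b xs)"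
  unfolding pnum_def
  by (rule ptime_cong[OF ptime_if[of n P "\<lambda>xs. replicate (a xs) True" "\<lambda>xs. replicate (b xs) True"]]) auto

lemma pnum_add: "pnum n a \<Longrightarrow> pnum n b \<Longrightarrow> pnum n (\<lambda>xs. a xs + b xs)"
  unfolding pnum_def by (rule ptime_cong[OF ptime_append]) (auto simp: replicate_add)

lemma pnum_Suc: "pnum n a \<Longrightarrow> pnum n (\<lambda>xs. Suc (a xs))"
  using pnum_add[OF pnum_const[of n 1]] by simp

lemma pnum_take: "pnum n a \<Longrightarrow> pnum (Suc n) (\<lambda>ys. a (take n ys))"
  unfolding pnum_def by (rule ptime_take)

lemma pnum_mult:
  assumes "pnum n a" "pnum n b" shows "pnum n (\<lambda>xs. a xs * b xs)"
  unfolding pnum_def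
proof (rule ptime_cong[OF ptime_for[OF assms(1)]])
  show "ptime (Suc n) (\<lambda>ys. replicate (b (take n ys)) True)"
    using pnum_take[OF assms(2)] unfolding pnum_def .
  have "concat (map (\<lambda>_. replicate y True) [0..<x]) = replicate (x * y) True" for x y :: nat
    by (induction x) (auto simp: replicate_add[symmetric] add.commute)
  then show "concat (map (\<lambda>_. replicate (b xs) True) [0..<a xs]) = replicate (a xs * b xs) True" for xs .
qed

lemma concat_if_replicate:
  "concat (map (\<lambda>i. if P i then [True] else []) [0..<n]) = replicate (card {i. i < n \<and> P i}) True"
proof (induction n)
  case (Suc n)
  have "{i. i < Suc n \<and> P i} = {i. i < n \<and> P i} \<union> (if P n then {n} else {})" by (auto simp: less_Suc_eq)
  with Suc show ?case by (simp add: replicate_append_same)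
qed simp

text \<open>Emitting one symbol per successful test counts; subtraction and division are obtained as
  such counts.\<close>

lemma pnum_card:
  assumes "pnum n u" "ppred (Suc n) (\<lambda>ys. P (take n ys) (length (ys ! n)))"
  shows "pnum n (\<lambda>xs. card {i. i < u xs \<and> P xs i})"
  unfolding pnum_def
  using ptime_for[OF assms(1) assms(2)[unfolded ppred_def]] by (simp add: concat_if_replicate)

lemma pnum_diff:
  assumes "pnum n a" "pnum n b" shows "pnum n (\<lambda>xs. a xs - b xs)"
proof -
  have "ppred (Suc n) (\<lambda>ys. b (take n ys) \<le> length (ys ! n))"
    by (intro ppred_le pnum_take assms pnum_length) simp
  from pnum_card[OF assms(1) this]
  have "pnum n (\<lambda>xs. card {i. i < a xs \<and> b xs \<le> i})" .
  moreover have "{i. i < a xs \<and> b xs \<le> i} = {b xs..<a xs}" for xs by auto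
  ultimately show ?thesis by simp
qed

text \<open>The quotient is the number of positive multiples of the divisor up to the dividend. The
  extra test \<open>0 < b xs\<close> reproduces the value 0 of division by zero.\<close>

lemma pnum_div:
  assumes "pnum n a" "pnum n b" shows "pnum n (\<lambda>xs. a xs div b xs)"
proof -
  have "ppred (Suc n) (\<lambda>ys. 0 < b (take n ys) \<and> Suc (length (ys ! n)) * b (take n ys) \<le> a (take n ys))"
    by (intro ppred_le ppred_less ppred_conj pnum_const pnum_mult pnum_Suc pnum_take assms pnum_length) simp
  from pnum_card[OF assms(1) this]
  have "pnum n (\<lambda>xs. card {i. i < a xs \<and> 0 < b xs \<and> Suc i * b xs \<le> a xs})" .
  moreover have "card {i. i < x \<and> 0 < y \<and> Suc i * y \<le> x} = x div y" for x y :: nat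
  proof (cases "y = 0")
    case False
    have eq: "Suc i * y \<le> x \<longleftrightarrow> i < x div y" for i
      using False by (simp add: less_eq_div_iff_mult_less_eq[of y "Suc i", symmetric] Suc_le_eq del: mult_Suc)
    have "{i. i < x \<and> 0 < y \<and> i < x div y} = {..<x div y}"
      using False less_le_trans[OF _ div_le_dividend[of x y]] by auto
    then have "{i. i < x \<and> 0 < y \<and> Suc i * y \<le> x} = {..<x div y}" unfolding eq .
    then show ?thesis by simp
  qed simp
  ultimately show ?thesis by simp
qed

lemma pnum_mod: "pnum n a \<Longrightarrow> pnum n b \<Longrightarrow> pnum n (\<lambda>xs. a xs mod b xs)"
  using pnum_diff[OF _ pnum_mult[OF pnum_div[of n a b], of b], of a] by (simp add: minus_div_mult_eq_mod)

lemma pnum_power: "pnum n a \<Longrightarrow> pnum n (\<lambda>xs. a xs ^ e)"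
  by (induction e) (simp_all add: pnum_const pnum_mult)

lemma ppred_odd: "pnum n a \<Longrightarrow> ppred n (\<lambda>xs. odd (a xs))"
  using ppred_eq[OF pnum_mod[OF _ pnum_const, of n a 2] pnum_const, of 1] by (simp add: odd_iff_mod_2_eq_one)

lemma ppred_mem:
  assumes "pnum n a" "finite A" shows "ppred n (\<lambda>xs. a xs \<in> A)"
  using assms(2)
proof induction
  case (insert x A)
  with ppred_disj[OF ppred_eq[OF assms(1) pnum_const[of n x]]] show ?case by simp
qed (simp add: ppred_const)

lemma ppred_mem_pair:
  assumes "pnum n a" "pnum n b" "finite A" shows "ppred n (\<lambda>xs. (a xs, b xs) \<in> A)"
  using assms(3)
proof induction
  case (insert x A)
  from ppred_disj[OF ppred_conj[OF ppred_eq[OF assms(1) pnum_const[of n "fst x"]]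
      ppred_eq[OF assms(2) pnum_const[of n "snd x"]]] insert.IH] show ?case by (simp add: prod_eq_iff)
qed (simp add: ppred_const)

lemmas pnum_intros = pnum_const pnum_add pnum_Suc pnum_mult pnum_diff pnum_div pnum_mod pnum_power
lemmas ppred_intros = ppred_const ppred_not ppred_conj ppred_disj ppred_iff ppred_less ppred_le
  ppred_eq ppred_odd

text \<open>The machine model expects the result on the first tape, which holds an argument. The
  result is therefore built on tape \<open>n\<close>, tape 0 is erased, and the result is copied
  over.\<close>

lemma ptime_imp_polytime:
  assumes f: "ptime n f" and n: "0 < n" shows "polytime n f"
proof -
  obtain P k a where P: "wf_prog k P" "pbound a" "computes n f [0..<n] n (Suc n) P a"
    by (rule ptimeD[OF f, of "[0..<n]" n "Suc n"]) auto
  obtain Q l b where Q: "wf_prog l Q" "pbound b" "computes 1 (\<lambda>xs. xs ! 0) [n] 0 (Suc n) Q b"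
    by (rule ptimeD[OF ptime_arg[of 0 1], of "[n]" 0 "Suc n"]) (use n in auto)
  obtain h where h: "pbound h" "\<And>xs. length xs = n \<Longrightarrow> length (f xs) \<le> h (tot xs)"
    using ptime_length[OF f] by blast
  let ?P = "Sq P (Sq (goto_end 0) (Sq (erase 0) (Sq (rewind n) Q)))"
  let ?T = "\<lambda>n. a n + ((2 * n + 1) + ((3 * n + 3) + ((2 * h n + 3) + b (h n))))"
  let ?K = "max (max k l) (Suc n)"
  let ?M = "\<lparr>tm_tapes = ?K, tm_states = prog_states ?P, tm_symbols = 3, tm_delta = prog_delta ?P\<rparr>"
  have wf: "wf_prog ?K ?P"
    using P Q wf_prog_mono n by (auto simp: rewind_def goto_end_def erase_def)
  have "tm_wf ?M"
    unfolding tm_wf_def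
  proof (intro conjI allI impI; (elim conjE)?)
    fix q ss assume "q < tm_states ?M" "length ss = tm_tapes ?M" "set ss \<subseteq> {..<tm_symbols ?M}"
    then show "case tm_delta ?M q ss of (q', acts) \<Rightarrow> q' \<le> tm_states ?M \<and> length acts = tm_tapes ?M \<and>
       (\<forall>(s, mv)\<in>set acts. s < tm_symbols ?M)"
      using prog_delta_wf[OF wf, of ss q] by (auto simp del: prog_delta.simps prog_states.simps simp: case_prod_beta)
  qed auto
  moreover have "\<exists>c e. \<forall>n. ?T n \<le> c * n ^ e + c"
    by (rule pbound_le, insert P(2) Q(2) h(1)) (assumption | rule pbound_intros pbound_comp[of b])+
  then obtain c e where ce: "\<And>n. ?T n \<le> c * n ^ e + c" by blast
  have "tm_computes_within ?M xs (f xs) (c * (\<Sum>x\<leftarrow>xs. length x) ^ e + c)" if xs: "length xs = n" for xs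
  proof -
    let ?N = "tot xs"
    let ?m = "\<lambda>i. reg (if i < length xs then xs ! i else [])"
    have len: "length (xs ! 0) \<le> ?N" unfolding tot_def using n xs by (intro member_le_sum_list) auto
    have len': "length (f xs) \<le> h ?N" using h xs by blast
    let ?m1 = "?m(n := out (f xs))" and ?m2 = "?m(n := out (f xs), 0 := out (xs ! 0))"
    let ?m3 = "?m(n := out (f xs), 0 := out [])" and ?m4 = "?m(n := reg (f xs), 0 := out [])"
    have 1: "runs P ?m (a ?N) ?m1"
      using computesD[OF P(3), of xs ?m "[]"] xs by (simp add: reg_Nil)
    have 2: "runs (goto_end 0) ?m1 (2 * ?N + 1) ?m2"
      by (rule runs_eq[OF runs_goto_end[of _ 0 "xs ! 0"]]) (use len n xs in simp_all)
    have 3: "runs (erase 0) ?m2 (3 * ?N + 3) ?m3"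
      by (rule runs_eq[OF runs_erase[of _ 0 "xs ! 0"]]) (use len n xs in \<open>simp_all add: reg_Nil\<close>)
    have 4: "runs (rewind n) ?m3 (2 * h ?N + 3) ?m4"
      by (rule runs_eq[OF runs_rewind[of _ n "f xs" "length (f xs)"]])
         (use len' n in \<open>simp_all add: out_def fun_upd_twist\<close>)
    have "runs Q ?m4 (b (tot [f xs])) (?m4(0 := out ([] @ [f xs] ! 0)))"
      by (rule computesD[OF Q(3)]) (use n xs in auto)
    moreover have "b (tot [f xs]) \<le> b (h ?N)" using len' by (intro pbound_mono[OF Q(2)]) (simp add: tot_def)
    ultimately have 5: "runs Q ?m4 (b (h ?N)) (?m4(0 := out (f xs)))"
      using runs_mono by force
    from runs_Sq[OF 1 runs_Sq[OF 2 runs_Sq[OF 3 runs_Sq[OF 4 5]]]]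
    obtain t where t: "t \<le> ?T ?N" "exec ?P ?m t (?m4(0 := out (f xs)))" unfolding runs_def by blast
    have "(tm_step ?M ^^ t) (0, map ?m [0..<?K]) = (prog_states ?P, map (?m4(0 := out (f xs))) [0..<?K])"
      by (rule path_tm_step[OF exec_path[OF t(2) wf]]) simp_all
    moreover have "tm_init ?M xs = (0, map ?m [0..<?K])" by (simp add: tm_init_def reg_def)
    moreover have "fst (hd (map (?m4(0 := out (f xs))) [0..<?K])) = string_tape (f xs)"
      by (subst hd_map) (auto simp: out_def)
    moreover have "t \<le> c * (\<Sum>x\<leftarrow>xs. length x) ^ e + c" using ce[of ?N] t(1) by (simp add: tot_def)
    ultimately show ?thesis unfolding tm_computes_within_def
      by (intro exI[of _ t] conjI) (simp_all del: prog_states.simps prog_delta.simps)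
  qed
  moreover have "n \<le> tm_tapes ?M" by simp
  ultimately show ?thesis unfolding polytime_def by blast
qed

section \<open>The vectors\<close>

text \<open>Rows \<open>5 * e\<close> to \<open>5 * e + 4\<close> belong to element
  \<open>e\<close>, the last rows to the clauses; columns also list elements before clauses. The
  entry 1/6 is padding: 1/9 + 1/9 + 1/36 = 1/4. Rows 3 and 4 of an element without tap keep their
  own coordinate, so that its diagonal entry is still 1.\<close>

definition ks_entry :: "nat \<Rightarrow> (nat \<Rightarrow> nat) \<Rightarrow> (nat \<Rightarrow> bool) \<Rightarrow> (nat \<Rightarrow> nat) \<Rightarrow> nat \<Rightarrow> nat \<Rightarrow> rat" where
  "ks_entry E \<pi> tap cl r j =
    (if 5 * E \<le> r then (if j = E + (r - 5 * E) then 1 / 2 else 0)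
     else if j = r div 5 then
       (if r mod 5 = 0 then 1 / 3 else if r mod 5 = 1 then - 1 / 3 else if r mod 5 = 2 then 1 / 6
        else if r mod 5 = 3 then 3 / 10 else 2 / 5)
     else if r mod 5 < 2 \<and> j = \<pi> (r div 5) then 1 / 2
     else if 2 < r mod 5 \<and> tap (r div 5) \<and> j = E + cl (r div 5) then
       (if r mod 5 = 3 then 2 / 5 else - 3 / 10)
     else 0)"

definition ks_vecs :: "nat \<Rightarrow> nat \<Rightarrow> (nat \<Rightarrow> nat) \<Rightarrow> (nat \<Rightarrow> bool) \<Rightarrow> (nat \<Rightarrow> nat) \<Rightarrow> rat vec list" where
  "ks_vecs E C \<pi> tap cl = map (\<lambda>r. vec (E + C) (ks_entry E \<pi> tap cl r)) [0..<5 * E + C]"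

definition two_point :: "nat \<Rightarrow> real \<Rightarrow> nat \<Rightarrow> real \<Rightarrow> nat \<Rightarrow> real" where
  "two_point p u q v j = (if j = p then u else if j = q then v else 0)"

lemma sum_two_point:
  assumes "p < d" "q < d" "p \<noteq> q"
  shows "(\<Sum>j = 0..<d. two_point p u q v j * x j) = u * x p + v * x q"
proof -
  have "(\<Sum>j = 0..<d. two_point p u q v j * x j) =
      (\<Sum>j = 0..<d. (if j = p then u * x p else 0) + (if j = q then v * x q else 0))"
    by (rule sum.cong) (use assms in \<open>auto simp: two_point_def\<close>)
  also have "\<dots> = u * x p + v * x q" using assms by (simp add: sum.distrib)
  finally show ?thesis .
qed

lemma sum_blocks:
  fixes F :: "nat \<Rightarrow> real"
  shows "(\<Sum>r<5 * E + C. F r) =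
    (\<Sum>e<E. F (5 * e) + F (5 * e + 1) + F (5 * e + 2) + F (5 * e + 3) + F (5 * e + 4)) + (\<Sum>c<C. F (5 * E + c))"
proof (induction C)
  case 0
  show ?case
  proof (induction E)
    case (Suc E)
    have "5 * Suc E + 0 = Suc (Suc (Suc (Suc (Suc (5 * E)))))" by simp
    with Suc show ?case by (simp add: numeral_eq_Suc)
  qed simp
qed simp

text \<open>Were \<open>\<pi>\<close> to have a 2-cycle, the links of both elements would meet in
  the same off-diagonal entry and could compensate each other. Three taps and the free vector
  contribute a quarter each to the diagonal entry of a clause.\<close>

locale ks_gadget =
  fixes E C :: nat and \<pi> :: "nat \<Rightarrow> nat" and tap :: "nat \<Rightarrow> bool" and cl :: "nat \<Rightarrow> nat"
  assumes C_pos: "0 < C"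
    and bij: "bij_betw \<pi> {..<E} {..<E}"
    and pi1: "e < E \<Longrightarrow> \<pi> e \<noteq> e"
    and pi2: "e < E \<Longrightarrow> \<pi> (\<pi> e) \<noteq> e"
    and cl: "e < E \<Longrightarrow> cl e < C"
    and taps: "c < C \<Longrightarrow> card {e. e < E \<and> tap e \<and> cl e = c} = 3"
begin

lemma pi_less: "e < E \<Longrightarrow> \<pi> e < E"
  using bij bij_betwE by blast

lemma pi_inj: "e < E \<Longrightarrow> e' < E \<Longrightarrow> \<pi> e = \<pi> e' \<Longrightarrow> e = e'"
  using bij unfolding bij_betw_def inj_on_def by auto

definition rv :: "nat \<Rightarrow> real vec" where
  "rv r = vec (E + C) (\<lambda>j. real_of_rat (ks_entry E \<pi> tap cl r j))"

definition ka :: "nat \<Rightarrow> real" where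
  "ka k = (if k = 0 then 1 / 3 else if k = 1 then - 1 / 3 else if k = 2 then 1 / 6
        else if k = 3 then 3 / 10 else 2 / 5)"

text \<open>Every row of an element is brought into the form of at most two nonzero entries. Where
  the second coefficient \<open>kb\<close> is 0, the coordinate named here only has to differ from
  \<open>e\<close>.\<close>

definition kq :: "nat \<Rightarrow> nat \<Rightarrow> nat" where
  "kq e k = (if k < 3 then \<pi> e else E + cl e)"

definition kb :: "nat \<Rightarrow> nat \<Rightarrow> real" where
  "kb e k = (if k < 2 then 1 / 2 else if k = 2 \<or> \<not> tap e then 0 else if k = 3 then 2 / 5 else - 3 / 10)"

lemma kq: "e < E \<Longrightarrow> kq e k < E + C \<and> kq e k \<noteq> e"
  using pi_less[of e] pi1[of e] cl[of e] by (auto simp: kq_def)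

lemma rv_elem: "e < E \<Longrightarrow> k < 5 \<Longrightarrow> j < E + C \<Longrightarrow> rv (5 * e + k) $ j = two_point e (ka k) (kq e k) (kb e k) j"
  using kq[of e k] pi_less[of e]
  by (auto simp: rv_def ks_entry_def two_point_def ka_def kq_def kb_def of_rat_divide of_rat_minus)

lemma rv_clause: "c < C \<Longrightarrow> j < E + C \<Longrightarrow> rv (5 * E + c) $ j = (if j = E + c then 1 / 2 else 0)"
  by (auto simp: rv_def ks_entry_def of_rat_divide)

lemma rv_dim: "rv r \<in> carrier_vec (E + C)" by (simp add: rv_def)

lemma dot_elem:
  assumes "e < E" "k < 5" "x \<in> carrier_vec (E + C)"
  shows "rv (5 * e + k) \<bullet> x = ka k * x $ e + kb e k * x $ kq e k"
proof -
  have "rv (5 * e + k) \<bullet> x = (\<Sum>j = 0..<E + C. two_point e (ka k) (kq e k) (kb e k) j * x $ j)"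
    using assms unfolding scalar_prod_def by (intro sum.cong) (auto simp: rv_elem)
  then show ?thesis using assms kq[of e k] by (simp add: sum_two_point)
qed

lemma dot_clause:
  assumes "c < C" "x \<in> carrier_vec (E + C)"
  shows "rv (5 * E + c) \<bullet> x = x $ (E + c) / 2"
proof -
  have "rv (5 * E + c) \<bullet> x = (\<Sum>j = 0..<E + C. if j = E + c then x $ (E + c) / 2 else 0)"
    using assms unfolding scalar_prod_def by (intro sum.cong) (auto simp: rv_clause)
  then show ?thesis using assms by simp
qed

lemma row_cases:
  assumes "r < 5 * E + C"
  obtains e k where "e < E" "k < 5" "r = 5 * e + k" | c where "c < C" "r = 5 * E + c"
proof (cases "r < 5 * E")
  case True
  then show ?thesis using that(1)[of "r div 5" "r mod 5"] by (simp add: less_mult_imp_div_less mult.commute)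
next
  case False
  then show ?thesis using that(2)[of "r - 5 * E"] assms by simp
qed

text \<open>The instance is a set, so coinciding rows would be lost. The values of \<open>ka\<close>
  on the five rows are distinct and avoid 0 and 1/2, the only values a row shows on another
  element's coordinate; hence a row reveals both \<open>e\<close> and \<open>k\<close>. This is why
  the varying sign of a linking pair sits on the own coordinate.\<close>

lemma rv_inj: "inj_on rv {..<5 * E + C}"
proof (rule inj_onI)
  fix r r' assume r: "r \<in> {..<5 * E + C}" and r': "r' \<in> {..<5 * E + C}" and eq: "rv r = rv r'"
  have key: "rv (5 * e + k) \<noteq> rv (5 * E + c)" if "e < E" "k < 5" "c < C" for e k c
  proof
    assume "rv (5 * e + k) = rv (5 * E + c)"
    then have "rv (5 * e + k) $ e = rv (5 * E + c) $ e" by simp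
    then show False using that by (auto simp: rv_elem rv_clause two_point_def ka_def split: if_splits)
  qed
  from r have "r < 5 * E + C" by simp
  then show "r = r'"
  proof (cases rule: row_cases)
    case (1 e k)
    from r' have "r' < 5 * E + C" by simp
    then show ?thesis
    proof (cases rule: row_cases)
      case r1: (1 e' k')
      have "rv r $ e = rv r' $ e" using eq by simp
      then have two_point: "ka k = two_point e' (ka k') (kq e' k') (kb e' k') e"
        using 1 r1 by (simp add: rv_elem two_point_def[of e])
      have "e = e'"
      proof (rule ccontr)
        assume "e \<noteq> e'"
        then have "ka k = (if e = kq e' k' then kb e' k' else 0)" using two_point by (simp add: two_point_def)
        moreover have "e = kq e' k' \<Longrightarrow> kb e' k' \<in> {0, 1/2}" using 1 by (auto simp: kq_def kb_def split: if_splits)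
        ultimately show False by (auto simp: ka_def split: if_splits)
      qed
      moreover have "k = k'" using two_point \<open>e = e'\<close> 1 r1
        by (auto simp: two_point_def ka_def split: if_splits)
      ultimately show ?thesis using 1 r1 by simp
    next
      case (2 c)
      then show ?thesis using key[of e k c] 1 eq by simp
    qed
  next
    case (2 c)
    from r' have "r' < 5 * E + C" by simp
    then show ?thesis
    proof (cases rule: row_cases)
      case (1 e k)
      then show ?thesis using key[of e k c] 2 eq by simp
    next
      case r2: (2 c')
      have "rv r $ (E + c) = rv r' $ (E + c)" using eq by simp
      then show ?thesis using 2 r2 by (simp add: rv_clause split: if_splits)
    qed
  qed
qed

abbreviation vs :: "rat vec list" where "vs \<equiv> ks_vecs E C \<pi> tap cl"

lemma vs_length: "length vs = 5 * E + C" by (simp add: ks_vecs_def)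

lemma real_vs: "r < 5 * E + C \<Longrightarrow> real_vec (vs ! r) = rv r"
  by (auto simp: ks_vecs_def rv_def)

lemma real_vs_set: "real_vec ` set vs = rv ` {..<5 * E + C}"
  by (force simp: ks_vecs_def rv_def)

lemma vs_distinct: "distinct vs"
proof -
  have "map real_vec vs = map rv [0..<5 * E + C]"
    by (rule nth_equalityI) (auto simp: vs_length real_vs)
  moreover have "distinct (map rv [0..<5 * E + C])"
    using rv_inj by (simp add: distinct_map lessThan_atLeast0)
  ultimately show ?thesis by (metis distinct_map)
qed

section \<open>Quadratic forms of selections and exact splitting\<close>

definition form :: "(nat \<Rightarrow> real) \<Rightarrow> real vec \<Rightarrow> real" where
  "form \<beta> x = (\<Sum>r<5 * E + C. \<beta> r * (rv r \<bullet> x)\<^sup>2)"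

lemma form_eq:
  assumes x: "x \<in> carrier_vec (E + C)"
  shows "form \<beta> x = (\<Sum>e<E. \<beta> (5 * e) * (x $ e / 3 + x $ \<pi> e / 2)\<^sup>2 + \<beta> (5 * e + 1) * (- x $ e / 3 + x $ \<pi> e / 2)\<^sup>2
     + \<beta> (5 * e + 2) * (x $ e / 6)\<^sup>2 + \<beta> (5 * e + 3) * (3 / 10 * x $ e + (if tap e then 2 / 5 * x $ (E + cl e) else 0))\<^sup>2
     + \<beta> (5 * e + 4) * (2 / 5 * x $ e - (if tap e then 3 / 10 * x $ (E + cl e) else 0))\<^sup>2)
     + (\<Sum>c<C. \<beta> (5 * E + c) * (x $ (E + c) / 2)\<^sup>2)"
  unfolding form_def sum_blocks
proof (rule arg_cong2[of _ _ _ _ "(+)"]; rule sum.cong[OF refl])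
  fix e assume "e \<in> {..<E}"
  then have e: "e < E" by simp
  note d = dot_elem[OF e _ x]
  have "rv (5 * e) \<bullet> x = x $ e / 3 + x $ \<pi> e / 2"
    "rv (5 * e + 1) \<bullet> x = - x $ e / 3 + x $ \<pi> e / 2"
    "rv (5 * e + 2) \<bullet> x = x $ e / 6"
    "rv (5 * e + 3) \<bullet> x = 3 / 10 * x $ e + (if tap e then 2 / 5 * x $ (E + cl e) else 0)"
    "rv (5 * e + 4) \<bullet> x = 2 / 5 * x $ e - (if tap e then 3 / 10 * x $ (E + cl e) else 0)"
    using d[of 0] d[of 1] d[of 2] d[of 3] d[of 4] by (simp_all add: ka_def kb_def kq_def)
  then show "\<beta> (5 * e) * (rv (5 * e) \<bullet> x)\<^sup>2 + \<beta> (5 * e + 1) * (rv (5 * e + 1) \<bullet> x)\<^sup>2 +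
      \<beta> (5 * e + 2) * (rv (5 * e + 2) \<bullet> x)\<^sup>2 + \<beta> (5 * e + 3) * (rv (5 * e + 3) \<bullet> x)\<^sup>2 +
      \<beta> (5 * e + 4) * (rv (5 * e + 4) \<bullet> x)\<^sup>2 =
    \<beta> (5 * e) * (x $ e / 3 + x $ \<pi> e / 2)\<^sup>2 + \<beta> (5 * e + 1) * (- x $ e / 3 + x $ \<pi> e / 2)\<^sup>2
     + \<beta> (5 * e + 2) * (x $ e / 6)\<^sup>2 + \<beta> (5 * e + 3) * (3 / 10 * x $ e + (if tap e then 2 / 5 * x $ (E + cl e) else 0))\<^sup>2
     + \<beta> (5 * e + 4) * (2 / 5 * x $ e - (if tap e then 3 / 10 * x $ (E + cl e) else 0))\<^sup>2"
    by (simp only:)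
next
  fix c assume "c \<in> {..<C}"
  then show "\<beta> (5 * E + c) * (rv (5 * E + c) \<bullet> x)\<^sup>2 = \<beta> (5 * E + c) * (x $ (E + c) / 2)\<^sup>2"
    using dot_clause[OF _ x, of c] by (simp only: lessThan_iff)
qed

lemma sum_pi: "(\<Sum>e<E. f (\<pi> e)) = (\<Sum>e<E. f e)"
  using sum.reindex_bij_betw[OF bij] .

lemma sum_taps: "(\<Sum>e<E. if tap e then f e (cl e) else 0) = (\<Sum>c<C. \<Sum>e | e < E \<and> tap e \<and> cl e = c. f e c)"
proof -
  have "(\<Sum>e<E. if tap e then f e (cl e) else 0) = (\<Sum>e\<in>{e. e < E \<and> tap e}. f e (cl e))"
    by (rule sum.mono_neutral_cong_right) auto
  also have "\<dots> = (\<Sum>c<C. \<Sum>e\<in>{e \<in> {e. e < E \<and> tap e}. cl e = c}. f e (cl e))"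
    by (rule sum.group[symmetric]) (auto simp: cl)
  also have "\<dots> = (\<Sum>c<C. \<Sum>e | e < E \<and> tap e \<and> cl e = c. f e c)"
    by (intro sum.cong) auto
  finally show ?thesis .
qed

lemma norm_split:
  fixes x :: "real vec"
  assumes x: "x \<in> carrier_vec (E + C)"
  shows "x \<bullet> x = (\<Sum>e<E. (x $ e)\<^sup>2) + (\<Sum>c<C. (x $ (E + c))\<^sup>2)"
proof -
  have "x \<bullet> x = (\<Sum>j<E + C. (x $ j)\<^sup>2)"
    using x by (simp add: scalar_prod_def power2_eq_square lessThan_atLeast0)
  also have "\<dots> = (\<Sum>e<E. (x $ e)\<^sup>2) + (\<Sum>c<C. (x $ (E + c))\<^sup>2)"
    by (induction C) auto
  finally show ?thesis .
qed

text \<open>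
  If the sign of an element is shared by all of its vectors, the mixed terms cancel and only
  squares of coordinates remain.
\<close>

lemma form_const:
  assumes x: "x \<in> carrier_vec (E + C)" and \<beta>: "\<And>e k. e < E \<Longrightarrow> k < 5 \<Longrightarrow> \<beta> (5 * e + k) = s e"
  shows "form \<beta> x = (\<Sum>e<E. s e * ((x $ \<pi> e)\<^sup>2 / 2 + (x $ e)\<^sup>2 / 2)) +
     (\<Sum>c<C. ((\<Sum>e | e < E \<and> tap e \<and> cl e = c. s e) + \<beta> (5 * E + c)) * (x $ (E + c))\<^sup>2 / 4)"
proof -
  have "form \<beta> x = (\<Sum>e<E. s e * ((x $ \<pi> e)\<^sup>2 / 2 + (x $ e)\<^sup>2 / 2) + (if tap e then s e * (x $ (E + cl e))\<^sup>2 / 4 else 0))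
     + (\<Sum>c<C. \<beta> (5 * E + c) * (x $ (E + c) / 2)\<^sup>2)"
    unfolding form_eq[OF x]
  proof (rule arg_cong2[of _ _ _ _ "(+)", OF sum.cong[OF refl] refl])
    fix e assume "e \<in> {..<E}"
    then have b: "\<beta> (5 * e) = s e" "\<beta> (5 * e + 1) = s e" "\<beta> (5 * e + 2) = s e" "\<beta> (5 * e + 3) = s e" "\<beta> (5 * e + 4) = s e"
      using \<beta>[of e 0] \<beta>[of e 1] \<beta>[of e 2] \<beta>[of e 3] \<beta>[of e 4] by auto
    show "\<beta> (5 * e) * (x $ e / 3 + x $ \<pi> e / 2)\<^sup>2 + \<beta> (5 * e + 1) * (- x $ e / 3 + x $ \<pi> e / 2)\<^sup>2
     + \<beta> (5 * e + 2) * (x $ e / 6)\<^sup>2 + \<beta> (5 * e + 3) * (3 / 10 * x $ e + (if tap e then 2 / 5 * x $ (E + cl e) else 0))\<^sup>2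
     + \<beta> (5 * e + 4) * (2 / 5 * x $ e - (if tap e then 3 / 10 * x $ (E + cl e) else 0))\<^sup>2 =
     s e * ((x $ \<pi> e)\<^sup>2 / 2 + (x $ e)\<^sup>2 / 2) + (if tap e then s e * (x $ (E + cl e))\<^sup>2 / 4 else 0)"
      unfolding b by (simp add: power2_eq_square field_simps)
  qed
  then show ?thesis
    by (simp add: sum.distrib sum_taps[of "\<lambda>e c. s e * (x $ (E + c))\<^sup>2 / 4"] sum_distrib_right sum_divide_distrib
        power_divide distrib_right add_divide_distrib)
qed

text \<open>With all weights 1, an element coordinate collects 1/2 from its own rows and 1/2 from
  the links of its predecessor, a clause coordinate four quarters.\<close>

lemma form_one: "x \<in> carrier_vec (E + C) \<Longrightarrow> form (\<lambda>r. 1) x = x \<bullet> x"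
proof -
  assume x: "x \<in> carrier_vec (E + C)"
  have "form (\<lambda>r. 1) x = (\<Sum>e<E. 1 * ((x $ \<pi> e)\<^sup>2 / 2 + (x $ e)\<^sup>2 / 2)) +
     (\<Sum>c<C. ((\<Sum>e | e < E \<and> tap e \<and> cl e = c. 1) + 1) * (x $ (E + c))\<^sup>2 / 4)"
    by (rule form_const[OF x]) simp
  also have "\<dots> = (\<Sum>e<E. (x $ e)\<^sup>2) + (\<Sum>c<C. (x $ (E + c))\<^sup>2)"
    using sum_pi[of "\<lambda>e. (x $ e)\<^sup>2 / 2"]
    by (simp add: sum.distrib taps sum_divide_distrib[symmetric])
  finally show ?thesis using norm_split[OF x] by simp
qed

lemma subset_sum:
  assumes "S \<subseteq> rv ` {..<5 * E + C}"
  shows "(\<Sum>v\<in>S. (v \<bullet> x)\<^sup>2) = form (\<lambda>r. of_bool (rv r \<in> S)) x"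
proof -
  let ?R = "{r. r < 5 * E + C \<and> rv r \<in> S}"
  have "S = rv ` ?R" using assms by auto
  moreover have "inj_on rv ?R" using rv_inj by (rule inj_on_subset) auto
  ultimately have "(\<Sum>v\<in>S. (v \<bullet> x)\<^sup>2) = (\<Sum>r\<in>?R. (rv r \<bullet> x)\<^sup>2)"
    by (metis (no_types, lifting) sum.reindex_cong)
  also have "\<dots> = form (\<lambda>r. of_bool (rv r \<in> S)) x"
    unfolding form_def by (rule sum.mono_neutral_cong_left) auto
  finally show ?thesis .
qed

lemma rv_norm: "r < 5 * E + C \<Longrightarrow> rv r \<bullet> rv r \<le> 13 / 36"
proof (erule row_cases)
  fix e k assume a: "e < E" "k < 5" "r = 5 * e + k"
  have "rv r \<bullet> rv r = (ka k)\<^sup>2 + (kb e k)\<^sup>2"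
    using dot_elem[OF a(1,2) rv_dim, of r] a kq[of e k]
    by (simp add: rv_elem two_point_def power2_eq_square)
  then show ?thesis by (auto simp: ka_def kb_def power2_eq_square)
next
  fix c assume "c < C" "r = 5 * E + c"
  then show ?thesis using dot_clause[OF _ rv_dim, of c r] by (simp add: rv_clause)
qed

lemma code: "KS2_code (E + C) (13 / 36) vs"
proof -
  have "(\<Sum>v\<in>rv ` {..<5 * E + C}. (v \<bullet> x)\<^sup>2) = 1" if "x \<in> unit_vecs (E + C)" for x
  proof -
    have x: "x \<in> carrier_vec (E + C)" "x \<bullet> x = 1" using that by (auto simp: unit_vecs_def)
    have "(\<Sum>v\<in>rv ` {..<5 * E + C}. (v \<bullet> x)\<^sup>2) = (\<Sum>r<5 * E + C. (rv r \<bullet> x)\<^sup>2)"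
      using sum.reindex[OF rv_inj] by (simp add: comp_def)
    also have "\<dots> = form (\<lambda>r. 1) x" by (simp add: form_def)
    finally show ?thesis using form_one[OF x(1)] x(2) by simp
  qed
  then show ?thesis unfolding KS2_code_def KS2_instance_def real_vs_set
    using vs_distinct C_pos rv_dim rv_norm by (auto simp: of_rat_divide)
qed


definition good :: "(nat \<Rightarrow> bool) \<Rightarrow> bool" where
  "good s \<longleftrightarrow> (\<forall>e<E. s (\<pi> e) \<longleftrightarrow> \<not> s e) \<and>
     (\<forall>c<C. (\<exists>e<E. tap e \<and> cl e = c \<and> s e) \<and> (\<exists>e<E. tap e \<and> cl e = c \<and> \<not> s e))"

text \<open>All five rows of an element follow its sign. On coordinate \<open>e\<close> the own rows
  give half of \<open>s e\<close> and the predecessor, having the opposite sign, half of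
  \<open>1 - s e\<close>: together always 1/2.\<close>

lemma complete:
  assumes "good s"
  obtains S where "S \<subseteq> real_vec ` set vs"
    "\<And>x. x \<in> unit_vecs (E + C) \<Longrightarrow> (\<Sum>v\<in>S. (v \<bullet> x)\<^sup>2) = 1 / 2"
proof -
  let ?t = "\<lambda>c. card {e. e < E \<and> tap e \<and> cl e = c \<and> s e}"
  \<comment> \<open>A clause has one or two selected taps. Its free vector is selected in the first
    case only, which makes two of four quarters.\<close>
  define b where "b r = (if r < 5 * E then s (r div 5) else ?t (r - 5 * E) = 1)" for r
  define S where "S = rv ` {r. r < 5 * E + C \<and> b r}"
  have S: "S \<subseteq> rv ` {..<5 * E + C}" by (auto simp: S_def)
  have mem: "rv r \<in> S \<longleftrightarrow> b r" if "r < 5 * E + C" for r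
    using rv_inj that unfolding S_def inj_on_def by auto
  have "(\<Sum>v\<in>S. (v \<bullet> x)\<^sup>2) = 1 / 2" if "x \<in> unit_vecs (E + C)" for x
  proof -
    have x: "x \<in> carrier_vec (E + C)" "x \<bullet> x = 1" using that by (auto simp: unit_vecs_def)
    let ?s = "\<lambda>e. of_bool (s e) :: real"
    have cnt: "(\<Sum>e | e < E \<and> tap e \<and> cl e = c. ?s e) + of_bool (b (5 * E + c)) = 2" if c: "c < C" for c
    proof -
      let ?T = "{e. e < E \<and> tap e \<and> cl e = c}"
      let ?A = "{e. e < E \<and> tap e \<and> cl e = c \<and> s e}"
      have fin: "finite ?T" by simp
      have "(\<Sum>e\<in>?T. ?s e) = real (card ?A)"
        by (simp add: of_bool_def sum.If_cases Collect_conj_eq[symmetric] conj_ac)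
      moreover obtain e e' where "e \<in> ?A" "e' \<in> ?T - ?A" using assms c unfolding good_def by blast
      then have "0 < card ?A" "?A \<subset> ?T" by (auto simp: card_gt_0_iff)
      moreover have "card ?A < 3" using psubset_card_mono[OF fin \<open>?A \<subset> ?T\<close>] taps[OF c] by simp
      ultimately show ?thesis by (auto simp: b_def)
    qed
    have "(\<Sum>v\<in>S. (v \<bullet> x)\<^sup>2) = form (\<lambda>r. of_bool (rv r \<in> S)) x" by (rule subset_sum[OF S])
    also have "\<dots> = form (\<lambda>r. of_bool (b r)) x"
      unfolding form_def by (rule sum.cong) (auto simp: mem)
    also have "\<dots> = (\<Sum>e<E. ?s e * ((x $ \<pi> e)\<^sup>2 / 2 + (x $ e)\<^sup>2 / 2)) +
       (\<Sum>c<C. ((\<Sum>e | e < E \<and> tap e \<and> cl e = c. ?s e) + of_bool (b (5 * E + c))) * (x $ (E + c))\<^sup>2 / 4)"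
      by (rule form_const[OF x(1)]) (simp add: b_def)
    also have "(\<Sum>e<E. ?s e * ((x $ \<pi> e)\<^sup>2 / 2 + (x $ e)\<^sup>2 / 2)) =
        (\<Sum>e<E. (1 - ?s (\<pi> e)) * (x $ \<pi> e)\<^sup>2 / 2) + (\<Sum>e<E. ?s e * (x $ e)\<^sup>2 / 2)"
      unfolding sum.distrib[symmetric]
      by (rule sum.cong) (use assms in \<open>auto simp: good_def\<close>)
    also have "(\<Sum>e<E. (1 - ?s (\<pi> e)) * (x $ \<pi> e)\<^sup>2 / 2) = (\<Sum>e<E. (1 - ?s e) * (x $ e)\<^sup>2 / 2)"
      by (rule sum_pi)
    also have "(\<Sum>e<E. (1 - ?s e) * (x $ e)\<^sup>2 / 2) + (\<Sum>e<E. ?s e * (x $ e)\<^sup>2 / 2) = (\<Sum>e<E. (x $ e)\<^sup>2) / 2"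
      unfolding sum.distrib[symmetric] sum_divide_distrib
      by (rule sum.cong) (auto simp: field_simps)
    also have "(\<Sum>c<C. ((\<Sum>e | e < E \<and> tap e \<and> cl e = c. ?s e) + of_bool (b (5 * E + c))) * (x $ (E + c))\<^sup>2 / 4)
       = (\<Sum>c<C. (x $ (E + c))\<^sup>2) / 2"
      unfolding sum_divide_distrib
    proof (rule sum.cong[OF refl])
      fix c assume "c \<in> {..<C}"
      then show "((\<Sum>e | e < E \<and> tap e \<and> cl e = c. ?s e) + of_bool (b (5 * E + c))) * (x $ (E + c))\<^sup>2 / 4
        = (x $ (E + c))\<^sup>2 / 2" using cnt[of c] by (simp only: lessThan_iff)
    qed
    finally show ?thesis using norm_split[OF x(1)] x(2) by simp
  qed
  with S show ?thesis using that real_vs_set by simp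
qed

section \<open>Matrix entries and forced signs\<close>

definition gram :: "(nat \<Rightarrow> real) \<Rightarrow> nat \<Rightarrow> nat \<Rightarrow> real" where
  "gram \<beta> a b = (\<Sum>r<5 * E + C. \<beta> r * (rv r $ a * rv r $ b))"

lemma gram_diag:
  assumes "a < E + C" shows "gram \<beta> a a = form \<beta> (unit_vec (E + C) a)"
  unfolding gram_def form_def
  by (rule sum.cong) (use assms rv_dim in \<open>simp_all add: power2_eq_square\<close>)

text \<open>The unit vectors \<open>(3 e\<^sub>a \<plusminus> 4 e\<^sub>b) / 5\<close> isolate the entry in row \<open>a\<close> and column \<open>b\<close>.\<close>

lemma gram_off:
  assumes ab: "a < E + C" "b < E + C" "a \<noteq> b"
    and F: "\<And>x. x \<in> unit_vecs (E + C) \<Longrightarrow> \<bar>form \<beta> x - 1 / 2\<bar> \<le> \<theta>"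
  shows "\<bar>gram \<beta> a b\<bar> \<le> 25 / 24 * \<theta>"
proof -
  define x where "x \<sigma> = vec (E + C) (two_point a (3 / 5) b (\<sigma> * 4 / 5))" for \<sigma> :: real
  have dot: "rv r \<bullet> x \<sigma> = 3 / 5 * rv r $ a + \<sigma> * 4 / 5 * rv r $ b" for r \<sigma>
    using sum_two_point[OF ab, of "3 / 5" "\<sigma> * 4 / 5" "\<lambda>j. rv r $ j"] rv_dim[of r]
    by (simp add: x_def scalar_prod_def mult.commute)
  have xx: "x \<sigma> \<bullet> x \<sigma> = 9 / 25 + \<sigma>\<^sup>2 * 16 / 25" for \<sigma>
    using sum_two_point[OF ab, of "3 / 5" "\<sigma> * 4 / 5" "two_point a (3 / 5) b (\<sigma> * 4 / 5)"] ab
    by (simp add: x_def scalar_prod_def two_point_def power2_eq_square)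
  have "x 1 \<in> unit_vecs (E + C)" "x (- 1) \<in> unit_vecs (E + C)"
    using xx[of 1] xx[of "- 1"] by (auto simp: unit_vecs_def x_def)
  from F[OF this(1)] F[OF this(2)] have "\<bar>form \<beta> (x 1) - form \<beta> (x (- 1))\<bar> \<le> 2 * \<theta>" by linarith
  moreover have "form \<beta> (x 1) - form \<beta> (x (- 1)) = 48 / 25 * gram \<beta> a b"
    unfolding form_def gram_def dot sum_subtractf[symmetric] sum_distrib_left
    by (rule sum.cong) (auto simp: power2_eq_square algebra_simps)
  ultimately show ?thesis by linarith
qed

lemma sum5: "(\<Sum>k<5. f k) = f 0 + f 1 + f 2 + f 3 + (f 4 :: real)" for f :: "nat \<Rightarrow> real"
  by (simp add: numeral_eq_Suc)

lemma gram_blocks: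
  assumes "a < E + C" "b < E + C"
  shows "gram \<beta> a b = (\<Sum>e<E. \<Sum>k<5. \<beta> (5 * e + k) * (two_point e (ka k) (kq e k) (kb e k) a * two_point e (ka k) (kq e k) (kb e k) b))
    + (\<Sum>c<C. \<beta> (5 * E + c) * (if a = E + c \<and> b = E + c then 1 / 4 else 0))"
proof -
  have "(if a = E + c then 1 / 2 else 0) * (if b = E + c then 1 / 2 else 0) =
      (if a = E + c \<and> b = E + c then 1 / 4 else (0 :: real))" for c
    by simp
  then show ?thesis unfolding gram_def sum_blocks sum5
    using rv_elem[of _ 0] rv_elem[of _ 1] rv_elem[of _ 2] rv_elem[of _ 3] rv_elem[of _ 4] assms
    by (simp add: rv_clause)
qed

text \<open>A row of \<open>e'\<close> meets both columns only if \<open>e'\<close> and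
  \<open>\<pi> e'\<close> are \<open>e\<close> and \<open>\<pi> e\<close> in some order. The swapped
  order would be a 2-cycle, so \<open>e' = e\<close> remains, with the products 1/6 and -1/6 of the
  linking pair.\<close>

lemma gram_link:
  assumes e: "e < E" shows "gram \<beta> e (\<pi> e) = (\<beta> (5 * e) - \<beta> (5 * e + 1)) / 6"
proof -
  have "(\<Sum>k<5. \<beta> (5 * e' + k) * (two_point e' (ka k) (kq e' k) (kb e' k) e * two_point e' (ka k) (kq e' k) (kb e' k) (\<pi> e)))
     = (if e' = e then (\<beta> (5 * e) - \<beta> (5 * e + 1)) / 6 else 0)" if "e' < E" for e'
    using e that pi1[of e] pi2[of e] pi_inj[of e e'] pi_less[of e]
    by (auto simp: sum5 two_point_def ka_def kb_def kq_def)
  then show ?thesis using e pi_less[OF e] by (simp add: gram_blocks)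
qed

lemma gram_tap:
  assumes e: "e < E" "tap e" shows "gram \<beta> e (E + cl e) = 3 / 25 * (\<beta> (5 * e + 3) - \<beta> (5 * e + 4))"
proof -
  have "(\<Sum>k<5. \<beta> (5 * e' + k) * (two_point e' (ka k) (kq e' k) (kb e' k) e * two_point e' (ka k) (kq e' k) (kb e' k) (E + cl e)))
     = (if e' = e then 3 / 25 * (\<beta> (5 * e + 3) - \<beta> (5 * e + 4)) else 0)" if "e' < E" for e'
    using e that pi_less[of e'] by (auto simp: sum5 two_point_def ka_def kb_def kq_def)
  then show ?thesis using e cl[of e] by (simp add: gram_blocks)
qed

lemma gram_elem:
  assumes e: "e < E" "\<pi> p = e" "p < E"
  shows "gram \<beta> e e = (\<beta> (5 * e) + \<beta> (5 * e + 1)) / 9 + \<beta> (5 * e + 2) / 36 + 9 / 100 * \<beta> (5 * e + 3) +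
    4 / 25 * \<beta> (5 * e + 4) + (\<beta> (5 * p) + \<beta> (5 * p + 1)) / 4"
proof -
  have "(\<Sum>k<5. \<beta> (5 * e' + k) * (two_point e' (ka k) (kq e' k) (kb e' k) e * two_point e' (ka k) (kq e' k) (kb e' k) e))
     = (if e' = e then (\<beta> (5 * e) + \<beta> (5 * e + 1)) / 9 + \<beta> (5 * e + 2) / 36 + 9 / 100 * \<beta> (5 * e + 3) + 4 / 25 * \<beta> (5 * e + 4) else 0)
      + (if e' = p then (\<beta> (5 * p) + \<beta> (5 * p + 1)) / 4 else 0)" if "e' < E" for e'
  proof -
    have ne: "p \<noteq> e" "\<pi> e \<noteq> e" using pi1[of p] pi1[of e] e by auto
    consider "e' = e" | "e' = p" | "e' \<noteq> e" "e' \<noteq> p" by blast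
    then show ?thesis
    proof cases
      case 1
      then show ?thesis using ne by (simp add: sum5 two_point_def ka_def add_divide_distrib)
    next
      case 2
      then show ?thesis using ne e by (simp add: sum5 two_point_def kb_def kq_def add_divide_distrib)
    next
      case 3
      then have "\<pi> e' \<noteq> e" using pi_inj[of p e'] e that by blast
      then show ?thesis using 3 e by (simp add: sum5 two_point_def kb_def kq_def)
    qed
  qed
  then show ?thesis using e by (simp add: gram_blocks sum.distrib)
qed

lemma gram_clause:
  assumes c: "c < C"
  shows "gram \<beta> (E + c) (E + c) = (\<Sum>e | e < E \<and> tap e \<and> cl e = c. 4 / 25 * \<beta> (5 * e + 3) + 9 / 100 * \<beta> (5 * e + 4))
    + \<beta> (5 * E + c) / 4"
proof -
  have "(\<Sum>k<5. \<beta> (5 * e' + k) * (two_point e' (ka k) (kq e' k) (kb e' k) (E + c) * two_point e' (ka k) (kq e' k) (kb e' k) (E + c)))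
     = (if tap e' \<and> cl e' = c then 4 / 25 * \<beta> (5 * e' + 3) + 9 / 100 * \<beta> (5 * e' + 4) else 0)" if "e' < E" for e'
    using c that pi_less[of e'] by (auto simp: sum5 two_point_def ka_def kb_def kq_def)
  moreover have "(\<Sum>e<E. if tap e \<and> cl e = c then 4 / 25 * \<beta> (5 * e + 3) + 9 / 100 * \<beta> (5 * e + 4) else 0) =
      (\<Sum>e | e < E \<and> tap e \<and> cl e = c. 4 / 25 * \<beta> (5 * e + 3) + 9 / 100 * \<beta> (5 * e + 4))"
    by (rule sum.mono_neutral_cong_right) auto
  moreover have "(\<Sum>c'<C. \<beta> (5 * E + c') * (if E + c = E + c' \<and> E + c = E + c' then 1 / 4 else 0)) =
      (\<Sum>c'<C. if c' = c then \<beta> (5 * E + c) / 4 else 0)"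
    by (rule sum.cong) auto
  ultimately show ?thesis using c by (simp add: gram_blocks)
qed

text \<open>Off-diagonal entries first equate the two bits of each link and of each tap pair. The
  diagonal entries of elements then force alternation and tie the taps, and those of clauses exclude
  three equal taps.\<close>

lemma sound:
  assumes sol: "KS2_solution (1 / (4 * sqrt 2)) (E + C) (13 / 36) (real_vec ` set vs) S"
  shows "good (\<lambda>e. rv (5 * e) \<in> S)"
proof -
  let ?t = "\<lambda>r. rv r \<in> S"
  let ?b = "\<lambda>r. of_bool (?t r) :: real"
  define \<theta> :: real where "\<theta> = 1 / (4 * sqrt 2) * sqrt (13 / 36)"
  have "\<theta>\<^sup>2 = 13 / 1152" by (simp add: \<theta>_def power_mult_distrib power_divide)
  \<comment> \<open>The square root of 13/1152 is about 0.1063.\<close>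
  also have "\<dots> < (107 / 1000)\<^sup>2" by (simp add: power2_eq_square)
  finally have \<theta>: "\<theta> < 107 / 1000" by (rule power2_less_imp_less) simp
  have F: "\<bar>form ?b x - 1 / 2\<bar> \<le> \<theta>" if "x \<in> unit_vecs (E + C)" for x
    using sol that subset_sum[of S x] unfolding KS2_solution_def real_vs_set \<theta>_def by auto
  have diag: "\<bar>gram ?b a a - 1 / 2\<bar> < 107 / 1000" if "a < E + C" for a
    using F[of "unit_vec (E + C) a"] that \<theta> by (simp add: gram_diag unit_vecs_def)
  \<comment> \<open>25/24 times 107/1000 is below 3/25, the smallest entry caused by a disagreeing
    pair: 3/25 for a tap, 1/6 for a link.\<close>
  have off: "\<bar>gram ?b a a'\<bar> < 3 / 25" if "a < E + C" "a' < E + C" "a \<noteq> a'" for a a'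
    using gram_off[OF that F] \<theta> by simp
  have link: "?t (5 * e + 1) \<longleftrightarrow> ?t (5 * e)" if "e < E" for e
    using off[of e "\<pi> e"] that gram_link[OF that, of ?b] pi_less[OF that] pi1[OF that] by (auto simp: of_bool_def split: if_splits)
  have tap': "?t (5 * e + 4) \<longleftrightarrow> ?t (5 * e + 3)" if "e < E" "tap e" for e
    using off[of e "E + cl e"] that gram_tap[OF that, of ?b] cl[of e] by (auto simp: of_bool_def split: if_splits)
  \<comment> \<open>If \<open>p\<close> and \<open>\<pi> p\<close> agree, the diagonal entry is at
    least 1/2 + 2/9 or at most 1/4 + 1/36, whatever the other rows of \<open>\<pi> p\<close> do;
    either is at distance at least 2/9 from 1/2.\<close>
  have "?t (5 * \<pi> p) \<longleftrightarrow> \<not> ?t (5 * p)" if p: "p < E" for p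
    using diag[of "\<pi> p"] gram_elem[OF pi_less[OF p] refl p, of ?b] link[OF p] link[OF pi_less[OF p]] pi_less[OF p]
    by (auto simp: of_bool_def split: if_splits)
  have tp: "?t (5 * e + 3) \<longleftrightarrow> ?t (5 * e)" if e: "e < E" "tap e" for e
  proof -
    obtain p where p: "p < E" "\<pi> p = e" using bij e(1) unfolding bij_betw_def by (metis imageE lessThan_iff)
    \<comment> \<open>Exactly one of \<open>p\<close> and \<open>e\<close> is selected. A tap bit
      differing from that of \<open>e\<close> pushes the entry to at least 1/2 + 1/4 or down to at
      most 2/9 + 1/36 = 1/4.\<close>
    show ?thesis
      using diag[of e] gram_elem[OF e(1) p(2,1), of ?b] link[OF p(1)] link[OF e(1)] tap'[OF e] e(1)
      by (auto simp: of_bool_def split: if_splits)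
  qed
  have "(\<exists>e<E. tap e \<and> cl e = c \<and> ?t (5 * e)) \<and> (\<exists>e<E. tap e \<and> cl e = c \<and> \<not> ?t (5 * e))" if c: "c < C" for c
  proof -
    let ?T = "{e. e < E \<and> tap e \<and> cl e = c}"
    have g: "gram ?b (E + c) (E + c) = (\<Sum>e\<in>?T. 1 / 4 * ?b (5 * e)) + ?b (5 * E + c) / 4"
      unfolding gram_clause[OF c] by (intro arg_cong2[of _ _ _ _ "(+)"] sum.cong refl) (auto simp: tp tap')
    have d: "\<bar>gram ?b (E + c) (E + c) - 1 / 2\<bar> < 107 / 1000" using diag c by simp
    \<comment> \<open>Three equal taps leave the entry at 3/4 or more, or at 1/4 or less, for either
      choice of the free vector.\<close>
    have False if "\<And>e. e \<in> ?T \<Longrightarrow> ?t (5 * e)"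
    proof -
      have "(\<Sum>e\<in>?T. 1 / 4 * ?b (5 * e)) = (\<Sum>e\<in>?T. 1 / 4)" by (rule sum.cong) (use that in auto)
      then have "gram ?b (E + c) (E + c) = 3 / 4 + ?b (5 * E + c) / 4" unfolding g by (simp add: taps[OF c])
      moreover have "0 \<le> ?b (5 * E + c)" by simp
      ultimately show False using d by linarith
    qed
    moreover have False if "\<And>e. e \<in> ?T \<Longrightarrow> \<not> ?t (5 * e)"
    proof -
      have "(\<Sum>e\<in>?T. 1 / 4 * ?b (5 * e)) = 0" by (rule sum.neutral) (use that in auto)
      then have "gram ?b (E + c) (E + c) = ?b (5 * E + c) / 4" unfolding g by simp
      moreover have "?b (5 * E + c) \<le> 1" by simp
      ultimately show False using d by linarith
    qed
    ultimately show ?thesis by blast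
  qed
  with \<open>\<And>p. p < E \<Longrightarrow> ?t (5 * \<pi> p) \<longleftrightarrow> \<not> ?t (5 * p)\<close> show ?thesis unfolding good_def by blast
qed

end

section \<open>From constraint satisfaction to not-all-equal satisfiability\<close>

text \<open>
  Element \<open>v * (2 * C) + l\<close> is the copy of variable \<open>v\<close> for the triple \<open>l div 2\<close>, negated if \<open>l\<close> is odd.
  Variable 0 stands for falsity; variable \<open>Suc (j * K + i)\<close> states that none of the first \<open>i\<close> literals
  of clause \<open>j\<close> is true; variable \<open>Suc (C + u)\<close> is the variable \<open>u\<close> of the clauses.
\<close>

definition nae_pi :: "nat \<Rightarrow> nat \<Rightarrow> nat" where
  "nae_pi C e = e div (2 * C) * (2 * C) + Suc (e mod (2 * C)) mod (2 * C)"

definition nae_cl :: "nat \<Rightarrow> nat \<Rightarrow> nat" where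
  "nae_cl C e = e mod (2 * C) div 2"

text \<open>The cases: falsity at the first or last triple of a clause, the negated chain variable,
  the next chain variable, and the literal itself.\<close>

definition nae_tap :: "nat \<Rightarrow> nat \<Rightarrow> (nat \<Rightarrow> nat) \<Rightarrow> (nat \<Rightarrow> bool) \<Rightarrow> nat \<Rightarrow> bool" where
  "nae_tap C K lv neg e \<longleftrightarrow>
     (\<not> odd (e mod (2 * C)) \<and> e div (2 * C) = 0 \<and> (nae_cl C e mod K = 0 \<or> Suc (nae_cl C e) mod K = 0)) \<or>
     (odd (e mod (2 * C)) \<and> e div (2 * C) = Suc (nae_cl C e) \<and> nae_cl C e mod K \<noteq> 0) \<or>
     (\<not> odd (e mod (2 * C)) \<and> e div (2 * C) = Suc (Suc (nae_cl C e)) \<and> Suc (nae_cl C e) mod K \<noteq> 0) \<or>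
     (e div (2 * C) = Suc (C + lv (nae_cl C e)) \<and> (odd (e mod (2 * C)) \<longleftrightarrow> neg (nae_cl C e)))"

text \<open>Slot \<open>j * K + i\<close> holds literal \<open>i\<close> of clause \<open>j\<close>.
  With at least two literals per clause no triple is both first and last, so no triple uses the
  falsity element twice.\<close>

locale cnf =
  fixes J K U :: nat and lv :: "nat \<Rightarrow> nat" and neg :: "nat \<Rightarrow> bool"
  assumes K2: "2 \<le> K" and J: "0 < J" and lv: "c < J * K \<Longrightarrow> lv c < U"
begin

definition "C = J * K"
definition "L = 2 * C"
definition "E = Suc (C + U) * L"

lemma C2: "2 \<le> C"
  unfolding C_def using K2 J mult_le_mono[of 1 J 2 K] by simp
lemma L_pos: "0 < L" "4 \<le> L" "even L" using C2 by (auto simp: L_def)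

lemma div_L: "l < L \<Longrightarrow> (v * L + l) div L = v" using L_pos by simp
lemma mod_L: "l < L \<Longrightarrow> (v * L + l) mod L = l" using L_pos by simp

lemma pi_eq: "nae_pi C e = e div L * L + Suc (e mod L) mod L"
  by (simp add: nae_pi_def L_def)

lemma pi_div: "nae_pi C e div L = e div L" and pi_mod: "nae_pi C e mod L = Suc (e mod L) mod L"
  unfolding pi_eq using L_pos by (simp_all add: div_L mod_L)

lemma E_iff: "e < E \<longleftrightarrow> e div L < Suc (C + U)"
  unfolding E_def using L_pos by (simp add: div_less_iff_less_mult)

text \<open>With \<open>Z i\<close> for "none of the first \<open>i\<close> literals is true", slot
  \<open>i\<close> becomes the triple of \<open>\<not> Z i\<close>, literal \<open>i\<close> and
  \<open>Z (i + 1)\<close>. Not all false is the usual chain clause; not all true is harmless,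
  because \<open>Z (i + 1)\<close> implies \<open>Z i\<close>. At the ends, both
  \<open>\<not> Z 0\<close> and \<open>Z K\<close> are falsity.\<close>

definition "e1 c = (if c mod K = 0 then 0 * L + 2 * c else Suc c * L + (2 * c + 1))"
definition "e2 c = Suc (C + lv c) * L + (2 * c + of_bool (neg c))"
definition "e3 c = (if Suc c mod K = 0 then 0 * L + 2 * c else Suc (Suc c) * L + 2 * c)"

lemma Suc_mod_ne: "c mod K = 0 \<Longrightarrow> Suc c mod K \<noteq> 0"
  using K2 by (simp add: mod_Suc)

text \<open>\<open>C\<close> is a multiple of \<open>K\<close>, so the last slot closes a clause.
  Hence the next chain variable \<open>Suc (Suc c)\<close> never runs into the block of the clause
  variables.\<close>

lemma next_slot: "c < C \<Longrightarrow> Suc c mod K \<noteq> 0 \<Longrightarrow> Suc c < C"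
  using mod_mult_self2_is_0[of J K] by (cases "Suc c = C") (auto simp: C_def)

lemma taps_set:
  assumes c: "c < C"
  shows "{e. e < E \<and> nae_tap C K lv neg e \<and> nae_cl C e = c} = {e1 c, e2 c, e3 c}"
proof -
  have lt: "2 * c < L" "2 * c + 1 < L" using c by (auto simp: L_def)
  have code: "e = v * L + l \<longleftrightarrow> e div L = v \<and> e mod L = l" if "l < L" for e v l
    using that L_pos by (metis div_L mod_L div_mult_mod_eq)
  have half: "n div 2 = c \<longleftrightarrow> n = 2 * c \<or> n = 2 * c + 1" for n by presburger
  note l = half[of "_ mod L"]
  have "e < E \<and> nae_tap C K lv neg e \<and> nae_cl C e = c \<longleftrightarrow> e = e1 c \<or> e = e2 c \<or> e = e3 c" for e
  proof -
    have 1: "e = e1 c \<longleftrightarrow> (if c mod K = 0 then e div L = 0 \<and> e mod L = 2 * c else e div L = Suc c \<and> e mod L = 2 * c + 1)"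
      unfolding e1_def using code[OF lt(1), of e 0] code[OF lt(2), of e "Suc c"]
      by (cases "c mod K = 0") (simp_all only: simp_thms if_True if_False)
    have 3: "e = e3 c \<longleftrightarrow> (if Suc c mod K = 0 then e div L = 0 \<and> e mod L = 2 * c else e div L = Suc (Suc c) \<and> e mod L = 2 * c)"
      unfolding e3_def using code[OF lt(1), of e 0] code[OF lt(1), of e "Suc (Suc c)"]
      by (cases "Suc c mod K = 0") (simp_all only: simp_thms if_True if_False)
    have 2: "e = e2 c \<longleftrightarrow> e div L = Suc (C + lv c) \<and> e mod L = 2 * c + of_bool (neg c)"
      unfolding e2_def by (rule code) (use lt in auto)
    have U: "lv c < U" using lv c by (simp add: C_def)
    have n: "Suc c mod K \<noteq> 0 \<Longrightarrow> Suc c < C" using next_slot c by blast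
    \<comment> \<open>The element is abstracted to its variable \<open>v\<close> and the parity
      \<open>od\<close> of its copy, which leaves a propositional statement.\<close>
    have key: "v < Suc (C + U) \<and>
        ((\<not> od \<and> v = 0 \<and> (c mod K = 0 \<or> Suc c mod K = 0)) \<or> (od \<and> v = Suc c \<and> c mod K \<noteq> 0) \<or>
         (\<not> od \<and> v = Suc (Suc c) \<and> Suc c mod K \<noteq> 0) \<or> (v = Suc (C + lv c) \<and> (od \<longleftrightarrow> neg c))) \<longleftrightarrow>
        (if c mod K = 0 then v = 0 \<and> \<not> od else v = Suc c \<and> od) \<or> (v = Suc (C + lv c) \<and> (od \<longleftrightarrow> neg c)) \<or>
        (if Suc c mod K = 0 then v = 0 \<and> \<not> od else v = Suc (Suc c) \<and> \<not> od)" for v od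
    proof -
      have "v < Suc (C + U)" if "v = 0 \<or> v = Suc c \<or> v = Suc (C + lv c) \<or> (v = Suc (Suc c) \<and> Suc c mod K \<noteq> 0)"
        using that U n c by auto
      then show ?thesis using Suc_mod_ne[of c] by (cases "c mod K = 0"; cases "Suc c mod K = 0") (simp_all only: simp_thms if_True if_False, blast+)
    qed
    show ?thesis
    proof (cases "nae_cl C e = c")
      case True
      then have "e mod L = 2 * c \<or> e mod L = 2 * c + 1" using l unfolding nae_cl_def L_def[symmetric] by simp
      then have od: "e mod L = 2 * c \<longleftrightarrow> \<not> odd (e mod L)" "e mod L = 2 * c + 1 \<longleftrightarrow> odd (e mod L)"
        "e mod L = 2 * c + of_bool (neg c) \<longleftrightarrow> (odd (e mod L) \<longleftrightarrow> neg c)" by auto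
      show ?thesis unfolding 1 2 3 od E_iff nae_tap_def True L_def[symmetric]
        using key[of "e div L" "odd (e mod L)"] by (simp only: simp_thms True)
    next
      case False
      then have "\<not> (e mod L = 2 * c \<or> e mod L = 2 * c + 1)" using l unfolding nae_cl_def L_def[symmetric] by simp
      then have "e \<noteq> e1 c" "e \<noteq> e2 c" "e \<noteq> e3 c" unfolding 1 2 3 by (auto split: if_splits)
      then show ?thesis using False by simp
    qed
  qed
  then show ?thesis by blast
qed

text \<open>The cycle of a variable runs through its \<open>L\<close> copies. As \<open>C\<close> is
  at least 2, \<open>L\<close> is at least 4, which excludes fixed points and 2-cycles; the three
  taps of a triple belong to different variables.\<close>

lemma gadget: "ks_gadget E C (nae_pi C) (nae_tap C K lv neg) (nae_cl C)"
proof
  show "0 < C" using C2 by simp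
  have inj: "inj_on (nae_pi C) {..<E}"
  proof (rule inj_onI)
    fix e e' assume "nae_pi C e = nae_pi C e'"
    then have "e div L = e' div L" "Suc (e mod L) mod L = Suc (e' mod L) mod L"
      using pi_div pi_mod by metis+
    moreover have "e mod L < L" "e' mod L < L" using L_pos by auto
    ultimately have "e div L = e' div L" "e mod L = e' mod L" by (auto simp: mod_Suc split: if_splits)
    then show "e = e'" by (metis div_mult_mod_eq)
  qed
  moreover have "nae_pi C ` {..<E} \<subseteq> {..<E}" by (auto simp: E_iff pi_div)
  ultimately show "bij_betw (nae_pi C) {..<E} {..<E}"
    by (simp add: bij_betw_def endo_inj_surj)
  fix e
  have m: "e mod L < L" using L_pos by simp
  show "nae_pi C e \<noteq> e"
  proof
    assume "nae_pi C e = e"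
    then have "Suc (e mod L) mod L = e mod L" using pi_mod[of e] by simp
    then show False using m L_pos by (auto simp: mod_Suc split: if_splits)
  qed
  show "nae_pi C (nae_pi C e) \<noteq> e"
  proof
    assume "nae_pi C (nae_pi C e) = e"
    then have "Suc (Suc (e mod L) mod L) mod L = e mod L" using pi_mod[of e] pi_mod[of "nae_pi C e"] by simp
    then show False using m L_pos by (auto simp: mod_Suc split: if_splits)
  qed
  show "nae_cl C e < C" using m by (auto simp: nae_cl_def L_def)
next
  fix c assume c: "c < C"
  have lt: "2 * c < L" "2 * c + 1 < L" "2 * c + of_bool (neg c) < L" using c by (auto simp: L_def)
  have "e1 c div L = (if c mod K = 0 then 0 else Suc c)"
    unfolding e1_def by (cases "c mod K = 0") (simp_all only: simp_thms if_True if_False div_L[OF lt(1)] div_L[OF lt(2)])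
  moreover have "e3 c div L = (if Suc c mod K = 0 then 0 else Suc (Suc c))"
    unfolding e3_def by (cases "Suc c mod K = 0") (simp_all only: simp_thms if_True if_False div_L[OF lt(1)])
  moreover have "e2 c div L = Suc (C + lv c)" unfolding e2_def by (rule div_L[OF lt(3)])
  ultimately have "e1 c div L \<noteq> e3 c div L" "e2 c div L = Suc (C + lv c)" "e1 c div L \<le> C" "e3 c div L \<le> C"
    using Suc_mod_ne[of c] next_slot[OF c] c by auto
  then have "e1 c \<noteq> e3 c" "e1 c \<noteq> e2 c" "e2 c \<noteq> e3 c" by auto
  then show "card {e. e < E \<and> nae_tap C K lv neg e \<and> nae_cl C e = c} = 3"
    unfolding taps_set[OF c] by simp
qed

lemma good_iff:
  "ks_gadget.good E C (nae_pi C) (nae_tap C K lv neg) (nae_cl C) s \<longleftrightarrow>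
    (\<forall>e<E. s (nae_pi C e) \<longleftrightarrow> \<not> s e) \<and>
    (\<forall>c<C. (s (e1 c) \<or> s (e2 c) \<or> s (e3 c)) \<and> \<not> (s (e1 c) \<and> s (e2 c) \<and> s (e3 c)))"
proof -
  have "(\<exists>e<E. nae_tap C K lv neg e \<and> nae_cl C e = c \<and> P e) \<longleftrightarrow> P (e1 c) \<or> P (e2 c) \<or> P (e3 c)" if "c < C" for c P
  proof -
    have "(\<exists>e<E. nae_tap C K lv neg e \<and> nae_cl C e = c \<and> P e) \<longleftrightarrow>
        (\<exists>e\<in>{e. e < E \<and> nae_tap C K lv neg e \<and> nae_cl C e = c}. P e)" by auto
    then show ?thesis unfolding taps_set[OF that] by simp
  qed
  note exec = this
  have "(\<exists>e<E. nae_tap C K lv neg e \<and> nae_cl C e = c \<and> s e) \<and> (\<exists>e<E. nae_tap C K lv neg e \<and> nae_cl C e = c \<and> \<not> s e)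
      \<longleftrightarrow> (s (e1 c) \<or> s (e2 c) \<or> s (e3 c)) \<and> \<not> (s (e1 c) \<and> s (e2 c) \<and> s (e3 c))" if "c < C" for c
    unfolding exec[OF that] by (simp only: de_Morgan_conj)
  then show ?thesis unfolding ks_gadget.good_def[OF gadget] by (simp only: cong: imp_cong)
qed

definition sat :: "(nat \<Rightarrow> bool) \<Rightarrow> bool" where
  "sat A \<longleftrightarrow> (\<forall>j<J. \<exists>i<K. A (lv (j * K + i)) \<noteq> neg (j * K + i))"

lemma slot: "j < J \<Longrightarrow> i < K \<Longrightarrow> j * K + i < C"
  unfolding C_def by (metis add_less_cancel_left less_le_trans mult_Suc add.commute Suc_leI mult_le_mono1)

text \<open>Not-all-equal constraints are invariant under complementing everything, so a variable
  counts as true if it differs from variable 0.\<close>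

lemma sat_of_good:
  assumes "ks_gadget.good E C (nae_pi C) (nae_tap C K lv neg) (nae_cl C) s"
  shows "sat (\<lambda>u. s (Suc (C + u) * L) \<noteq> s 0)"
proof -
  have flip: "\<And>e. e < E \<Longrightarrow> s (nae_pi C e) \<longleftrightarrow> \<not> s e"
    and nae: "\<And>c. c < C \<Longrightarrow> (s (e1 c) \<or> s (e2 c) \<or> s (e3 c)) \<and> \<not> (s (e1 c) \<and> s (e2 c) \<and> s (e3 c))"
    using assms unfolding good_iff by blast+
  have val: "s (v * L + l) \<longleftrightarrow> (s (v * L) \<noteq> odd l)" if "v < Suc (C + U)" "l < L" for v l
    using that(2)
  proof (induction l)
    case (Suc l)
    have "nae_pi C (v * L + l) = v * L + Suc l"
      using Suc.prems unfolding pi_eq by (simp add: div_L mod_L)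
    moreover have "v * L + l < E" using that(1) Suc.prems by (simp add: E_iff div_L)
    ultimately show ?case using flip[of "v * L + l"] Suc by simp
  qed simp
  show ?thesis unfolding sat_def
  proof (intro allI impI, rule ccontr)
    fix j assume j: "j < J"
    assume "\<not> (\<exists>i<K. (s (Suc (C + lv (j * K + i)) * L) \<noteq> s 0) \<noteq> neg (j * K + i))"
    then have f: "(s (Suc (C + lv (j * K + i)) * L) \<noteq> neg (j * K + i)) = s 0" if "i < K" for i using that by blast
    \<comment> \<open>The chain with its prescribed ends. If all literals of the clause were false,
      each triple would have two members equal to \<open>s 0\<close> and pass the value
      \<open>\<not> s 0\<close> on, up to \<open>Z K\<close>, which is \<open>s 0\<close>.\<close>
    define Z where "Z i = (if i = 0 then \<not> s 0 else if i = K then s 0 else s (Suc (j * K + i) * L))" for i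
    have "i \<le> K \<Longrightarrow> Z i = (\<not> s 0)" for i
    proof (induction i)
      case (Suc i)
      let ?c = "j * K + i"
      have i: "i < K" and c: "?c < C" and lt: "2 * ?c + 1 < L" using Suc.prems slot[OF j, of i] by (auto simp: L_def)
      have "?c mod K = i" using i by simp
      have "s (e1 ?c) = (\<not> Z i)"
        using val[of 0 "2 * ?c"] val[of "Suc ?c" "2 * ?c + 1"] lt c i unfolding e1_def Z_def
        by (auto simp del: mult_Suc mult_0)
      moreover have "s (e2 ?c) = s 0"
        using val[of "Suc (C + lv ?c)" "2 * ?c + of_bool (neg ?c)"] f[OF i] lv[of ?c] c lt unfolding e2_def
        by (auto simp: C_def[symmetric] simp del: mult_Suc)
      moreover have "s (e3 ?c) = Z (Suc i)"
        using val[of 0 "2 * ?c"] val[of "Suc (Suc ?c)" "2 * ?c"] lt c i next_slot[OF c] unfolding e3_def Z_def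
        by (auto simp: mod_Suc simp del: mult_Suc mult_0)
      ultimately show ?case using nae[OF c] Suc.IH i by auto
    qed (simp add: Z_def)
    from this[of K] show False using K2 by (simp add: Z_def)
  qed
qed

text \<open>Giving the chain variables their intended meaning makes \<open>Z (i + 1)\<close> the
  conjunction of \<open>Z i\<close> and the negated literal, so no triple is constant; at the last
  slot this uses that some literal of the clause is true.\<close>

lemma good_of_sat:
  assumes "sat A"
  obtains s where "ks_gadget.good E C (nae_pi C) (nae_tap C K lv neg) (nae_cl C) s"
proof -
  \<comment> \<open>\<open>c - c mod K\<close> is the first slot of the clause of
    \<open>c\<close>.\<close>
  define z where "z c \<longleftrightarrow> (\<forall>i<c mod K. A (lv (c - c mod K + i)) = neg (c - c mod K + i))" for c
  define val where "val v = (if v = 0 then False else if v \<le> C then z (v - 1) else A (v - Suc C))" for v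
  define s where "s e \<longleftrightarrow> val (e div L) \<noteq> odd (e mod L)" for e
  have s: "s (v * L + l) \<longleftrightarrow> val v \<noteq> odd l" if "l < L" for v l
    using that by (simp add: s_def div_L mod_L)
  have "s (nae_pi C e) \<longleftrightarrow> \<not> s e" for e
  proof -
    have "e mod L < L" using L_pos by simp
    \<comment> \<open>As \<open>L\<close> is even, the parity also alternates where the cycle
      closes.\<close>
    moreover have "odd (e mod L)" if "Suc (e mod L) = L" using L_pos(3) that by (metis even_Suc)
    ultimately have "odd (Suc (e mod L) mod L) \<longleftrightarrow> \<not> odd (e mod L)"
      by (cases "Suc (e mod L) = L") simp_all
    then show ?thesis unfolding s_def pi_div pi_mod by simp
  qed
  moreover have "(s (e1 c) \<or> s (e2 c) \<or> s (e3 c)) \<and> \<not> (s (e1 c) \<and> s (e2 c) \<and> s (e3 c))" if c: "c < C" for c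
  proof -
    define j i where "j = c div K" and "i = c mod K"
    have cji: "c = j * K + i" and i: "i < K" using K2 by (auto simp: j_def i_def)
    have j: "j < J" using c K2 unfolding j_def C_def by (simp add: div_less_iff_less_mult)
    have lt: "2 * c < L" "2 * c + 1 < L" using c by (auto simp: L_def)
    let ?f = "\<lambda>i. A (lv (j * K + i)) = neg (j * K + i)"
    have z: "z (j * K + i') \<longleftrightarrow> (\<forall>i<i'. ?f i)" if "i' < K" for i' using that by (simp add: z_def)
    have 1: "s (e1 c) = (\<not> (\<forall>i'<i. ?f i'))"
      using c i z[OF i] s[OF lt(1), of 0] s[OF lt(2), of "Suc c"] unfolding e1_def i_def[symmetric]
      by (auto simp: val_def cji[symmetric] simp del: mult_Suc mult_0)
    have 2: "s (e2 c) = (\<not> ?f i)"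
      using s[of "2 * c + of_bool (neg c)" "Suc (C + lv c)"] lt unfolding e2_def
      by (auto simp: val_def cji[symmetric] simp del: mult_Suc)
    have 3: "s (e3 c) = (\<forall>i'<Suc i. ?f i')"
    proof (cases "Suc i = K")
      case True
      then have "Suc c mod K = 0" by (simp add: i_def mod_Suc)
      moreover have "\<not> (\<forall>i'<K. ?f i')" using assms j unfolding sat_def by auto
      ultimately show ?thesis using s[OF lt(1), of 0] True unfolding e3_def by (auto simp: val_def)
    next
      case False
      then have "Suc c mod K = Suc i" using i by (simp add: i_def mod_Suc)
      then have "Suc c mod K \<noteq> 0" "Suc c = j * K + Suc i" "Suc i < K" using cji False i by auto
      moreover have "Suc c < C" using next_slot[OF c] calculation(1) .
      ultimately show ?thesis using s[OF lt(1), of "Suc (Suc c)"] z[of "Suc i"] unfolding e3_def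
        by (auto simp: val_def simp del: mult_Suc)
    qed
    show ?thesis unfolding 1 2 3 by (auto simp: less_Suc_eq)
  qed
  ultimately show ?thesis using that good_iff by blast
qed

end

text \<open>
  A binary constraint satisfaction problem with \<open>Q\<close> cells and values below \<open>K\<close>: the predicate
  \<open>forb q o s s'\<close> forbids the value \<open>s\<close> at \<open>q\<close> together with \<open>s'\<close> at the cell \<open>q + off o\<close>.
\<close>

definition csp_cell :: "nat \<Rightarrow> nat \<Rightarrow> nat" where "csp_cell K c = c div K div K div K div 4"

definition csp_bad :: "nat \<Rightarrow> (nat \<Rightarrow> nat \<Rightarrow> nat \<Rightarrow> nat \<Rightarrow> bool) \<Rightarrow> nat \<Rightarrow> bool" where
  "csp_bad K forb c = forb (csp_cell K c) (c div K div K div K mod 4) (c div K div K mod K) (c div K mod K)"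

text \<open>The clause index encodes a cell, an offset and two values; the last digit of
  \<open>c\<close> is the position in the clause. A forbidden pair becomes the clause of its two
  negations, the second repeated up to width \<open>K\<close>. Every other index is spent on the
  clause that the cell has some value, so all clauses have width \<open>K\<close>.\<close>

definition csp_var :: "nat \<Rightarrow> (nat \<Rightarrow> nat) \<Rightarrow> (nat \<Rightarrow> nat \<Rightarrow> nat \<Rightarrow> nat \<Rightarrow> bool) \<Rightarrow> nat \<Rightarrow> nat" where
  "csp_var K off forb c =
    (if csp_bad K forb c then
      (if c mod K = 0 then csp_cell K c * K + c div K div K mod K
       else (csp_cell K c + off (c div K div K div K mod 4)) * K + c div K mod K)
     else csp_cell K c * K + c mod K)"

locale csp =
  fixes Q K :: nat and off :: "nat \<Rightarrow> nat" and forb :: "nat \<Rightarrow> nat \<Rightarrow> nat \<Rightarrow> nat \<Rightarrow> bool"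
  assumes K2: "2 \<le> K" and Q: "0 < Q" and forb: "forb q o' s s' \<Longrightarrow> o' < 3 \<and> q + off o' < Q"
begin

definition "J = Q * 4 * K * K"

lemma cell_less: "c < J * K \<Longrightarrow> csp_cell K c < Q"
  using K2 unfolding csp_cell_def J_def by (simp add: div_less_iff_less_mult)

sublocale cnf J K "Q * K" "csp_var K off forb" "csp_bad K forb"
proof
  show "2 \<le> K" by (rule K2)
  show "0 < J" using K2 Q by (simp add: J_def)
  fix c assume "c < J * K"
  then have q: "csp_cell K c < Q" by (rule cell_less)
  have less: "a * K + b < Q * K" if "a < Q" "b < K" for a b
    using that by (metis add_less_cancel_left less_le_trans mult_Suc add.commute Suc_leI mult_le_mono1)
  have "0 < K" using K2 by simp
  moreover have "csp_cell K c + off (c div K div K div K mod 4) < Q" if "csp_bad K forb c"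
    using forb that unfolding csp_bad_def by blast
  ultimately show "csp_var K off forb c < Q * K" unfolding csp_var_def using q by (auto intro!: less)
qed

definition csp_sat :: "(nat \<Rightarrow> bool) \<Rightarrow> bool" where
  "csp_sat A \<longleftrightarrow> (\<forall>q<Q. \<exists>s<K. A (q * K + s)) \<and>
     (\<forall>q<Q. \<forall>o'<4. \<forall>s<K. \<forall>s'<K. forb q o' s s' \<longrightarrow> \<not> (A (q * K + s) \<and> A ((q + off o') * K + s')))"

lemma decode:
  fixes q o' s s' i :: nat
  assumes "s < K" "s' < K" "i < K" "o' < 4"
  defines c: "c \<equiv> (((q * 4 + o') * K + s) * K + s') * K + i"
  shows "c mod K = i" "c div K mod K = s'" "c div K div K mod K = s" "c div K div K div K mod 4 = o'"
    "csp_cell K c = q"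
  using assms unfolding csp_cell_def by simp_all

lemma sat_iff: "sat A \<longleftrightarrow> csp_sat A"
proof
  assume sat: "sat A"
  have clause: "\<exists>i<K. if forb q o' s s' then \<not> A (if i = 0 then q * K + s else (q + off o') * K + s') else A (q * K + i)"
    if "q < Q" "o' < 4" "s < K" "s' < K" for q o' s s'
  proof -
    let ?j = "((q * 4 + o') * K + s) * K + s'"
    have "?j < J"
    proof -
      have "q * 4 + o' < Q * 4" using that by linarith
      then have "(q * 4 + o') * K + s < Q * 4 * K"
        using that by (metis add_less_cancel_left less_le_trans mult_Suc add.commute Suc_leI mult_le_mono1)
      then show ?thesis unfolding J_def
        using that by (metis add_less_cancel_left less_le_trans mult_Suc add.commute Suc_leI mult_le_mono1)
    qed
    from sat[unfolded sat_def, rule_format, OF this]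
    obtain i where i: "i < K" "A (csp_var K off forb (?j * K + i)) \<noteq> csp_bad K forb (?j * K + i)"
      by (elim exE conjE)
    note d = decode[OF that(3,4) i(1) that(2), of q]
    show ?thesis
    proof (intro exI[of _ i] conjI i(1))
      show "if forb q o' s s' then \<not> A (if i = 0 then q * K + s else (q + off o') * K + s') else A (q * K + i)"
        using i(2) unfolding csp_var_def csp_bad_def d by (cases "forb q o' s s'"; cases "i = 0") simp_all
    qed
  qed
  \<comment> \<open>The fourth offset is never forbidden, which guarantees that the clause "some
    value" occurs for every cell.\<close>
  have "\<not> forb q 3 s s'" for q s s' using forb by blast
  then have "\<exists>s<K. A (q * K + s)" if "q < Q" for q
    using clause[OF that, of 3 0 0] K2 by simp
  moreover have "\<not> (A (q * K + s) \<and> A ((q + off o') * K + s'))"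
    if "q < Q" "o' < 4" "s < K" "s' < K" "forb q o' s s'" for q o' s s'
    using clause[OF that(1-4)] that(5) by (auto split: if_splits)
  ultimately show "csp_sat A" unfolding csp_sat_def by blast
next
  assume cs: "csp_sat A"
  show "sat A" unfolding sat_def
  proof (intro allI impI)
    fix j assume j: "j < J"
    define q o' s s' where "q = j div K div K div 4" and "o' = j div K div K mod 4" and "s = j div K mod K" and "s' = j mod K"
    have lt: "o' < 4" "s < K" "s' < K" using K2 by (auto simp: o'_def s_def s'_def)
    have j_eq: "j = ((q * 4 + o') * K + s) * K + s'" by (simp add: q_def o'_def s_def s'_def)
    have q: "q < Q" using j K2 unfolding J_def q_def by (simp add: div_less_iff_less_mult)
    have d: "(A (csp_var K off forb (j * K + i)) \<noteq> csp_bad K forb (j * K + i)) \<longleftrightarrow>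
        (if forb q o' s s' then \<not> A (if i = 0 then q * K + s else (q + off o') * K + s') else A (q * K + i))" if "i < K" for i
      unfolding csp_var_def csp_bad_def j_eq decode[OF lt(2,3) that lt(1), of q]
      by (cases "forb q o' s s'"; cases "i = 0") simp_all
    have "\<exists>i<K. if forb q o' s s' then \<not> A (if i = 0 then q * K + s else (q + off o') * K + s') else A (q * K + i)"
    proof (cases "forb q o' s s'")
      case True
      then have "\<not> A (q * K + s) \<or> \<not> A ((q + off o') * K + s')" using cs q lt unfolding csp_sat_def by blast
      then show ?thesis using True K2 by (elim disjE) (auto intro: exI[of _ 0] exI[of _ 1])
    next
      case False
      then show ?thesis using cs q unfolding csp_sat_def by simp
    qed
    then show "\<exists>i<K. A (csp_var K off forb (j * K + i)) \<noteq> csp_bad K forb (j * K + i)"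
      using d by blast
  qed
qed

end

section \<open>The tableau of a computation\<close>

text \<open>State, symbols under all heads, then the symbols to the left of the cell, in it, and to
  its right. Carrying state and read symbols in every cell makes the rewriting local although the
  tapes shift independently.\<close>

type_synonym tile = "nat \<times> nat list \<times> nat list \<times> nat list \<times> nat list"

text \<open>The numbering of tiles only has to be onto; tiles may repeat. It depends on the machine
  alone, so \<open>K\<close> is a constant of the reduction.\<close>

locale tableau =
  fixes M :: tm and K :: nat and tile_of :: "nat \<Rightarrow> tile"
  assumes wf: "tm_wf M" and tapes2: "2 \<le> tm_tapes M" and K2: "2 \<le> K"
    and tiles: "tile_of ` {..<K} = {..tm_states M} \<times> {ss. set ss \<subseteq> {..<tm_symbols M} \<and> length ss = tm_tapes M} \<times>
        {ss. set ss \<subseteq> {..<tm_symbols M} \<and> length ss = tm_tapes M} \<times>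
        {ss. set ss \<subseteq> {..<tm_symbols M} \<and> length ss = tm_tapes M} \<times>
        {ss. set ss \<subseteq> {..<tm_symbols M} \<and> length ss = tm_tapes M}"
begin

definition syms where "syms = {ss. set ss \<subseteq> {..<tm_symbols M} \<and> length ss = tm_tapes M}"

definition valid :: "config \<Rightarrow> bool" where
  "valid cf \<longleftrightarrow> fst cf \<le> tm_states M \<and> length (snd cf) = tm_tapes M \<and>
     (\<forall>j<tm_tapes M. \<forall>i. fst (snd cf ! j) i < tm_symbols M)"

definition col :: "config \<Rightarrow> int \<Rightarrow> nat list" where
  "col cf p = map (\<lambda>tp. fst tp (snd tp + p)) (snd cf)"

definition nextq :: "nat \<Rightarrow> nat list \<Rightarrow> nat" where
  "nextq q r = (if q = tm_states M then q else fst (tm_delta M q r))"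

text \<open>The position \<open>p\<close> is relative to the new head, hence
  \<open>p + shift mv\<close> relative to the old one. It is the cell just written if this is 0;
  otherwise its content comes from the neighbour in the direction of the move.\<close>

definition upd :: "int \<Rightarrow> nat \<Rightarrow> nat list \<Rightarrow> nat list \<Rightarrow> nat list \<Rightarrow> nat list \<Rightarrow> nat list" where
  "upd p q r a b c = map (\<lambda>j. if q = tm_states M then b ! j else
     (case snd (tm_delta M q r) ! j of (s, mv) \<Rightarrow> if p + shift mv = 0 then s
        else (case mv of Move_Left \<Rightarrow> a ! j | Stay \<Rightarrow> b ! j | Move_Right \<Rightarrow> c ! j))) [0..<tm_tapes M]"

text \<open>Only the positions -1, 0 and 1 can be the cell just written. All others share the
  representative 2, so four tables of vertical constraints suffice.\<close>

definition clip :: "int \<Rightarrow> int" where "clip p = (if \<bar>p\<bar> \<le> 1 then p else 2)"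

lemma clip_shift: "clip p + shift mv = 0 \<longleftrightarrow> p + shift mv = 0"
  by (cases mv) (auto simp: clip_def)

lemma col_syms: "valid cf \<Longrightarrow> col cf p \<in> syms"
  by (auto simp: valid_def col_def syms_def in_set_conv_nth) (metis fst_conv)

lemma col_nth: "valid cf \<Longrightarrow> j < tm_tapes M \<Longrightarrow> col cf p ! j = fst (snd cf ! j) (snd (snd cf ! j) + p)"
  by (simp add: valid_def col_def)

lemma read_col: "map read_tape (snd cf) = col cf 0"
  by (auto simp: col_def)

lemma delta_wf:
  assumes "q < tm_states M" "r \<in> syms"
  shows "fst (tm_delta M q r) \<le> tm_states M" "length (snd (tm_delta M q r)) = tm_tapes M"
    "j < tm_tapes M \<Longrightarrow> fst (snd (tm_delta M q r) ! j) < tm_symbols M"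
proof -
  obtain q' acts where d: "tm_delta M q r = (q', acts)" by (cases "tm_delta M q r")
  have "\<forall>q < tm_states M. \<forall>ss. length ss = tm_tapes M \<and> set ss \<subseteq> {..<tm_symbols M} \<longrightarrow>
        (case tm_delta M q ss of (q', acts) \<Rightarrow>
           q' \<le> tm_states M \<and> length acts = tm_tapes M \<and> (\<forall>(s, mv) \<in> set acts. s < tm_symbols M))"
    using wf unfolding tm_wf_def by (elim conjE)
  from this[rule_format, OF assms(1), of r] assms(2)
  have *: "q' \<le> tm_states M" "length acts = tm_tapes M" "\<forall>a \<in> set acts. fst a < tm_symbols M"
    unfolding d syms_def by (simp_all add: case_prod_beta)
  then show "fst (tm_delta M q r) \<le> tm_states M" "length (snd (tm_delta M q r)) = tm_tapes M"
    by (simp_all add: d)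
  show "j < tm_tapes M \<Longrightarrow> fst (snd (tm_delta M q r) ! j) < tm_symbols M"
    using * nth_mem[of j acts] by (simp add: d)
qed

lemma step:
  assumes v: "valid cf"
  shows "valid (tm_step M cf)" "fst (tm_step M cf) = nextq (fst cf) (col cf 0)"
    "col (tm_step M cf) p = upd (clip p) (fst cf) (col cf 0) (col cf (p - 1)) (col cf p) (col cf (p + 1))"
    "j < tm_tapes M \<Longrightarrow> \<bar>snd (snd (tm_step M cf) ! j) - snd (snd cf ! j)\<bar> \<le> 1"
proof -
  obtain q ts where cf: "cf = (q, ts)" by (cases cf)
  have l: "length ts = tm_tapes M" using v cf by (simp add: valid_def)
  have "valid (tm_step M cf) \<and> fst (tm_step M cf) = nextq (fst cf) (col cf 0) \<and>
    col (tm_step M cf) p = upd (clip p) (fst cf) (col cf 0) (col cf (p - 1)) (col cf p) (col cf (p + 1)) \<and>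
    (\<forall>j<tm_tapes M. \<bar>snd (snd (tm_step M cf) ! j) - snd (snd cf ! j)\<bar> \<le> 1)"
  proof (cases "q = tm_states M")
    case True
    have "upd (clip p) q (col cf 0) (col cf (p - 1)) (col cf p) (col cf (p + 1)) = col cf p"
      unfolding upd_def using True l cf by (intro nth_equalityI) (auto simp: col_def)
    then show ?thesis using v True by (simp add: cf nextq_def)
  next
    case False
    then have q: "q < tm_states M" using v cf by (simp add: valid_def)
    let ?D = "tm_delta M q (col cf 0)"
    note D = delta_wf[OF q col_syms[OF v, of 0]]
    have st: "tm_step M cf = (fst ?D, map2 act_tape (snd ?D) ts)"
      using False read_col[of cf] by (simp add: cf case_prod_beta)
    have act: "act_tape (snd ?D ! j) (ts ! j) = ((fst (ts ! j))(snd (ts ! j) := fst (snd ?D ! j)), snd (ts ! j) + shift (snd (snd ?D ! j)))" for j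
      by (cases "ts ! j"; cases "snd ?D ! j") simp
    have nth: "map2 act_tape (snd ?D) ts ! j = ((fst (ts ! j))(snd (ts ! j) := fst (snd ?D ! j)), snd (ts ! j) + shift (snd (snd ?D ! j)))"
      if "j < tm_tapes M" for j
      using that l D(2) act by simp
    have len: "length (map2 act_tape (snd ?D) ts) = tm_tapes M" using l D(2) by simp
    have vs: "valid (tm_step M cf)"
      using v D len unfolding st valid_def by (auto simp: act[unfolded cf] cf)
    have lc: "length (col (tm_step M cf) p) = tm_tapes M" using col_syms[OF vs, of p] by (simp add: syms_def)
    note vs moreover have "col (tm_step M cf) p = upd (clip p) q (col cf 0) (col cf (p - 1)) (col cf p) (col cf (p + 1))"
    proof (rule nth_equalityI)
      show "length (col (tm_step M cf) p) = length (upd (clip p) q (col cf 0) (col cf (p - 1)) (col cf p) (col cf (p + 1)))"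
        using lc by (simp add: upd_def)
      fix j assume "j < length (col (tm_step M cf) p)"
      then have j: "j < tm_tapes M" using lc by simp
      obtain s mv where a: "snd ?D ! j = (s, mv)" by (cases "snd ?D ! j")
      have "col (tm_step M cf) p ! j = (if p + shift mv = 0 then s else fst (ts ! j) (snd (ts ! j) + (p + shift mv)))"
        by (subst col_nth[OF vs j], unfold st snd_conv nth[OF j] a) (simp add: algebra_simps)
      moreover have "col cf p' ! j = fst (ts ! j) (snd (ts ! j) + p')" for p'
        using col_nth[OF v j] by (simp add: cf)
      ultimately show "col (tm_step M cf) p ! j = upd (clip p) q (col cf 0) (col cf (p - 1)) (col cf p) (col cf (p + 1)) ! j"
        using j a False by (cases mv) (simp_all add: upd_def clip_shift)
    qed
    moreover have "\<bar>shift mv\<bar> \<le> 1" for mv by (cases mv) auto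
    ultimately show ?thesis using False st l D(2) by (simp add: cf nextq_def act[unfolded cf])
  qed
  then show "valid (tm_step M cf)" "fst (tm_step M cf) = nextq (fst cf) (col cf 0)"
    "col (tm_step M cf) p = upd (clip p) (fst cf) (col cf 0) (col cf (p - 1)) (col cf p) (col cf (p + 1))"
    "j < tm_tapes M \<Longrightarrow> \<bar>snd (snd (tm_step M cf) ! j) - snd (snd cf ! j)\<bar> \<le> 1"
    by blast+
qed

definition cfg :: "bool list \<Rightarrow> bool list \<Rightarrow> nat \<Rightarrow> config" where
  "cfg x y t = (tm_step M ^^ t) (tm_init M [x, y])"

lemma cfg_Suc: "cfg x y (Suc t) = tm_step M (cfg x y t)" by (simp add: cfg_def)

lemma cfg_0_nth: "j < tm_tapes M \<Longrightarrow>
    snd (cfg x y 0) ! j = (string_tape (if j = 0 then x else if j = 1 then y else []), 0)"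
  by (auto simp: cfg_def tm_init_def less_Suc_eq)

lemma cfg_valid: "valid (cfg x y t)"
proof (induction t)
  case 0
  have "3 \<le> tm_symbols M" using wf by (simp add: tm_wf_def)
  then show ?case unfolding valid_def using cfg_0_nth[of _ x y]
    by (auto simp: cfg_def tm_init_def string_tape_def)
qed (simp add: cfg_Suc step(1))

lemma cfg_head: "j < tm_tapes M \<Longrightarrow> \<bar>snd (snd (cfg x y t) ! j)\<bar> \<le> int t"
proof (induction t)
  case 0
  then show ?case by (simp add: cfg_0_nth)
next
  case (Suc t)
  then show ?case using step(4)[OF cfg_valid, of j x y t] by (simp add: cfg_Suc)
qed

lemma col_0: "col (cfg x y 0) p = map (\<lambda>j. string_tape (if j = 0 then x else if j = 1 then y else []) p) [0..<tm_tapes M]"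
proof (rule nth_equalityI)
  show "length (col (cfg x y 0) p) = length (map (\<lambda>j. string_tape (if j = 0 then x else if j = 1 then y else []) p) [0..<tm_tapes M])"
    using cfg_valid[of x y 0] by (simp add: valid_def col_def)
  fix j assume "j < length (col (cfg x y 0) p)"
  then have "j < tm_tapes M" using cfg_valid[of x y 0] by (simp add: valid_def col_def)
  then show "col (cfg x y 0) p ! j = map (\<lambda>j. string_tape (if j = 0 then x else if j = 1 then y else []) p) [0..<tm_tapes M] ! j"
    by (simp add: col_nth cfg_valid cfg_0_nth)
qed

text \<open>Halting configurations repeat, so one tableau height serves every halting time up to
  it.\<close>

lemma halted_stable:
  assumes "fst (cfg x y t) = tm_states M" "t \<le> t'" shows "cfg x y t' = cfg x y t"
  using assms(2)
proof (induction rule: dec_induct)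
  case (step n)
  then show ?case using assms(1) by (cases "cfg x y t") (simp add: cfg_Suc)
qed simp

lemma halted_eq:
  assumes "fst (cfg x y t) = tm_states M" "fst (cfg x y t') = tm_states M"
  shows "cfg x y t' = cfg x y t"
  using halted_stable[OF assms(1), of t'] halted_stable[OF assms(2), of t] by (cases "t \<le> t'") auto

definition tq where "tq s = fst (tile_of s)"
definition tr where "tr s = fst (snd (tile_of s))"
definition ta where "ta s = fst (snd (snd (tile_of s)))"
definition tb where "tb s = fst (snd (snd (snd (tile_of s))))"
definition tc where "tc s = snd (snd (snd (snd (tile_of s))))"

text \<open>The second tape is only bounded by 2: its content is the guessed certificate. Through
  \<open>Blk\<close>, the constraints keep it blank left of the origin and let blanks spread to the
  right, so that it is a word.\<close>

definition Ini where "Ini \<sigma> = {s. s < K \<and> tq s = 0 \<and> tb s ! 0 = \<sigma> \<and> tb s ! 1 \<le> 2 \<and>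
    (\<forall>j. 2 \<le> j \<and> j < tm_tapes M \<longrightarrow> tb s ! j = 0)}"
definition Blk where "Blk = {s. s < K \<and> tb s ! 1 = 0}"
definition Cen where "Cen = {s. s < K \<and> tb s = tr s}"
text \<open>Symbol 1 is the bit False, the sign of rejection on the output tape.\<close>

definition Fin where "Fin = {s. s < K \<and> tq s = tm_states M \<and> tb s ! 0 \<noteq> 1}"
definition Hor where "Hor = {(s, s'). s < K \<and> s' < K \<and> tq s' = tq s \<and> tr s' = tr s \<and> ta s' = tb s \<and> tb s' = tc s}"
definition Ver where "Ver p = {(s, s'). s < K \<and> s' < K \<and> tq s' = nextq (tq s) (tr s) \<and>
    tb s' = upd p (tq s) (tr s) (ta s) (tb s) (tc s)}"

text \<open>
  Row \<open>t\<close> of the tableau describes time \<open>t\<close>, and column \<open>p\<close> the position \<open>p - 2 * T\<close> relative to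
  each head; there are \<open>4 * T + 1\<close> columns.
\<close>

definition forb :: "bool list \<Rightarrow> nat \<Rightarrow> nat \<Rightarrow> nat \<Rightarrow> nat \<Rightarrow> nat \<Rightarrow> nat \<Rightarrow> nat \<Rightarrow> bool" where
  "forb x T t p q o' s s' \<longleftrightarrow> q < (T + 1) * (4 * T + 1) \<and>
    (o' = 0 \<and> (\<not> s = s' \<or>
       (t = 0 \<and> 2 * T \<le> p \<and> (p - 2 * T < length x \<and> x ! (p - 2 * T)) \<and> \<not> s \<in> Ini 2) \<or>
       (t = 0 \<and> 2 * T \<le> p \<and> p - 2 * T < length x \<and> \<not> (p - 2 * T < length x \<and> x ! (p - 2 * T)) \<and> \<not> s \<in> Ini 1) \<or>
       (t = 0 \<and> (p < 2 * T \<or> length x \<le> p - 2 * T) \<and> \<not> s \<in> Ini 0) \<or>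
       (t = 0 \<and> p < 2 * T \<and> \<not> s \<in> Blk) \<or>
       (p = 2 * T \<and> \<not> s \<in> Cen) \<or> (t = T \<and> \<not> s \<in> Fin)) \<or>
     o' = 1 \<and> p < 4 * T \<and> (\<not> (s, s') \<in> Hor \<or> (t = 0 \<and> 2 * T \<le> p \<and> s \<in> Blk \<and> \<not> s' \<in> Blk)) \<or>
     o' = 2 \<and> t < T \<and> ((p + 1 = 2 * T \<and> \<not> (s, s') \<in> Ver (- 1)) \<or> (p = 2 * T \<and> \<not> (s, s') \<in> Ver 0) \<or>
       (p = 2 * T + 1 \<and> \<not> (s, s') \<in> Ver 1) \<or>
       (\<not> p + 1 = 2 * T \<and> \<not> p = 2 * T \<and> \<not> p = 2 * T + 1 \<and> \<not> (s, s') \<in> Ver 2)))"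

definition forb' :: "bool list \<Rightarrow> nat \<Rightarrow> nat \<Rightarrow> nat \<Rightarrow> nat \<Rightarrow> nat \<Rightarrow> bool" where
  "forb' x T q = forb x T (q div (4 * T + 1)) (q mod (4 * T + 1)) q"

definition off :: "nat \<Rightarrow> nat \<Rightarrow> nat" where
  "off T o' = (if o' = 0 then 0 else if o' = 1 then 1 else 4 * T + 1)"

lemma cell_code:
  fixes p T t :: nat
  assumes "p < 4 * T + 1"
  shows "(t * (4 * T + 1) + p) div (4 * T + 1) = t \<and> (t * (4 * T + 1) + p) mod (4 * T + 1) = p"
proof -
  have "p < n \<Longrightarrow> (t * n + p) div n = t \<and> (t * n + p) mod n = p" for n by simp
  with assms show ?thesis by blast
qed

lemma cell_less:
  fixes p T t :: nat
  shows "t \<le> T \<Longrightarrow> p < 4 * T + 1 \<Longrightarrow> t * (4 * T + 1) + p < (T + 1) * (4 * T + 1)"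
proof -
  assume "t \<le> T" "p < 4 * T + 1"
  then have "t * (4 * T + 1) + p < t * (4 * T + 1) + (4 * T + 1)" by simp
  also have "\<dots> = (t + 1) * (4 * T + 1)" by simp
  also have "\<dots> \<le> (T + 1) * (4 * T + 1)" using \<open>t \<le> T\<close> by (intro mult_le_mono1) simp
  finally show ?thesis .
qed

lemma csp: "csp ((T + 1) * (4 * T + 1)) K (off T) (forb' x T)"
proof
  show "2 \<le> K" by (rule K2)
  show "0 < (T + 1) * (4 * T + 1)" by simp
  fix q o' s s' assume f: "forb' x T q o' s s'"
  let ?W = "4 * T + 1"
  let ?t = "q div ?W" and ?p = "q mod ?W"
  have q: "q = ?t * ?W + ?p" by (rule div_mult_mod_eq[symmetric])
  have qQ: "q < (T + 1) * ?W" using f by (simp add: forb'_def forb_def)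
  then have t: "?t \<le> T" using less_mult_imp_div_less[of q "T + 1" ?W] by simp
  have "o' = 0 \<or> o' = 1 \<and> ?p < 4 * T \<or> o' = 2 \<and> ?t < T" using f unfolding forb'_def forb_def by blast
  then show "o' < 3 \<and> q + off T o' < (T + 1) * ?W"
  proof (elim disjE conjE)
    assume "o' = 1" "?p < 4 * T"
    then show ?thesis using cell_less[OF t, of "?p + 1"] q unfolding off_def by simp
  next
    assume "o' = 2" "?t < T"
    then show ?thesis using cell_less[of "?t + 1" T ?p] q unfolding off_def by simp
  qed (use qQ in \<open>simp add: off_def\<close>)
qed

end

definition outs :: "nat \<Rightarrow> bool list" where
  "outs n = (if n = 1 then [False] else if n = 2 then [True] else [])"

text \<open>After the first blank only blanks follow, so dropping blanks shifts no other
  symbol.\<close>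

lemma string_tape_outs:
  fixes f :: "nat \<Rightarrow> nat"
  assumes "\<And>i. i < N \<Longrightarrow> f i \<le> 2" "\<And>i. Suc i < N \<Longrightarrow> f i = 0 \<Longrightarrow> f (Suc i) = 0"
  defines "w \<equiv> \<lambda>n. concat (map (\<lambda>i. outs (f i)) [0..<n])"
  shows "i < N \<Longrightarrow> string_tape (w N) (int i) = f i"
proof -
  have mono: "f j = 0" if "f i = 0" "i \<le> j" "j < N" for i j
    using that(2,1,3) by (induction rule: dec_induct) (auto intro: assms(2))
  have inv: "n \<le> N \<Longrightarrow> length (w n) \<le> n \<and> ((\<forall>i<n. f i \<noteq> 0) \<longrightarrow> length (w n) = n) \<and>
      (\<forall>i<n. string_tape (w n) (int i) = f i)" for n
  proof (induction n)
    case (Suc n)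
    have IH: "length (w n) \<le> n" "(\<forall>i<n. f i \<noteq> 0) \<longrightarrow> length (w n) = n" "\<forall>i<n. string_tape (w n) (int i) = f i"
      using Suc by auto
    have w: "w (Suc n) = w n @ outs (f n)" by (simp add: w_def)
    show ?case
    proof (cases "f n = 0")
      case True
      then have "w (Suc n) = w n" using w by (simp add: outs_def)
      moreover have "string_tape (w n) (int n) = 0" using IH(1) by (simp add: string_tape_def)
      ultimately show ?thesis using IH True by (auto simp: less_Suc_eq)
    next
      case False
      then have "\<forall>i<n. f i \<noteq> 0" using mono[of _ n] Suc.prems less_imp_le Suc_le_lessD by metis
      then have l: "length (w n) = n" using IH by blast
      obtain b where b: "outs (f n) = [b]" "f n = (if b then 2 else 1)"
        using False assms(1)[of n] Suc.prems unfolding outs_def by (cases "f n = 1") auto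
      have "string_tape (w n @ [b]) (int i) = f i" if "i < Suc n" for i
        using IH(3) that l b(2) by (cases "i = n") (auto simp: string_tape_def nth_append)
      then show ?thesis using l b(1) w by auto
    qed
  qed (simp add: w_def)
  show "i < N \<Longrightarrow> string_tape (w N) (int i) = f i" using inv[of N] by blast
qed

context tableau
begin

lemma tile_syms: "s < K \<Longrightarrow> tq s \<le> tm_states M \<and> tr s \<in> syms \<and> ta s \<in> syms \<and> tb s \<in> syms \<and> tc s \<in> syms"
proof -
  assume "s < K"
  then have "tile_of s \<in> tile_of ` {..<K}" by simp
  then show ?thesis unfolding tiles by (auto simp: tq_def tr_def ta_def tb_def tc_def syms_def)
qed

lemma tile_ex:
  assumes "q \<le> tm_states M" "r \<in> syms" "a \<in> syms" "b \<in> syms" "c \<in> syms"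
  shows "\<exists>s<K. tq s = q \<and> tr s = r \<and> ta s = a \<and> tb s = b \<and> tc s = c"
proof -
  have "(q, r, a, b, c) \<in> tile_of ` {..<K}" unfolding tiles using assms by (simp add: syms_def)
  then obtain s where "s < K" "tile_of s = (q, r, a, b, c)" by force
  then show ?thesis by (intro exI[of _ s]) (simp add: tq_def tr_def ta_def tb_def tc_def)
qed

text \<open>Exactly one value \<open>s\<close> of a cell is selected, so concatenating over all
  values returns its symbol; this turns the decoding into plain loops.\<close>

definition witness :: "nat \<Rightarrow> (nat \<Rightarrow> bool) \<Rightarrow> bool list" where
  "witness T A = concat (map (\<lambda>i. concat (map (\<lambda>s. if A ((2 * T + i) * K + s) then outs (tb s ! 1) else []) [0..<K])) [0..<2 * T + 1])"

lemma concat_unique: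
  assumes "s < n" "P s" "\<And>s'. s' < n \<Longrightarrow> P s' \<Longrightarrow> s' = s"
  shows "concat (map (\<lambda>s. if P s then g s else []) [0..<n]) = g s"
proof -
  have "concat (map (\<lambda>s'. if P s' then g s' else []) [0..<n]) =
      concat (map (\<lambda>s'. if s' = s then g s else []) [0..<n])"
  proof (rule arg_cong[of _ _ concat], rule map_cong[OF refl])
    fix s' assume "s' \<in> set [0..<n]"
    then have "P s' \<longleftrightarrow> s' = s" using assms(2) assms(3)[of s'] by (simp only: set_upt atLeastLessThan_iff) blast
    then show "(if P s' then g s' else []) = (if s' = s then g s else [])" by simp
  qed
  also have "\<dots> = g s" using assms(1)
  proof (induction n)
    case (Suc n)
    have "concat (map (\<lambda>s'. if s' = s then g s else []) [0..<s]) = []" by simp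
    with Suc show ?case by (cases "s = n") auto
  qed simp
  finally show ?thesis .
qed

lemma ini_string_tape:
  assumes "\<not> forb x T 0 p q 0 s s" "q < (T + 1) * (4 * T + 1)"
  shows "s \<in> Ini (string_tape x (int p - 2 * int T))"
proof -
  consider "p < 2 * T" | "2 * T \<le> p" "p - 2 * T < length x" | "2 * T \<le> p" "length x \<le> p - 2 * T" by linarith
  then show ?thesis
  proof cases
    case 1
    then have "string_tape x (int p - 2 * int T) = 0" by (simp add: string_tape_def)
    with assms 1 show ?thesis unfolding forb_def by simp
  next
    case 2
    then have "string_tape x (int p - 2 * int T) = (if x ! (p - 2 * T) then 2 else 1)"
      by (simp add: string_tape_def nat_diff_distrib' nat_mult_distrib)
    with assms 2 show ?thesis unfolding forb_def by (cases "x ! (p - 2 * T)") simp_all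
  next
    case 3
    then have "string_tape x (int p - 2 * int T) = 0" by (simp add: string_tape_def)
    with assms 3 show ?thesis unfolding forb_def by simp
  qed
qed

lemma forb_2_iff:
  "forb x T t p q 2 s s' \<longleftrightarrow> q < (T + 1) * (4 * T + 1) \<and> t < T \<and> (s, s') \<notin> Ver (clip (int p - 2 * int T))"
proof -
  have "clip (int p - 2 * int T) = (if p + 1 = 2 * T then - 1 else if p = 2 * T then 0 else if p = 2 * T + 1 then 1 else 2)"
    unfolding clip_def by auto
  then show ?thesis unfolding forb_def by auto
qed

lemma tableau_sound:
  assumes T: "0 < T" and cs: "csp.csp_sat ((T + 1) * (4 * T + 1)) K (off T) (forb' x T) A"
  defines "y \<equiv> witness T A"
  shows "fst (cfg x y T) = tm_states M" "\<And>p. \<bar>p\<bar> \<le> int T \<Longrightarrow> col (cfg x y T) p ! 0 \<noteq> 1"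
proof -
  define W where "W = 4 * T + 1"
  define Q where "Q = (T + 1) * W"
  have exec: "\<And>q. q < Q \<Longrightarrow> \<exists>s<K. A (q * K + s)"
    and nf: "\<And>q o' s s'. q < Q \<Longrightarrow> o' < 4 \<Longrightarrow> s < K \<Longrightarrow> s' < K \<Longrightarrow> forb' x T q o' s s' \<Longrightarrow>
       A (q * K + s) \<Longrightarrow> A ((q + off T o') * K + s') \<Longrightarrow> False"
    using cs unfolding csp.csp_sat_def[OF csp] Q_def W_def by blast+
  \<comment> \<open>A cell has some value by its clause, and only one because offset 0 forbids two
    different values.\<close>
  define sel where "sel q = (SOME s. s < K \<and> A (q * K + s))" for q
  have sel: "sel q < K" "A (q * K + sel q)" if "q < Q" for q
    using someI_ex[of "\<lambda>s. s < K \<and> A (q * K + s)"] exec[OF that] unfolding sel_def by blast+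
  have off0: "off T 0 = 0" "off T 1 = 1" "off T 2 = W" by (simp_all add: off_def W_def)
  have uniq: "s = sel q" if q: "q < Q" and s: "s < K" "A (q * K + s)" for q s
  proof (rule ccontr)
    assume "s \<noteq> sel q"
    then have "forb' x T q 0 s (sel q)" using q unfolding forb'_def forb_def Q_def W_def by blast
    from nf[OF q _ s(1) sel(1)[OF q] this s(2)] sel(2)[OF q] off0 show False by simp
  qed
  define S where "S t p = sel (t * W + p)" for t p
  have cell: "t * W + p < Q" if "t \<le> T" "p < W" for t p using cell_less[of t T p] that unfolding Q_def W_def by simp
  have SK: "S t p < K" if "t \<le> T" "p < W" for t p using sel(1) cell that unfolding S_def by blast
  have nfS: "\<not> forb x T t p (t * W + p) o' (S t p) (sel (t * W + p + off T o'))" if "t \<le> T" "p < W" for t p o'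
  proof
    assume f: "forb x T t p (t * W + p) o' (S t p) (sel (t * W + p + off T o'))"
    then have f': "forb' x T (t * W + p) o' (S t p) (sel (t * W + p + off T o'))"
      using cell_code[of p T t] that unfolding forb'_def W_def by simp
    then have "o' < 3" "t * W + p + off T o' < Q" using csp.forb[OF csp f'] unfolding Q_def W_def by auto
    then show False using nf[OF cell[OF that] _ SK[OF that] sel(1) f'] sel(2) cell[OF that] unfolding S_def by simp
  qed
  have n0: "\<not> forb x T t p (t * W + p) 0 (S t p) (S t p)" if "t \<le> T" "p < W" for t p
    using nfS[OF that, of 0] unfolding off0 S_def by simp
  have n1: "\<not> forb x T t p (t * W + p) 1 (S t p) (S t (p + 1))" if "t \<le> T" "p < W" for t p
    using nfS[OF that, of 1] unfolding off0 S_def by (simp add: add.assoc)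
  have n2: "\<not> forb x T t p (t * W + p) 2 (S t p) (S (t + 1) p)" if "t \<le> T" "p < W" for t p
    using nfS[OF that, of 2] unfolding off0 S_def by (simp add: add.assoc add.commute[of W])
  have QW: "Q = (T + 1) * (4 * T + 1)" by (simp add: Q_def W_def)
  have ini: "S 0 p \<in> Ini (string_tape x (int p - 2 * int T))" if "p < W" for p
    using ini_string_tape n0[of 0 p] cell[of 0 p] that QW by simp
  have blk: "S 0 p \<in> Blk" if "p < 2 * T" for p
    using n0[of 0 p] cell[of 0 p] that unfolding forb_def QW W_def by simp
  have cen: "S t (2 * T) \<in> Cen" if "t \<le> T" for t
    using n0[of t "2 * T"] cell[of t "2 * T"] that unfolding forb_def QW W_def by simp
  have fin: "S T p \<in> Fin" if "p < W" for p
    using n0[of T p] cell[of T p] that unfolding forb_def QW by simp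
  have hor: "(S t p, S t (p + 1)) \<in> Hor" if "t \<le> T" "p < 4 * T" for t p
    using n1[of t p] cell[of t p] that unfolding forb_def QW W_def by simp
  have blkm: "S 0 (p + 1) \<in> Blk" if "2 * T \<le> p" "p < 4 * T" "S 0 p \<in> Blk" for p
    using n1[of 0 p] cell[of 0 p] that unfolding forb_def QW W_def by simp
  have ver: "(S t p, S (t + 1) p) \<in> Ver (clip (int p - 2 * int T))" if "t < T" "p < W" for t p
    using n2[of t p] that cell[of t p] unfolding QW forb_2_iff by simp
  have row: "tq (S t p) = tq (S t 0) \<and> tr (S t p) = tr (S t 0)" if "t \<le> T" "p < W" for t p
    using that(2)
  proof (induction p)
    case (Suc p)
    then show ?case using hor[OF that(1), of p] unfolding W_def Hor_def by auto
  qed simp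
  have reads: "tr (S t p) = tb (S t (2 * T))" if "t \<le> T" "p < W" for t p
    using row[OF that] row[OF that(1), of "2 * T"] cen[OF that(1)] unfolding Cen_def W_def by simp
  have y: "y = concat (map (\<lambda>i. outs (tb (S 0 (2 * T + i)) ! 1)) [0..<2 * T + 1])"
    unfolding y_def witness_def
  proof (rule arg_cong[of _ _ concat], rule map_cong[OF refl])
    fix i assume "i \<in> set [0..<2 * T + 1]"
    then have "i < 2 * T + 1" by (simp only: set_upt atLeastLessThan_iff)
    then have q: "2 * T + i < Q" using cell[of 0 "2 * T + i"] by (simp add: W_def)
    show "concat (map (\<lambda>s. if A ((2 * T + i) * K + s) then outs (tb s ! 1) else []) [0..<K]) = outs (tb (S 0 (2 * T + i)) ! 1)"
      unfolding S_def mult_0 add_0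
      by (rule concat_unique[where P = "\<lambda>s. A ((2 * T + i) * K + s)", OF sel[OF q] uniq[OF q]])
  qed
  have ytape: "string_tape y (int i) = tb (S 0 (2 * T + i)) ! 1" if "i < 2 * T + 1" for i
    unfolding y
  proof (rule string_tape_outs[of "2 * T + 1" "\<lambda>i. tb (S 0 (2 * T + i)) ! 1"])
    fix i assume "i < 2 * T + 1"
    then show "tb (S 0 (2 * T + i)) ! 1 \<le> 2" using ini[of "2 * T + i"] by (simp add: Ini_def W_def)
  next
    fix i assume "Suc i < 2 * T + 1" "tb (S 0 (2 * T + i)) ! 1 = 0"
    then show "tb (S 0 (2 * T + Suc i)) ! 1 = 0"
      using blkm[of "2 * T + i"] SK[of 0 "2 * T + i"] by (simp add: Blk_def W_def)
  qed (rule that)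
  \<comment> \<open>Beyond the outer columns nothing is constrained, so the trusted region loses one
    column on each side per step. From \<open>2 * T\<close> columns on each side, \<open>T\<close>
    survive after \<open>T\<close> steps; this still covers the output cell, since a head moves at
    most \<open>T\<close> cells from the origin.\<close>
  have main: "t \<le> T \<Longrightarrow> (\<forall>p<W. tq (S t p) = fst (cfg x y t)) \<and>
     (\<forall>p<W. \<bar>int p - 2 * int T\<bar> \<le> 2 * int T - int t \<longrightarrow> tb (S t p) = col (cfg x y t) (int p - 2 * int T))" for t
  proof (induction t)
    case 0
    have "tb (S 0 p) = col (cfg x y 0) (int p - 2 * int T)" if p: "p < W" for p
    proof (rule nth_equalityI)
      have l: "length (tb (S 0 p)) = tm_tapes M" using tile_syms[OF SK[of 0 p]] p by (simp add: syms_def)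
      then show "length (tb (S 0 p)) = length (col (cfg x y 0) (int p - 2 * int T))" by (simp add: col_0)
      fix j assume "j < length (tb (S 0 p))"
      then have j: "j < tm_tapes M" using l by simp
      consider "j = 0" | "j = 1" "p < 2 * T" | "j = 1" "2 * T \<le> p" | "2 \<le> j" by linarith
      then show "tb (S 0 p) ! j = col (cfg x y 0) (int p - 2 * int T) ! j"
      proof cases
        case 1
        then show ?thesis using ini[OF p] j by (simp add: col_0 Ini_def)
      next
        case 2
        then show ?thesis using blk[of p] j by (simp add: col_0 Blk_def string_tape_def)
      next
        case 3
        then show ?thesis using ytape[of "p - 2 * T"] j p by (simp add: col_0 W_def of_nat_diff)
      next
        case 4
        then show ?thesis using ini[OF p] j by (simp add: col_0 Ini_def string_tape_def)
      qed
    qed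
    moreover have "fst (cfg x y 0) = 0" by (simp add: cfg_def tm_init_def)
    ultimately show ?case using ini by (simp add: Ini_def)
  next
    case (Suc t)
    then have t: "t < T" and IHq: "\<And>p. p < W \<Longrightarrow> tq (S t p) = fst (cfg x y t)"
      and IHb: "\<And>p. p < W \<Longrightarrow> \<bar>int p - 2 * int T\<bar> \<le> 2 * int T - int t \<Longrightarrow> tb (S t p) = col (cfg x y t) (int p - 2 * int T)"
      by auto
    have IHr: "tr (S t p) = col (cfg x y t) 0" if "p < W" for p
      using reads[of t p] IHb[of "2 * T"] t that by (simp add: W_def)
    have "tq (S (Suc t) p) = fst (cfg x y (Suc t))" if p: "p < W" for p
      using ver[OF t p] IHq[OF p] IHr[OF p] step(2)[OF cfg_valid, of x y t] by (simp add: Ver_def cfg_Suc)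
    moreover have "tb (S (Suc t) p) = col (cfg x y (Suc t)) (int p - 2 * int T)"
      if p: "p < W" and d: "\<bar>int p - 2 * int T\<bar> \<le> 2 * int T - int (Suc t)" for p
    proof -
      have p1: "0 < p" "p < 4 * T" using d t by auto
      have "ta (S t p) = tb (S t (p - 1))" "tc (S t p) = tb (S t (p + 1))"
        using hor[of t "p - 1"] hor[of t p] p1 t by (auto simp: Hor_def)
      moreover have "tb (S t (p - 1)) = col (cfg x y t) (int p - 2 * int T - 1)"
        using IHb[of "p - 1"] p1 p d by (simp add: of_nat_diff algebra_simps)
      moreover have "tb (S t (p + 1)) = col (cfg x y t) (int p - 2 * int T + 1)"
        using IHb[of "p + 1"] p1 d by (simp add: W_def algebra_simps)
      moreover have "tb (S t p) = col (cfg x y t) (int p - 2 * int T)" using IHb[OF p] d by simp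
      ultimately show ?thesis
        using ver[OF t p] IHq[OF p] IHr[OF p] step(3)[OF cfg_valid, of x y t "int p - 2 * int T"]
        by (simp add: Ver_def cfg_Suc)
    qed
    ultimately show ?case by blast
  qed
  have W0: "2 * T < W" by (simp add: W_def)
  show "fst (cfg x y T) = tm_states M" using main[of T] fin[OF W0] W0 by (auto simp: Fin_def)
  fix p :: int assume p: "\<bar>p\<bar> \<le> int T"
  let ?p = "nat (p + 2 * int T)"
  have "?p < W" "int ?p - 2 * int T = p" using p by (auto simp: W_def)
  then show "col (cfg x y T) p ! 0 \<noteq> 1" using main[of T] fin[of ?p] p by (auto simp: Fin_def)
qed

text \<open>Every cell receives a tile describing the actual configuration at its time and position.
  Each such tile is an entry of the enumeration, and horizontal and vertical constraints hold
  because neighbouring tiles describe the same run.\<close>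

lemma tableau_complete:
  assumes halt: "fst (cfg x y T) = tm_states M" and acc: "\<And>p. col (cfg x y T) p ! 0 \<noteq> 1"
  shows "\<exists>A. csp.csp_sat ((T + 1) * (4 * T + 1)) K (off T) (forb' x T) A"
proof -
  define W where "W = 4 * T + 1"
  have Wp: "0 < W" by (simp add: W_def)
  have "\<exists>s<K. tq s = fst (cfg x y t) \<and> tr s = col (cfg x y t) 0 \<and> ta s = col (cfg x y t) (p - 1) \<and>
      tb s = col (cfg x y t) p \<and> tc s = col (cfg x y t) (p + 1)" for t p
    by (rule tile_ex) (use cfg_valid[of x y t] col_syms in \<open>auto simp: valid_def\<close>)
  then obtain \<tau> where \<tau>: "\<And>t p. \<tau> t p < K" "\<And>t p. tq (\<tau> t p) = fst (cfg x y t)" "\<And>t p. tr (\<tau> t p) = col (cfg x y t) 0"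
     "\<And>t p. ta (\<tau> t p) = col (cfg x y t) (p - 1)" "\<And>t p. tb (\<tau> t p) = col (cfg x y t) p"
     "\<And>t p. tc (\<tau> t p) = col (cfg x y t) (p + 1)"
    by metis
  define S where "S q = \<tau> (q div W) (int (q mod W) - 2 * int T)" for q
  define A where "A u \<longleftrightarrow> u mod K = S (u div K)" for u
  have A: "A (q * K + s) \<longleftrightarrow> s = S q" if "s < K" for q s using that by (simp add: A_def)
  have SK: "S q < K" for q by (simp add: S_def \<tau>)
  have ini: "S q \<in> Ini \<sigma>" if "q div W = 0" "\<sigma> = string_tape x (int (q mod W) - 2 * int T)" for q \<sigma>
    using that tapes2 SK[of q] unfolding S_def Ini_def
    by (auto simp: \<tau> col_0 string_tape_def) (simp_all add: cfg_def tm_init_def)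
  have ver: "(S q, S (q + W)) \<in> Ver (clip (int (q mod W) - 2 * int T))" for q
  proof -
    have "S (q + W) = \<tau> (Suc (q div W)) (int (q mod W) - 2 * int T)" using Wp unfolding S_def by simp
    then show ?thesis
      unfolding Ver_def S_def using step(2,3)[OF cfg_valid, of x y "q div W"] by (simp add: \<tau> cfg_Suc)
  qed
  have hor: "(S q, S (q + 1)) \<in> Hor" "q div W = 0 \<Longrightarrow> 2 * T \<le> q mod W \<Longrightarrow> S q \<in> Blk \<Longrightarrow> S (q + 1) \<in> Blk"
    if "q mod W < 4 * T" for q
  proof -
    have "Suc (q mod W) \<noteq> W" using that by (simp add: W_def)
    then have e: "(q + 1) div W = q div W" "(q + 1) mod W = q mod W + 1"
      by (simp_all add: div_Suc mod_Suc)
    then have S1: "S (q + 1) = \<tau> (q div W) (int (q mod W) + 1 - 2 * int T)" unfolding S_def by (simp add: add.commute)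
    then show "(S q, S (q + 1)) \<in> Hor" unfolding Hor_def S_def by (simp add: \<tau> algebra_simps)
    show "S (q + 1) \<in> Blk" if "q div W = 0" "2 * T \<le> q mod W" "S q \<in> Blk"
      using that S1 tapes2 unfolding Blk_def S_def by (auto simp: \<tau> col_0 string_tape_def split: if_splits)
  qed
  have blk: "S q \<in> Blk" if "q div W = 0" "q mod W < 2 * T" for q
    using that tapes2 unfolding Blk_def S_def by (simp add: \<tau> col_0 string_tape_def)
  have cen: "S q \<in> Cen" if "q mod W = 2 * T" for q using that unfolding Cen_def S_def by (simp add: \<tau>)
  have fin: "S q \<in> Fin" if "q div W = T" for q
    using that halt acc unfolding Fin_def S_def by (simp add: \<tau>)
  have "\<not> forb' x T q o' (S q) (S (q + off T o'))" for q o'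
  proof
    let ?t = "q div W" and ?p = "q mod W"
    assume "forb' x T q o' (S q) (S (q + off T o'))"
    then have f: "forb x T ?t ?p q o' (S q) (S (q + off T o'))" unfolding forb'_def W_def .
    have "o' = 0 \<or> o' = 1 \<and> ?p < 4 * T \<or> o' = 2 \<and> ?t < T" using f unfolding forb_def by blast
    then show False
    proof (elim disjE conjE)
      assume o: "o' = 0"
      have i: "int ?p - 2 * int T = int (?p - 2 * T)" if "2 * T \<le> ?p" using that by simp
      have 2: "S q \<in> Ini 2" if "?t = 0" "2 * T \<le> ?p" "?p - 2 * T < length x" "x ! (?p - 2 * T)"
        by (rule ini) (use that i[OF that(2)] in \<open>simp_all add: string_tape_def del: of_nat_diff\<close>)
      have 1: "S q \<in> Ini 1" if "?t = 0" "2 * T \<le> ?p" "?p - 2 * T < length x" "\<not> x ! (?p - 2 * T)"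
        by (rule ini) (use that i[OF that(2)] in \<open>simp_all add: string_tape_def del: of_nat_diff\<close>)
      have 0: "S q \<in> Ini 0" if "?t = 0" "?p < 2 * T \<or> length x \<le> ?p - 2 * T"
        by (rule ini) (use that in \<open>auto simp: string_tape_def\<close>)
      show False using f 0 1 2 blk[of q] cen[of q] fin[of q] unfolding o forb_def off_def by auto
    next
      assume o: "o' = 1" and p: "?p < 4 * T"
      show False using f hor[OF p] unfolding o forb_def off_def by auto
    next
      assume o: "o' = 2"
      have W: "off T 2 = W" by (simp add: off_def W_def)
      show False using f ver[of q] unfolding o W forb_2_iff by blast
    qed
  qed
  then have "csp.csp_sat ((T + 1) * (4 * T + 1)) K (off T) (forb' x T) A"
    unfolding csp.csp_sat_def[OF csp] using A SK by metis
  then show ?thesis by blast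
qed

text \<open>
  The final tape content is that of the one-symbol output; so the computation accepts iff the symbol
  for the bit False does not occur on the first tape.
\<close>

lemma accept_iff:
  assumes "tm_computes_within M [x, y] [b] B" "fst (cfg x y T) = tm_states M"
  shows "\<not> b \<Longrightarrow> \<exists>p. \<bar>p\<bar> \<le> int T \<and> col (cfg x y T) p ! 0 = 1" "b \<Longrightarrow> col (cfg x y T) p ! 0 \<noteq> 1"
proof -
  obtain t where t: "fst (cfg x y t) = tm_states M" "fst (hd (snd (cfg x y t))) = string_tape [b]"
    using assms(1) unfolding tm_computes_within_def cfg_def by (auto simp: case_prod_beta)
  have eq: "cfg x y T = cfg x y t" using halted_eq[OF t(1) assms(2)] .
  have l: "length (snd (cfg x y T)) = tm_tapes M" using cfg_valid[of x y T] by (simp add: valid_def)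
  have "snd (cfg x y T) \<noteq> []" using l tapes2 by auto
  then have h: "fst (snd (cfg x y T) ! 0) = string_tape [b]" using t(2) eq by (simp add: hd_conv_nth)
  have c: "col (cfg x y T) p ! 0 = string_tape [b] (snd (snd (cfg x y T) ! 0) + p)" for p
    using col_nth[OF cfg_valid, of 0 x y T p] tapes2 h by simp
  show "\<exists>p. \<bar>p\<bar> \<le> int T \<and> col (cfg x y T) p ! 0 = 1" if "\<not> b"
    using cfg_head[of 0 x y T] tapes2 that
    by (intro exI[of _ "- snd (snd (cfg x y T) ! 0)"]) (simp add: c string_tape_def)
  show "col (cfg x y T) p ! 0 \<noteq> 1" if "b" using that by (auto simp: c string_tape_def)
qed

end

section \<open>The reduction\<close>

lemma unit_vecs_nonempty: "0 < d \<Longrightarrow> unit_vecs d \<noteq> {}"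
proof -
  assume "0 < d"
  then have "unit_vec d 0 \<in> unit_vecs d" by (simp add: unit_vecs_def)
  then show ?thesis by blast
qed

text \<open>A partial sum lies between 0 and the full sum 1. The bound makes the real supremum in
  \<open>KS2_W\<close> an actual upper bound of its values.\<close>

lemma discrepancy_le:
  assumes "KS2_instance d \<alpha> I" "S \<subseteq> I" "x \<in> unit_vecs d"
  shows "\<bar>(\<Sum>v\<in>S. (v \<bullet> x)\<^sup>2) - 1 / 2\<bar> \<le> 1 / 2"
proof -
  have "finite I" "(\<Sum>v\<in>I. (v \<bullet> x)\<^sup>2) = 1" using assms unfolding KS2_instance_def by auto
  then have "(\<Sum>v\<in>S. (v \<bullet> x)\<^sup>2) \<le> 1" using sum_mono2[of I S "\<lambda>v. (v \<bullet> x)\<^sup>2"] assms(2) by auto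
  moreover have "0 \<le> (\<Sum>v\<in>S. (v \<bullet> x)\<^sup>2)" by (intro sum_nonneg) auto
  ultimately show ?thesis by linarith
qed

lemma discrepancy_le_SUP:
  assumes "KS2_instance d \<alpha> I" "S \<subseteq> I" "x \<in> unit_vecs d"
  shows "\<bar>(\<Sum>v\<in>S. (v \<bullet> x)\<^sup>2) - 1 / 2\<bar> \<le> (SUP x \<in> unit_vecs d. \<bar>(\<Sum>v\<in>S. (v \<bullet> x)\<^sup>2) - 1 / 2\<bar>)"
  using discrepancy_le[OF assms(1,2)] by (intro cSUP_upper[OF assms(3)] bdd_aboveI2)

lemma KS2_W_eq_0:
  assumes I: "KS2_instance d \<alpha> I" and S: "S \<subseteq> I" "\<And>x. x \<in> unit_vecs d \<Longrightarrow> (\<Sum>v\<in>S. (v \<bullet> x)\<^sup>2) = 1 / 2"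
  shows "KS2_W d I = 0"
  unfolding KS2_W_def
proof (rule Min_eqI)
  have ne: "unit_vecs d \<noteq> {}" using unit_vecs_nonempty I unfolding KS2_instance_def by blast
  show "finite ((\<lambda>S. SUP x \<in> unit_vecs d. \<bar>(\<Sum>v\<in>S. (v \<bullet> x)\<^sup>2) - 1 / 2\<bar>) ` Pow I)"
    using I unfolding KS2_instance_def by simp
  have "(SUP x \<in> unit_vecs d. \<bar>(\<Sum>v\<in>S. (v \<bullet> x)\<^sup>2) - 1 / 2\<bar>) = (SUP x \<in> unit_vecs d. 0)"
    by (rule SUP_cong[OF refl]) (simp only: S(2) diff_self abs_zero)
  then have "(SUP x \<in> unit_vecs d. \<bar>(\<Sum>v\<in>S. (v \<bullet> x)\<^sup>2) - 1 / 2\<bar>) = 0" using ne by simp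
  then show "0 \<in> (\<lambda>S. SUP x \<in> unit_vecs d. \<bar>(\<Sum>v\<in>S. (v \<bullet> x)\<^sup>2) - 1 / 2\<bar>) ` Pow I"
    by (intro rev_image_eqI[of S]) (use S(1) in \<open>simp_all only: Pow_iff\<close>)
  fix w assume "w \<in> (\<lambda>S. SUP x \<in> unit_vecs d. \<bar>(\<Sum>v\<in>S. (v \<bullet> x)\<^sup>2) - 1 / 2\<bar>) ` Pow I"
  then obtain S' where "S' \<subseteq> I" "w = (SUP x \<in> unit_vecs d. \<bar>(\<Sum>v\<in>S'. (v \<bullet> x)\<^sup>2) - 1 / 2\<bar>)" by auto
  moreover obtain x where "x \<in> unit_vecs d" using ne by blast
  ultimately have "\<bar>(\<Sum>v\<in>S'. (v \<bullet> x)\<^sup>2) - 1 / 2\<bar> \<le> w" using discrepancy_le_SUP[OF I, of S' x] by simp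
  then show "0 \<le> w" by (rule order_trans[OF abs_ge_zero])
qed

lemma KS2_W_ge:
  assumes I: "KS2_instance d \<alpha> I" and no: "\<And>S. \<not> KS2_solution c d \<alpha> I S"
  shows "c * sqrt \<alpha> \<le> KS2_W d I"
  unfolding KS2_W_def
proof (rule Min.boundedI)
  show "finite ((\<lambda>S. SUP x \<in> unit_vecs d. \<bar>(\<Sum>v\<in>S. (v \<bullet> x)\<^sup>2) - 1 / 2\<bar>) ` Pow I)"
    using I unfolding KS2_instance_def by simp
  fix w assume "w \<in> (\<lambda>S. SUP x \<in> unit_vecs d. \<bar>(\<Sum>v\<in>S. (v \<bullet> x)\<^sup>2) - 1 / 2\<bar>) ` Pow I"
  then obtain S where S: "S \<subseteq> I" "w = (SUP x \<in> unit_vecs d. \<bar>(\<Sum>v\<in>S. (v \<bullet> x)\<^sup>2) - 1 / 2\<bar>)" by auto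
  then obtain x where "x \<in> unit_vecs d" "c * sqrt \<alpha> < \<bar>(\<Sum>v\<in>S. (v \<bullet> x)\<^sup>2) - 1 / 2\<bar>"
    using no[of S] unfolding KS2_solution_def by (auto simp: not_le)
  then show "c * sqrt \<alpha> \<le> w" using discrepancy_le_SUP[OF I S(1), of x] S(2) by simp
qed auto

lemma KS2_rel_of_solution:
  assumes "KS2_code d \<alpha> vs" "KS2_solution c d (of_rat \<alpha>) (real_vec ` set vs) S"
  shows "\<exists>z. KS2_rel c (enc_KS2 \<alpha> vs) z"
proof -
  define z where "z = map (\<lambda>i. real_vec (vs ! i) \<in> S) [0..<length vs]"
  have "S \<subseteq> real_vec ` set vs" using assms(2) unfolding KS2_solution_def by blast
  then have sub: "\<exists>i<length vs. v = real_vec (vs ! i)" if "v \<in> S" for v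
    using that by (force simp: in_set_conv_nth)
  have "S = {real_vec (vs ! i) | i. i < length vs \<and> z ! i}"
  proof (intro equalityI subsetI)
    fix v assume v: "v \<in> S"
    then obtain i where "i < length vs" "v = real_vec (vs ! i)" using sub by blast
    with v show "v \<in> {real_vec (vs ! i) | i. i < length vs \<and> z ! i}" by (auto simp: z_def)
  qed (auto simp: z_def)
  then have "KS2_rel c (enc_KS2 \<alpha> vs) z" unfolding KS2_rel_def
    using assms by (intro exI[of _ d] exI[of _ \<alpha>] exI[of _ vs]) (simp add: z_def)
  then show ?thesis by blast
qed

context ks_gadget
begin

lemma KS2_rel_good:
  assumes "KS2_rel (1 / (4 * sqrt 2)) (enc_KS2 (13 / 36) vs) z"
  obtains s where "good s" "\<And>e. e < E \<Longrightarrow> s e = z ! (5 * e)" "length z = 5 * E + C"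
proof -
  let ?S = "{real_vec (vs ! i) | i. i < length vs \<and> z ! i}"
  obtain d where d: "KS2_code d (13 / 36) vs" "length z = length vs"
    "KS2_solution (1 / (4 * sqrt 2)) d (of_rat (13 / 36)) (real_vec ` set vs) ?S"
    using assms unfolding KS2_rel_def enc_KS2_inject by blast
  \<comment> \<open>The relation hides the dimension behind an existential quantifier; any single
    vector of the instance recovers it.\<close>
  have "rv 0 \<in> real_vec ` set vs" unfolding real_vs_set using C_pos by simp
  then have "rv 0 \<in> carrier_vec d" using d(1) unfolding KS2_code_def KS2_instance_def by blast
  then have "d = E + C" using rv_dim[of 0] by (metis carrier_vecD)
  then have "KS2_solution (1 / (4 * sqrt 2)) (E + C) (13 / 36) (real_vec ` set vs) ?S"
    using d(3) by (simp add: of_rat_divide)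
  from sound[OF this] have "good (\<lambda>e. rv (5 * e) \<in> ?S)" .
  moreover have "rv r \<in> ?S \<longleftrightarrow> z ! r" if r: "r < 5 * E + C" for r
  proof -
    have "?S = (\<lambda>i. real_vec (vs ! i)) ` {i. i < 5 * E + C \<and> z ! i}" unfolding vs_length by blast
    also have "\<dots> = rv ` {i. i < 5 * E + C \<and> z ! i}" by (rule image_cong) (simp_all add: real_vs)
    finally have "?S = rv ` {i. i < 5 * E + C \<and> z ! i}" .
    then show ?thesis using rv_inj r unfolding inj_on_def by auto
  qed
  ultimately show ?thesis using that[of "\<lambda>e. rv (5 * e) \<in> ?S"] d(2) by (simp add: vs_length)
qed

lemma solution_of_good:
  assumes "good s"
  shows "\<exists>S. KS2_solution (1 / (4 * sqrt 2)) (E + C) (of_rat (13 / 36)) (real_vec ` set vs) S"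
    "KS2_W (E + C) (real_vec ` set vs) = 0"
proof -
  obtain S where S: "S \<subseteq> real_vec ` set vs" "\<And>x. x \<in> unit_vecs (E + C) \<Longrightarrow> (\<Sum>v\<in>S. (v \<bullet> x)\<^sup>2) = 1 / 2"
    using complete[OF assms] by blast
  then show "\<exists>S. KS2_solution (1 / (4 * sqrt 2)) (E + C) (of_rat (13 / 36)) (real_vec ` set vs) S"
    unfolding KS2_solution_def
    by (intro exI[of _ S] conjI ballI S(1)) (simp only: S(2) diff_self abs_zero, simp add: of_rat_divide)
  show "KS2_W (E + C) (real_vec ` set vs) = 0"
    using KS2_W_eq_0[OF _ S] code unfolding KS2_code_def by blast
qed

end

lemma (in cnf) E_0: "0 < E" "u < U \<Longrightarrow> Suc (C + u) * L < E"
  using L_pos by (auto simp: E_def)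

context tableau
begin

definition nC :: "nat \<Rightarrow> nat" where "nC T = (T + 1) * (4 * T + 1) * 4 * K * K * K"
definition nE :: "nat \<Rightarrow> nat" where "nE T = Suc (nC T + (T + 1) * (4 * T + 1) * K) * (2 * nC T)"

definition inst :: "bool list \<Rightarrow> nat \<Rightarrow> rat vec list" where
  "inst x T = ks_vecs (nE T) (nC T) (nae_pi (nC T))
     (nae_tap (nC T) K (csp_var K (off T) (forb' x T)) (csp_bad K (forb' x T))) (nae_cl (nC T))"

text \<open>The bit of the first vector of copy 0 of variable \<open>Suc (nC T + u)\<close> is
  compared with that of element 0, which stands for falsity. The length tests make this total on
  arbitrary strings, in the shape handled by \<open>ppred_nth\<close>.\<close>

definition assignment :: "nat \<Rightarrow> bool list \<Rightarrow> nat \<Rightarrow> bool" where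
  "assignment T z u \<longleftrightarrow> \<not> ((5 * (Suc (nC T + u) * (2 * nC T)) < length z \<and> z ! (5 * (Suc (nC T + u) * (2 * nC T)))) \<longleftrightarrow>
     (0 < length z \<and> z ! 0))"

lemma inst_props:
  assumes T: "0 < T"
  shows "KS2_code (nE T + nC T) (13 / 36) (inst x T)"
    and "KS2_rel (1 / (4 * sqrt 2)) (enc_KS2 (13 / 36) (inst x T)) z \<Longrightarrow>
      fst (cfg x (witness T (assignment T z)) T) = tm_states M \<and>
      (\<forall>p. \<bar>p\<bar> \<le> int T \<longrightarrow> col (cfg x (witness T (assignment T z)) T) p ! 0 \<noteq> 1)"
    and "fst (cfg x y T) = tm_states M \<Longrightarrow> (\<And>p. col (cfg x y T) p ! 0 \<noteq> 1) \<Longrightarrow>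
      (\<exists>S. KS2_solution (1 / (4 * sqrt 2)) (nE T + nC T) (of_rat (13 / 36)) (real_vec ` set (inst x T)) S) \<and>
      KS2_W (nE T + nC T) (real_vec ` set (inst x T)) = 0"
proof -
  let ?Q = "(T + 1) * (4 * T + 1)"
  interpret P: csp ?Q K "off T" "forb' x T" by (rule csp)
  have C: "P.C = nC T" using P.C_def P.J_def by (simp only: nC_def)
  have L: "P.L = 2 * nC T" using P.L_def by (simp only: C)
  have E: "P.E = nE T" using P.E_def by (simp only: L C nE_def)
  interpret G: ks_gadget "nE T" "nC T" "nae_pi (nC T)" "nae_tap (nC T) K (csp_var K (off T) (forb' x T)) (csp_bad K (forb' x T))" "nae_cl (nC T)"
    using P.gadget unfolding C E .
  have vs: "G.vs = inst x T" unfolding inst_def ..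
  show "KS2_code (nE T + nC T) (13 / 36) (inst x T)" using G.code unfolding vs .
  show "(\<exists>S. KS2_solution (1 / (4 * sqrt 2)) (nE T + nC T) (of_rat (13 / 36)) (real_vec ` set (inst x T)) S) \<and>
      KS2_W (nE T + nC T) (real_vec ` set (inst x T)) = 0"
    if "fst (cfg x y T) = tm_states M" "\<And>p. col (cfg x y T) p ! 0 \<noteq> 1"
  proof -
    note h = that
    obtain A where "P.csp_sat A" using tableau_complete[OF h] by blast
    then obtain s where "G.good s" using P.good_of_sat[of A] P.sat_iff unfolding C E by blast
    from G.solution_of_good[OF this] show ?thesis unfolding vs by blast
  qed
  show "fst (cfg x (witness T (assignment T z)) T) = tm_states M \<and>
      (\<forall>p. \<bar>p\<bar> \<le> int T \<longrightarrow> col (cfg x (witness T (assignment T z)) T) p ! 0 \<noteq> 1)"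
    if "KS2_rel (1 / (4 * sqrt 2)) (enc_KS2 (13 / 36) (inst x T)) z"
  proof -
    note h = that
    obtain s where s: "G.good s" "\<And>e. e < nE T \<Longrightarrow> s e = z ! (5 * e)" "length z = 5 * nE T + nC T"
      using G.KS2_rel_good[unfolded vs, OF h] by blast
    define A where "A u \<longleftrightarrow> s (Suc (nC T + u) * (2 * nC T)) \<noteq> s 0" for u
    have "P.csp_sat A" using P.sat_of_good s(1) P.sat_iff unfolding C E L A_def by blast
    note snd = tableau_sound[OF T this]
    have "assignment T z u = A u" if "u < ?Q * K" for u
    proof -
      have "Suc (nC T + u) * (2 * nC T) < nE T" "0 < nE T" using P.E_0 that unfolding C E L by auto
      then show ?thesis using s(2,3) unfolding assignment_def A_def by simp
    qed
    moreover have "(2 * T + i) * K + k < ?Q * K" if "i < 2 * T + 1" "k < K" for i k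
    proof -
      have "2 * T + i < ?Q" using cell_less[of 0 T "2 * T + i"] that by simp
      then have "Suc (2 * T + i) * K \<le> ?Q * K" by (intro mult_le_mono1) simp
      moreover have "(2 * T + i) * K + k < Suc (2 * T + i) * K" using that by simp
      ultimately show ?thesis by (rule less_le_trans[rotated])
    qed
    ultimately have "witness T (assignment T z) = witness T A"
      unfolding witness_def by (intro arg_cong[of _ _ concat] map_cong refl) auto
    with snd show ?thesis by simp
  qed
qed

end

section \<open>Computability of instances and certificates\<close>

lemma pnum_length_of: "ptime n f \<Longrightarrow> pnum n (\<lambda>xs. length (f xs))"
  unfolding pnum_def
  by (rule ptime_cong[OF ptime_let[OF _ pnum_length[of n "Suc n", unfolded pnum_def]]])
     (auto simp: nth_append)

text \<open>Only finitely many rationals occur as entries, so encoding one is a choice among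
  constant words, without rational arithmetic.\<close>

lemma ptime_ks_entry:
  assumes "pnum n E" "pnum n r" "pnum n j" "pnum n (\<lambda>xs. \<pi> xs (r xs div 5))"
    "ppred n (\<lambda>xs. tap xs (r xs div 5))" "pnum n (\<lambda>xs. cl xs (r xs div 5))"
  shows "ptime n (\<lambda>xs. enc_rat (ks_entry (E xs) (\<pi> xs) (tap xs) (cl xs) (r xs) (j xs)))"
  unfolding ks_entry_def if_distrib[of enc_rat]
  by (intro ptime_if ptime_const ppred_intros pnum_intros assms)

lemma pnum_nae_cl: "pnum n C \<Longrightarrow> pnum n e \<Longrightarrow> pnum n (\<lambda>xs. nae_cl (C xs) (e xs))"
  unfolding nae_cl_def by (intro pnum_intros)

lemma pnum_nae_pi: "pnum n C \<Longrightarrow> pnum n e \<Longrightarrow> pnum n (\<lambda>xs. nae_pi (C xs) (e xs))"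
  unfolding nae_pi_def by (intro pnum_intros)

lemma ppred_nae_tap:
  assumes "pnum n C" "pnum n e" "pnum n (\<lambda>xs. lv xs (nae_cl (C xs) (e xs)))"
    "ppred n (\<lambda>xs. neg xs (nae_cl (C xs) (e xs)))"
  shows "ppred n (\<lambda>xs. nae_tap (C xs) K (lv xs) (neg xs) (e xs))"
  unfolding nae_tap_def by (intro ppred_intros pnum_intros pnum_nae_cl assms)

lemma pnum_csp_cell: "pnum n c \<Longrightarrow> pnum n (\<lambda>xs. csp_cell K (c xs))"
  unfolding csp_cell_def by (intro pnum_intros)

lemma ptime_enc_vecs:
  assumes "pnum 1 (\<lambda>xs. d (xs ! 0))" "pnum 1 (\<lambda>xs. m (xs ! 0))"
    and "ptime 3 (\<lambda>xs. enc_rat (a (xs ! 0) (length (xs ! 1)) (length (xs ! 2))))"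
  shows "ptime 1 (\<lambda>xs. enc_KS2 \<alpha> (map (\<lambda>r. vec (d (xs ! 0)) (a (xs ! 0) r)) [0..<m (xs ! 0)]))"
proof -
  have d2: "pnum 2 (\<lambda>xs. d (xs ! 0))"
    using pnum_take[OF assms(1)] by (simp add: numeral_2_eq_2)
  have "ptime 3 (\<lambda>xs. [True] @ enc_rat (a (xs ! 0) (length (xs ! 1)) (length (xs ! 2))))"
    by (rule ptime_append[OF ptime_const assms(3)])
  then have "ptime 2 (\<lambda>xs. concat (map (\<lambda>j. [True] @ enc_rat (a (xs ! 0) (length (xs ! 1)) j)) [0..<d (xs ! 0)]))"
    by (intro ptime_for[OF d2]) (simp add: numeral_3_eq_3 numeral_2_eq_2)
  then have "ptime 2 (\<lambda>xs. [True] @ concat (map (\<lambda>j. [True] @ enc_rat (a (xs ! 0) (length (xs ! 1)) j)) [0..<d (xs ! 0)]) @ [False])"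
    by (intro ptime_append ptime_const)
  then have "ptime 1 (\<lambda>xs. concat (map (\<lambda>r. [True] @ concat (map (\<lambda>j. [True] @ enc_rat (a (xs ! 0) r j)) [0..<d (xs ! 0)]) @ [False]) [0..<m (xs ! 0)]))"
    by (intro ptime_for[OF assms(2)]) (simp add: numeral_2_eq_2)
  then have "ptime 1 (\<lambda>xs. enc_rat \<alpha> @ concat (map (\<lambda>r. [True] @ concat (map (\<lambda>j. [True] @ enc_rat (a (xs ! 0) r j)) [0..<d (xs ! 0)]) @ [False]) [0..<m (xs ! 0)]) @ [False])"
    by (intro ptime_append ptime_const)
  then show ?thesis
    by (rule ptime_cong) (simp add: enc_KS2_def enc_list_def enc_vec_def comp_def)
qed

context tableau
begin

text \<open>The transitions of the machine enter the reduction only through these finite tables,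
  which are fixed before the input is seen; membership is then a finite disjunction of
  equalities.\<close>

lemma finite_tile_sets: "finite (Ini \<sigma>)" "finite Blk" "finite Cen" "finite Fin" "finite Hor" "finite (Ver p)"
proof -
  have *: "Hor \<subseteq> {..<K} \<times> {..<K}" "Ver p \<subseteq> {..<K} \<times> {..<K}" unfolding Hor_def Ver_def by auto
  show "finite Hor" "finite (Ver p)" by (rule finite_subset[OF *(1)], simp, rule finite_subset[OF *(2)], simp)
qed (simp_all add: Ini_def Blk_def Cen_def Fin_def)

lemma ppred_forb:
  assumes "ptime n x" "pnum n T" "pnum n q" "pnum n o'" "pnum n s" "pnum n s'"
  shows "ppred n (\<lambda>xs. forb' (x xs) (T xs) (q xs) (o' xs) (s xs) (s' xs))"
  unfolding forb'_def forb_def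
  by (intro ppred_nth ppred_mem ppred_mem_pair finite_tile_sets ppred_intros pnum_length_of pnum_intros assms)

lemma ppred_bad:
  assumes "ptime n x" "pnum n T" "pnum n c"
  shows "ppred n (\<lambda>xs. csp_bad K (forb' (x xs) (T xs)) (c xs))"
  unfolding csp_bad_def by (intro ppred_forb pnum_csp_cell pnum_intros assms)

lemma pnum_var:
  assumes "ptime n x" "pnum n T" "pnum n c"
  shows "pnum n (\<lambda>xs. csp_var K (off (T xs)) (forb' (x xs) (T xs)) (c xs))"
  unfolding csp_var_def off_def
  by (intro pnum_if ppred_bad ppred_intros pnum_csp_cell pnum_intros assms)

lemma pnum_nC: "pnum n T \<Longrightarrow> pnum n (\<lambda>xs. nC (T xs))"
  unfolding nC_def by (intro pnum_intros)

lemma pnum_nE: "pnum n T \<Longrightarrow> pnum n (\<lambda>xs. nE (T xs))"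
  unfolding nE_def by (intro pnum_intros pnum_nC)

lemma ptime_inst:
  assumes T: "\<And>n. 0 < n \<Longrightarrow> pnum n (\<lambda>xs. Tf (xs ! 0))"
  shows "ptime 1 (\<lambda>xs. enc_KS2 (13 / 36) (inst (xs ! 0) (Tf (xs ! 0))))"
  unfolding inst_def ks_vecs_def
proof (rule ptime_enc_vecs[where d = "\<lambda>x. nE (Tf x) + nC (Tf x)" and m = "\<lambda>x. 5 * nE (Tf x) + nC (Tf x)"])
  show "pnum 1 (\<lambda>xs. nE (Tf (xs ! 0)) + nC (Tf (xs ! 0)))" "pnum 1 (\<lambda>xs. 5 * nE (Tf (xs ! 0)) + nC (Tf (xs ! 0)))"
    by (intro pnum_intros pnum_nE pnum_nC T; simp)+
  have "ptime 3 (\<lambda>xs. xs ! 0)" "pnum 3 (\<lambda>xs. length (xs ! 1))" "pnum 3 (\<lambda>xs. length (xs ! 2))"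
    "pnum 3 (\<lambda>xs. Tf (xs ! 0))"
    by (intro ptime_arg pnum_length T; simp)+
  then show "ptime 3 (\<lambda>xs. enc_rat (ks_entry (nE (Tf (xs ! 0))) (nae_pi (nC (Tf (xs ! 0))))
       (nae_tap (nC (Tf (xs ! 0))) K (csp_var K (off (Tf (xs ! 0))) (forb' (xs ! 0) (Tf (xs ! 0)))) (csp_bad K (forb' (xs ! 0) (Tf (xs ! 0)))))
       (nae_cl (nC (Tf (xs ! 0)))) (length (xs ! 1)) (length (xs ! 2))))"
    by (intro ptime_ks_entry ppred_nae_tap pnum_var ppred_bad pnum_nae_pi pnum_nae_cl pnum_nE pnum_nC pnum_div pnum_const)
qed

lemma ptime_witness:
  assumes T: "\<And>n. 0 < n \<Longrightarrow> pnum n (\<lambda>xs. Tf (xs ! 0))"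
  shows "ptime 2 (\<lambda>xs. witness (Tf (xs ! 0)) (assignment (Tf (xs ! 0)) (xs ! 1)))"
proof -
  let ?S = "\<lambda>b. {s. s < K \<and> tb s ! 1 = b}"
  let ?o = "\<lambda>s. if s \<in> ?S 1 then [False] else if s \<in> ?S 2 then [True] else []"
  have u: "pnum 2 (\<lambda>xs. 2 * Tf (xs ! 0) + 1)" by (intro pnum_intros T) simp
  have "ptime 4 (\<lambda>xs. xs ! 1)" "pnum 4 (\<lambda>xs. length (xs ! 2))" "pnum 4 (\<lambda>xs. length (xs ! 3))" "pnum 4 (\<lambda>xs. Tf (xs ! 0))"
    by (intro ptime_arg pnum_length T; simp)+
  then have "ptime 4 (\<lambda>xs. if assignment (Tf (xs ! 0)) (xs ! 1) ((2 * Tf (xs ! 0) + length (xs ! 2)) * K + length (xs ! 3)) then ?o (length (xs ! 3)) else [])"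
    unfolding assignment_def
    by (intro ptime_if ptime_const ppred_nth ppred_mem ppred_not ppred_iff pnum_nC pnum_intros) simp_all
  then have "ptime 3 (\<lambda>xs. concat (map (\<lambda>s. if assignment (Tf (xs ! 0)) (xs ! 1) ((2 * Tf (xs ! 0) + length (xs ! 2)) * K + s) then ?o s else []) [0..<K]))"
    by (intro ptime_for[OF pnum_const]) (simp add: numeral_eq_Suc)
  then have "ptime 2 (\<lambda>xs. concat (map (\<lambda>i. concat (map (\<lambda>s. if assignment (Tf (xs ! 0)) (xs ! 1) ((2 * Tf (xs ! 0) + i) * K + s) then ?o s else []) [0..<K])) [0..<2 * Tf (xs ! 0) + 1]))"
    by (intro ptime_for[OF u]) (simp add: numeral_eq_Suc)
  then show ?thesis
    unfolding witness_def
    by (rule ptime_cong) (intro arg_cong[of _ _ concat] map_cong refl, auto simp: outs_def)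
qed

end

lemma tableau_exists:
  assumes "tm_wf M" "2 \<le> tm_tapes M"
  obtains K tile_of where "tableau M K tile_of"
proof -
  define Z where "Z = {ss. set ss \<subseteq> {..<tm_symbols M} \<and> length ss = tm_tapes M}"
  have "finite Z" unfolding Z_def by (rule finite_lists_length_eq) simp
  then have "finite ({..tm_states M} \<times> Z \<times> Z \<times> Z \<times> Z)" by simp
  then obtain ts where ts: "set ts = {..tm_states M} \<times> Z \<times> Z \<times> Z \<times> Z" using finite_list by blast
  have "replicate (tm_tapes M) 0 \<in> Z" using assms(1) unfolding Z_def tm_wf_def by (auto simp: set_replicate_conv_if)
  then have "(0, replicate (tm_tapes M) 0, replicate (tm_tapes M) 0, replicate (tm_tapes M) 0, replicate (tm_tapes M) 0) \<in> set ts"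
    unfolding ts by simp
  then have "ts \<noteq> []" by auto
  \<comment> \<open>The list of tiles is doubled to have at least two values even if there is only
    one tile.\<close>
  have "tableau M (length (ts @ ts)) ((!) (ts @ ts))"
  proof
    show "2 \<le> length (ts @ ts)" using \<open>ts \<noteq> []\<close> by (cases ts) auto
    have "(!) (ts @ ts) ` {..<length (ts @ ts)} = set (ts @ ts)" unfolding set_conv_nth by blast
    then show "(!) (ts @ ts) ` {..<length (ts @ ts)} = {..tm_states M} \<times> {ss. set ss \<subseteq> {..<tm_symbols M} \<and> length ss = tm_tapes M} \<times>
        {ss. set ss \<subseteq> {..<tm_symbols M} \<and> length ss = tm_tapes M} \<times>
        {ss. set ss \<subseteq> {..<tm_symbols M} \<and> length ss = tm_tapes M} \<times>
        {ss. set ss \<subseteq> {..<tm_symbols M} \<and> length ss = tm_tapes M}"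
      using ts unfolding Z_def by simp
  qed (use assms in auto)
  then show ?thesis by (rule that)
qed

text \<open>One map serves both claims: a certificate gives an exact splitting, and any approximate
  solution gives back a certificate.\<close>

lemma reduction:
  assumes "polytime_rel R" "poly_balanced R"
  shows "\<exists>f g. polytime_fun f \<and> polytime_fun2 g \<and>
    (\<forall>x z. KS2_rel (1 / (4 * sqrt 2)) (f x) z \<longrightarrow> R x (g x z)) \<and>
    (\<forall>x. \<exists>d \<alpha> vs. f x = enc_KS2 \<alpha> vs \<and> KS2_code d \<alpha> vs \<and>
       ((\<exists>y. R x y) \<longrightarrow> (\<exists>S. KS2_solution (1 / (4 * sqrt 2)) d (of_rat \<alpha>) (real_vec ` set vs) S) \<and>
         KS2_W d (real_vec ` set vs) = 0))"
proof -
  obtain M c e where M: "tm_wf M" "2 \<le> tm_tapes M"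
    and comp: "\<And>xs. length xs = 2 \<Longrightarrow> tm_computes_within M xs [R (xs ! 0) (xs ! 1)] (c * (\<Sum>x\<leftarrow>xs. length x) ^ e + c)"
    using assms(1) unfolding polytime_rel_def polytime_def by blast
  obtain c' e' where bal: "\<And>x y. R x y \<Longrightarrow> length y \<le> c' * length x ^ e' + c'"
    using assms(2) unfolding poly_balanced_def by blast
  obtain K tile_of where "tableau M K tile_of" using tableau_exists[OF M] by blast
  then interpret tableau M K tile_of .
  \<comment> \<open>The running time for the longest certificate that the balance condition allows;
    the successor keeps it positive.\<close>
  define Tf where "Tf x = Suc (c * (length x + (c' * length x ^ e' + c')) ^ e + c)" for x :: "bool list"
  have T: "0 < Tf x" for x by (simp add: Tf_def)
  have pT: "pnum n (\<lambda>xs. Tf (xs ! 0))" if "0 < n" for n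
    unfolding Tf_def by (intro pnum_intros pnum_length that)
  have R: "tm_computes_within M [x, y] [R x y] (c * (length x + length y) ^ e + c)" for x y
    using comp[of "[x, y]"] by simp
  define f where "f x = enc_KS2 (13 / 36) (inst x (Tf x))" for x
  define g where "g x z = witness (Tf x) (assignment (Tf x) z)" for x z
  have "polytime_fun f" unfolding polytime_fun_def f_def by (rule ptime_imp_polytime[OF ptime_inst[OF pT]]) simp_all
  moreover have "polytime_fun2 g" unfolding polytime_fun2_def g_def
    by (rule ptime_imp_polytime[OF ptime_witness[OF pT]]) simp_all
  \<comment> \<open>The decoded word makes the machine halt by time \<open>Tf x\<close>, and halting
    configurations are unique. Had the verifier rejected, its output symbol 1 would lie within
    distance \<open>Tf x\<close> of the head, where the tableau excludes it.\<close>
  moreover have "R x (g x z)" if "KS2_rel (1 / (4 * sqrt 2)) (f x) z" for x z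
    using inst_props(2)[OF T, of x x z] that accept_iff(1)[OF R, of x "g x z" "Tf x"] unfolding f_def g_def by blast
  moreover have "\<exists>d \<alpha> vs. f x = enc_KS2 \<alpha> vs \<and> KS2_code d \<alpha> vs \<and>
       ((\<exists>y. R x y) \<longrightarrow> (\<exists>S. KS2_solution (1 / (4 * sqrt 2)) d (of_rat \<alpha>) (real_vec ` set vs) S) \<and>
         KS2_W d (real_vec ` set vs) = 0)" for x
  proof (rule exI, rule exI, rule exI, intro conjI impI)
    show "f x = enc_KS2 (13 / 36) (inst x (Tf x))" by (rule f_def)
    show "KS2_code (nE (Tf x) + nC (Tf x)) (13 / 36) (inst x (Tf x))" by (rule inst_props(1)[OF T])
    assume "\<exists>y. R x y"
    then obtain y where y: "R x y" by blast
    obtain t where t: "t \<le> c * (length x + length y) ^ e + c" "fst (cfg x y t) = tm_states M"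
      using R[of x y] unfolding tm_computes_within_def cfg_def by (auto simp: case_prod_beta)
    have "(length x + length y) ^ e \<le> (length x + (c' * length x ^ e' + c')) ^ e"
      using bal[OF y] by (intro power_mono) auto
    then have "c * (length x + length y) ^ e + c \<le> c * (length x + (c' * length x ^ e' + c')) ^ e + c" by simp
    then have "t \<le> Tf x" using t(1) unfolding Tf_def by linarith
    from halted_stable[OF t(2) this] t(2) have h: "fst (cfg x y (Tf x)) = tm_states M" by simp
    from inst_props(3)[OF T h accept_iff(2)[OF R h y]]
    show "\<exists>S. KS2_solution (1 / (4 * sqrt 2)) (nE (Tf x) + nC (Tf x)) (of_rat (13 / 36)) (real_vec ` set (inst x (Tf x))) S"
      "KS2_W (nE (Tf x) + nC (Tf x)) (real_vec ` set (inst x (Tf x))) = 0" by blast+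
  qed
  ultimately show ?thesis by (intro exI[of _ f] exI[of _ g] conjI allI impI)
qed

theorem theorem2:
  shows "FNP_hard KS2_codes (KS2_rel (1 / (4 * sqrt 2)))
    \<and> NP_hard_to_distinguish KS2_codes_W_zero (KS2_codes_W_ge (1 / (4 * sqrt 2)))"
proof
  show "FNP_hard KS2_codes (KS2_rel (1 / (4 * sqrt 2)))"
    unfolding FNP_hard_def
  proof
    fix Q assume "Q \<in> FNP"
    then have Q: "polytime_rel Q" "poly_balanced Q" unfolding FNP_def by auto
    from reduction[OF Q] obtain f g where fg: "polytime_fun f" "polytime_fun2 g"
      "\<forall>x z. KS2_rel (1 / (4 * sqrt 2)) (f x) z \<longrightarrow> Q x (g x z)"
      "\<forall>x. \<exists>d \<alpha> vs. f x = enc_KS2 \<alpha> vs \<and> KS2_code d \<alpha> vs \<and>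
        ((\<exists>y. Q x y) \<longrightarrow> (\<exists>S. KS2_solution (1 / (4 * sqrt 2)) d (of_rat \<alpha>) (real_vec ` set vs) S) \<and>
         KS2_W d (real_vec ` set vs) = 0)"
      by (elim exE conjE)
    have "f x \<in> KS2_codes" for x using fg(4)[rule_format, of x] unfolding KS2_codes_def by blast
    moreover have "\<exists>z. KS2_rel (1 / (4 * sqrt 2)) (f x) z" if "Q x y" for x y
      using fg(4)[rule_format, of x] that KS2_rel_of_solution by metis
    ultimately show "fnp_reduces Q KS2_codes (KS2_rel (1 / (4 * sqrt 2)))"
      unfolding fnp_reduces_def using fg(1-3) by blast
  qed
  show "NP_hard_to_distinguish KS2_codes_W_zero (KS2_codes_W_ge (1 / (4 * sqrt 2)))"
    unfolding NP_hard_to_distinguish_def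
  proof
    fix N assume "N \<in> NP"
    then obtain R where N: "N = {x. \<exists>y. R x y}" and R: "polytime_rel R" "poly_balanced R" unfolding NP_def by auto
    from reduction[OF R] obtain f g where fg: "polytime_fun f" "polytime_fun2 g"
      "\<forall>x z. KS2_rel (1 / (4 * sqrt 2)) (f x) z \<longrightarrow> R x (g x z)"
      "\<forall>x. \<exists>d \<alpha> vs. f x = enc_KS2 \<alpha> vs \<and> KS2_code d \<alpha> vs \<and>
        ((\<exists>y. R x y) \<longrightarrow> (\<exists>S. KS2_solution (1 / (4 * sqrt 2)) d (of_rat \<alpha>) (real_vec ` set vs) S) \<and>
         KS2_W d (real_vec ` set vs) = 0)"
      by (elim exE conjE)
    have "f x \<in> KS2_codes_W_zero" if "x \<in> N" for x
      using fg(4)[rule_format, of x] that unfolding KS2_codes_W_zero_def N by blast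
    \<comment> \<open>Off the language no selection at all is a solution, since \<open>g\<close>
      would turn it into a certificate.\<close>
    moreover have "f x \<in> KS2_codes_W_ge (1 / (4 * sqrt 2))" if "x \<notin> N" for x
    proof -
      obtain d \<alpha> vs where f: "f x = enc_KS2 \<alpha> vs" "KS2_code d \<alpha> vs" using fg(4)[rule_format, of x] by blast
      have "\<not> KS2_solution (1 / (4 * sqrt 2)) d (of_rat \<alpha>) (real_vec ` set vs) S" for S
        using KS2_rel_of_solution[OF f(2)] fg(3)[rule_format, of x] that f(1) unfolding N by (metis mem_Collect_eq)
      then have "1 / (4 * sqrt 2) * sqrt (of_rat \<alpha>) \<le> KS2_W d (real_vec ` set vs)"
        using KS2_W_ge f(2) unfolding KS2_code_def by blast
      then show ?thesis using f unfolding KS2_codes_W_ge_def by blast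
    qed
    ultimately show "\<exists>f. polytime_fun f \<and> (\<forall>x. (x \<in> N \<longrightarrow> f x \<in> KS2_codes_W_zero) \<and>
        (x \<notin> N \<longrightarrow> f x \<in> KS2_codes_W_ge (1 / (4 * sqrt 2))))"
      using fg(1) by blast
  qed
qed

end
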